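(* Let $n \geq 2$ and, for $j = 1,\dots,n$, let $\Omega_j \subset \mathbb{R}^{d_j}$ with $d_j \in \mathbb{N}$ be open, and let $\Gamma_j$ be a closed subset of $\partial\Omega_j$. Put $\Omega = \Omega_1 \times \dots \times \Omega_n \subset \mathbb{R}^d$ with $d = d_1 + \dots + d_n$, and define the closed subset $\Gamma \subset \partial\Omega$ by \[ \Gamma := \bigl( \Gamma_1 \times \overline{\Omega}_2 \times \dots \times \overline{\Omega}_n \bigr) \cup \dots \cup \bigl( \overline{\Omega}_1 \times \dots \times \overline{\Omega}_{n-1} \times \Gamma_n \bigr) \] (the union over $j=1,\dots,n$ of the products whose $j$-th factor is $\Gamma_j$ and whose $l$-th factor is $\overline{\Omega}_l$ for $l \neq j$). Let \[ V := \overline{ \{ u|_\Omega : u \in C_c^\infty(\mathbb{R}^d\setminus\Gamma) \} }^{H^1(\Omega)} \] and let $\Delta_\Omega^V$ be the Laplacian on $\Omega$ with form domain $V$. For each $j$ let \[ \mathcal{H}_j = \overline{ \{ u|_{\Omega_j} : u \in C_c^\infty(\mathbb{R}^{d_j}\setminus\Gamma_j)\} }^{H^1(\Omega_j)}, \] and let $T$ be the self-adjoint operator on $L^2(\Omega)$ associated with $\mathcal{H}_1,\dots,\mathcal{H}_n$ (as defined in the context). Then $T = -\Delta_\Omega^V$ and $V = \bigotimes_{j=1}^n \mathcal{H}_j$.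
   Context: All function spaces consist of complex-valued functions, and inner products are linear in the first argument. $H^1$ is the $L^2$-based first-order Sobolev space; $\overline{\,\cdot\,}^{H^1(\Omega)}$ denotes closure in $H^1(\Omega)$, while $\overline{\Omega}_j$ is the topological closure of $\Omega_j$ in $\mathbb{R}^{d_j}$. For each $j$ let $\mathcal{H}_j$ be a closed subspace of $H^1(\Omega_j)$ that is dense in $L^2(\Omega_j)$. For $f_j \in \mathcal{H}_j$, the elementary tensor $\bigotimes_{j=1}^n f_j \in H^1(\Omega)$ is the function $(x_1,\dots,x_n) \mapsto \prod_{j=1}^n f_j(x_j)$, $x_j \in \Omega_j$. Let $\mathcal{K} = \operatorname{span}_{\mathbb{C}}\{ \bigotimes_{j=1}^n f_j : f_j \in \mathcal{H}_j \} \subset H^1(\Omega)$, and define $\mathcal{H} = \bigotimes_{j=1}^n \mathcal{H}_j$ to be the closure of $\mathcal{K}$ in $H^1(\Omega)$ (with respect to the $H^1(\Omega)$-norm). The form $\mathfrak{t}[f,g] = \sum_{k=1}^d \langle \partial_k f, \partial_k g \rangle_{L^2(\Omega)}$, $f,g \in \mathcal{H}$, is closed, nonnegative, and densely defined on $L^2(\Omega)$. $T$ denotes the unique nonnegative self-adjoint operator on $L^2(\Omega)$ with $\operatorname{Dom}(T) \subset \mathcal{H}$ and $\mathfrak{t}[f,g] = \langle Tf, g\rangle_{L^2(\Omega)}$ for all $f \in \operatorname{Dom}(T)$, $g \in \mathcal{H}$. The Laplacian $\Delta_\Omega^V$ with form domain $V$ is defined by: $-\Delta_\Omega^V$ is the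 unique nonnegative self-adjoint operator on $L^2(\Omega)$ with domain contained in $V$ and $\sum_{k=1}^d \langle \partial_k f, \partial_k g \rangle_{L^2(\Omega)} = \langle -\Delta_\Omega^V f, g\rangle_{L^2(\Omega)}$ for all $f \in \operatorname{Dom}(\Delta_\Omega^V)$, $g \in V$. Equality of unbounded operators includes equality of domains. *)

theory Defs
  imports "HOL-Analysis.Analysis"
begin

text \<open>
  Points of \<open>\<real>\<^sup>d\<close> are the extensional functions in \<open>{..<d} \<rightarrow>\<^sub>E UNIV\<close>, so that the dimension may be
  a term; \<open>\<real>\<^sup>0\<close> is a single point and coordinates are numbered from 0.
\<close>

abbreviation Rtop :: "nat \<Rightarrow> (nat \<Rightarrow> real) topology" where
  "Rtop d \<equiv> powertop_real {..<d}"

abbreviation Rmeas :: "nat \<Rightarrow> (nat \<Rightarrow> real) measure" where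
  "Rmeas d \<equiv> PiM {..<d} (\<lambda>_. lborel)"

abbreviation dom_meas :: "nat \<Rightarrow> (nat \<Rightarrow> real) set \<Rightarrow> (nat \<Rightarrow> real) measure" where
  "dom_meas d \<Omega> \<equiv> restrict_space (Rmeas d) \<Omega>"

section \<open>Test functions\<close>

definition partial_deriv :: "nat \<Rightarrow> ((nat \<Rightarrow> real) \<Rightarrow> complex) \<Rightarrow> (nat \<Rightarrow> real) \<Rightarrow> complex" where
  "partial_deriv i u x = vector_derivative (\<lambda>t. u (x(i := t))) (at (x i))"

fun C_k :: "nat \<Rightarrow> nat \<Rightarrow> ((nat \<Rightarrow> real) \<Rightarrow> complex) \<Rightarrow> bool" where
  "C_k d 0 u \<longleftrightarrow> continuous_map (Rtop d) euclidean u"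
| "C_k d (Suc k) u \<longleftrightarrow> continuous_map (Rtop d) euclidean u \<and>
     (\<forall>i<d. (\<forall>x\<in>topspace (Rtop d). (\<lambda>t. u (x(i := t))) differentiable (at (x i))) \<and>
            C_k d k (partial_deriv i u))"

definition smooth :: "nat \<Rightarrow> ((nat \<Rightarrow> real) \<Rightarrow> complex) \<Rightarrow> bool" where
  "smooth d u \<longleftrightarrow> (\<forall>k. C_k d k u)"

definition supp :: "nat \<Rightarrow> ((nat \<Rightarrow> real) \<Rightarrow> complex) \<Rightarrow> (nat \<Rightarrow> real) set" where
  "supp d u = Rtop d closure_of {x \<in> topspace (Rtop d). u x \<noteq> 0}"

text \<open>\<open>C\<^sub>c\<^sup>\<infinity>(U)\<close> for open \<open>U\<close>, its elements being extended by zero to \<open>\<real>\<^sup>d\<close>.\<close>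

definition test_functions :: "nat \<Rightarrow> (nat \<Rightarrow> real) set \<Rightarrow> ((nat \<Rightarrow> real) \<Rightarrow> complex) set" where
  "test_functions d U = {u. smooth d u \<and> compactin (Rtop d) (supp d u) \<and> supp d u \<subseteq> U}"

section \<open>\<open>L\<^sup>2\<close> and \<open>H\<^sup>1\<close>\<close>

text \<open>
  Elements of \<open>L\<^sup>2(\<Omega>)\<close> are represented by functions whose values outside \<open>\<Omega>\<close> are irrelevant.
  Subspaces of \<open>L\<^sup>2(\<Omega>)\<close> are represented by sets of such functions that are saturated under
  almost everywhere equality on \<open>\<Omega>\<close>, so that equality of subspaces is equality of these sets.
  The sets \<open>L2 d \<Omega>\<close>, \<open>H1 d \<Omega>\<close> and \<open>H1_closure d \<Omega> S\<close> below are saturated. Since every Lebesgue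
  measurable function agrees almost everywhere with a Borel one, Borel representatives suffice.
\<close>

definition L2 :: "nat \<Rightarrow> (nat \<Rightarrow> real) set \<Rightarrow> ((nat \<Rightarrow> real) \<Rightarrow> complex) set" where
  "L2 d \<Omega> = {f \<in> borel_measurable (dom_meas d \<Omega>). integrable (dom_meas d \<Omega>) (\<lambda>x. (cmod (f x))\<^sup>2)}"

definition L2_inner ::
  "nat \<Rightarrow> (nat \<Rightarrow> real) set \<Rightarrow> ((nat \<Rightarrow> real) \<Rightarrow> complex) \<Rightarrow> ((nat \<Rightarrow> real) \<Rightarrow> complex) \<Rightarrow> complex" where
  "L2_inner d \<Omega> f g = (LINT x|dom_meas d \<Omega>. f x * cnj (g x))"

definition L2_norm :: "nat \<Rightarrow> (nat \<Rightarrow> real) set \<Rightarrow> ((nat \<Rightarrow> real) \<Rightarrow> complex) \<Rightarrow> real" where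
  "L2_norm d \<Omega> f = sqrt (LINT x|dom_meas d \<Omega>. (cmod (f x))\<^sup>2)"

definition is_weak_deriv ::
  "nat \<Rightarrow> (nat \<Rightarrow> real) set \<Rightarrow> nat \<Rightarrow> ((nat \<Rightarrow> real) \<Rightarrow> complex) \<Rightarrow> ((nat \<Rightarrow> real) \<Rightarrow> complex) \<Rightarrow> bool" where
  "is_weak_deriv d \<Omega> i f g \<longleftrightarrow>
     (\<forall>\<phi>\<in>test_functions d \<Omega>.
        (LINT x|dom_meas d \<Omega>. f x * partial_deriv i \<phi> x) = - (LINT x|dom_meas d \<Omega>. g x * \<phi> x))"

definition H1 :: "nat \<Rightarrow> (nat \<Rightarrow> real) set \<Rightarrow> ((nat \<Rightarrow> real) \<Rightarrow> complex) set" where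
  "H1 d \<Omega> = {f \<in> L2 d \<Omega>. \<forall>i<d. \<exists>g\<in>L2 d \<Omega>. is_weak_deriv d \<Omega> i f g}"

text \<open>A representative of \<open>\<partial>\<^sub>i f\<close> for \<open>f\<close> in \<open>H\<^sup>1(\<Omega>)\<close>; it is determined up to a null set.\<close>

definition weak_deriv ::
  "nat \<Rightarrow> (nat \<Rightarrow> real) set \<Rightarrow> nat \<Rightarrow> ((nat \<Rightarrow> real) \<Rightarrow> complex) \<Rightarrow> (nat \<Rightarrow> real) \<Rightarrow> complex" where
  "weak_deriv d \<Omega> i f = (SOME g. g \<in> L2 d \<Omega> \<and> is_weak_deriv d \<Omega> i f g)"

definition H1_norm :: "nat \<Rightarrow> (nat \<Rightarrow> real) set \<Rightarrow> ((nat \<Rightarrow> real) \<Rightarrow> complex) \<Rightarrow> real" where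
  "H1_norm d \<Omega> f = sqrt ((L2_norm d \<Omega> f)\<^sup>2 + (\<Sum>i<d. (L2_norm d \<Omega> (weak_deriv d \<Omega> i f))\<^sup>2))"

definition H1_closure ::
  "nat \<Rightarrow> (nat \<Rightarrow> real) set \<Rightarrow> ((nat \<Rightarrow> real) \<Rightarrow> complex) set \<Rightarrow> ((nat \<Rightarrow> real) \<Rightarrow> complex) set" where
  "H1_closure d \<Omega> S = {f \<in> H1 d \<Omega>. \<forall>\<epsilon>>0. \<exists>g\<in>S. H1_norm d \<Omega> (\<lambda>x. f x - g x) < \<epsilon>}"

text \<open>The form domain with Dirichlet condition on \<open>\<Gamma> \<subseteq> \<partial>\<Omega>\<close>; it yields both \<open>V\<close> and the \<open>\<H>\<^sub>j\<close>.\<close>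

definition H1_vanishing ::
  "nat \<Rightarrow> (nat \<Rightarrow> real) set \<Rightarrow> (nat \<Rightarrow> real) set \<Rightarrow> ((nat \<Rightarrow> real) \<Rightarrow> complex) set" where
  "H1_vanishing d \<Omega> \<Gamma> =
     H1_closure d \<Omega> ((\<lambda>u. restrict u \<Omega>) ` test_functions d (topspace (Rtop d) - \<Gamma>))"

section \<open>Unbounded operators on \<open>L\<^sup>2\<close>\<close>

text \<open>
  An operator on \<open>L\<^sup>2(\<Omega>)\<close> is represented by its graph, again saturated under almost everywhere
  equality in both components; equality of graphs is equality of operators including domains.
\<close>

type_synonym l2_graph = "(((nat \<Rightarrow> real) \<Rightarrow> complex) \<times> ((nat \<Rightarrow> real) \<Rightarrow> complex)) set"

definition L2_operator :: "nat \<Rightarrow> (nat \<Rightarrow> real) set \<Rightarrow> l2_graph \<Rightarrow> bool" where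
  "L2_operator d \<Omega> A \<longleftrightarrow>
     A \<subseteq> L2 d \<Omega> \<times> L2 d \<Omega> \<and>
     ((\<lambda>_. 0), (\<lambda>_. 0)) \<in> A \<and>
     (\<forall>(f, h)\<in>A. \<forall>(g, k)\<in>A. ((\<lambda>x. f x + g x), (\<lambda>x. h x + k x)) \<in> A) \<and>
     (\<forall>c. \<forall>(f, h)\<in>A. ((\<lambda>x. c * f x), (\<lambda>x. c * h x)) \<in> A) \<and>
     (\<forall>(f, h)\<in>A. \<forall>g\<in>L2 d \<Omega>. \<forall>k\<in>L2 d \<Omega>.
        (AE x in dom_meas d \<Omega>. f x = g x) \<and> (AE x in dom_meas d \<Omega>. h x = k x) \<longrightarrow> (g, k) \<in> A) \<and>
     (\<forall>(f, h)\<in>A. \<forall>k. (f, k) \<in> A \<longrightarrow> (AE x in dom_meas d \<Omega>. h x = k x))"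

definition densely_defined :: "nat \<Rightarrow> (nat \<Rightarrow> real) set \<Rightarrow> l2_graph \<Rightarrow> bool" where
  "densely_defined d \<Omega> A \<longleftrightarrow>
     (\<forall>f\<in>L2 d \<Omega>. \<forall>\<epsilon>>0. \<exists>g\<in>Domain A. L2_norm d \<Omega> (\<lambda>x. f x - g x) < \<epsilon>)"

definition adjoint_op :: "nat \<Rightarrow> (nat \<Rightarrow> real) set \<Rightarrow> l2_graph \<Rightarrow> l2_graph" where
  "adjoint_op d \<Omega> A =
     {(g, k). g \<in> L2 d \<Omega> \<and> k \<in> L2 d \<Omega> \<and> (\<forall>(f, h)\<in>A. L2_inner d \<Omega> h g = L2_inner d \<Omega> f k)}"

definition self_adjoint :: "nat \<Rightarrow> (nat \<Rightarrow> real) set \<Rightarrow> l2_graph \<Rightarrow> bool" where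
  "self_adjoint d \<Omega> A \<longleftrightarrow> L2_operator d \<Omega> A \<and> densely_defined d \<Omega> A \<and> adjoint_op d \<Omega> A = A"

definition nonneg_op :: "nat \<Rightarrow> (nat \<Rightarrow> real) set \<Rightarrow> l2_graph \<Rightarrow> bool" where
  "nonneg_op d \<Omega> A \<longleftrightarrow> (\<forall>(f, h)\<in>A. L2_inner d \<Omega> h f \<in> \<real>\<^sub>\<ge>\<^sub>0)"

definition op_uminus :: "l2_graph \<Rightarrow> l2_graph" where
  "op_uminus A = (\<lambda>(f, h). (f, (\<lambda>x. - h x))) ` A"

definition grad_form ::
  "nat \<Rightarrow> (nat \<Rightarrow> real) set \<Rightarrow> ((nat \<Rightarrow> real) \<Rightarrow> complex) \<Rightarrow> ((nat \<Rightarrow> real) \<Rightarrow> complex) \<Rightarrow> complex" where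
  "grad_form d \<Omega> f g = (\<Sum>k<d. L2_inner d \<Omega> (weak_deriv d \<Omega> k f) (weak_deriv d \<Omega> k g))"

text \<open>
  \<open>A\<close> is the nonnegative self-adjoint operator associated with the gradient form on \<open>W\<close>. There is
  at most one, see \<open>associated_op_unique\<close>; it exists if \<open>W\<close> is a closed subspace of \<open>H\<^sup>1(\<Omega>)\<close> that is
  dense in \<open>L\<^sup>2(\<Omega>)\<close>.
\<close>

definition associated_op ::
  "nat \<Rightarrow> (nat \<Rightarrow> real) set \<Rightarrow> ((nat \<Rightarrow> real) \<Rightarrow> complex) set \<Rightarrow> l2_graph \<Rightarrow> bool" where
  "associated_op d \<Omega> W A \<longleftrightarrow>
     self_adjoint d \<Omega> A \<and> nonneg_op d \<Omega> A \<and> Domain A \<subseteq> W \<and>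
     (\<forall>(f, h)\<in>A. \<forall>g\<in>W. grad_form d \<Omega> f g = L2_inner d \<Omega> h g)"

definition is_laplacian ::
  "nat \<Rightarrow> (nat \<Rightarrow> real) set \<Rightarrow> ((nat \<Rightarrow> real) \<Rightarrow> complex) set \<Rightarrow> l2_graph \<Rightarrow> bool" where
  "is_laplacian d \<Omega> W \<Delta> \<longleftrightarrow> associated_op d \<Omega> W (op_uminus \<Delta>)"

lemma L2_inner_commute: "cnj (L2_inner d \<Omega> f g) = L2_inner d \<Omega> g f"
  unfolding L2_inner_def
  by (subst Bochner_Integration.integral_cnj [symmetric]) (simp add: mult.commute)

lemma associated_op_unique:
  assumes "associated_op d \<Omega> W A" and "associated_op d \<Omega> W B"
  shows "A = B"
proof -
  have le: "A \<subseteq> B" if A: "associated_op d \<Omega> W A" and B: "associated_op d \<Omega> W B" for A B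
  proof safe
    fix f h assume fh: "(f, h) \<in> A"
    have fW: "f \<in> W" and L: "f \<in> L2 d \<Omega>" "h \<in> L2 d \<Omega>"
      using A fh unfolding associated_op_def self_adjoint_def L2_operator_def by blast+
    have "L2_inner d \<Omega> k f = L2_inner d \<Omega> g h" if gk: "(g, k) \<in> B" for g k
    proof -
      have gW: "g \<in> W" using B gk unfolding associated_op_def by blast
      have "L2_inner d \<Omega> k f = grad_form d \<Omega> g f"
        using B gk fW unfolding associated_op_def by fastforce
      also have "\<dots> = cnj (grad_form d \<Omega> f g)"
        by (simp add: grad_form_def L2_inner_commute)
      also have "grad_form d \<Omega> f g = L2_inner d \<Omega> h g"
        using A fh gW unfolding associated_op_def by fastforce
      finally show ?thesis by (simp add: L2_inner_commute)
    qed
    then have "(f, h) \<in> adjoint_op d \<Omega> B"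
      using L by (auto simp: adjoint_op_def)
    then show "(f, h) \<in> B"
      using B by (simp add: associated_op_def self_adjoint_def)
  qed
  show ?thesis using le assms by blast
qed

section \<open>Products\<close>

text \<open>
  \<open>\<real>\<^sup>d\<close> with \<open>d = d\<^sub>0 + \<dots> + d\<^bsub>n-1\<^esub>\<close> is identified with the product of the \<open>\<real>\<^bsup>d\<^sub>j\<^esup>\<close> by concatenation of
  coordinates; \<open>block d j x\<close> is the component \<open>x\<^sub>j\<close>.
\<close>

definition block :: "(nat \<Rightarrow> nat) \<Rightarrow> nat \<Rightarrow> (nat \<Rightarrow> real) \<Rightarrow> nat \<Rightarrow> real" where
  "block d j x = (\<lambda>i\<in>{..<d j}. x ((\<Sum>l<j. d l) + i))"

definition prod_set :: "nat \<Rightarrow> (nat \<Rightarrow> nat) \<Rightarrow> (nat \<Rightarrow> (nat \<Rightarrow> real) set) \<Rightarrow> (nat \<Rightarrow> real) set" where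
  "prod_set n d S = {x \<in> topspace (Rtop (\<Sum>j<n. d j)). \<forall>j<n. block d j x \<in> S j}"

definition prod_Gamma ::
  "nat \<Rightarrow> (nat \<Rightarrow> nat) \<Rightarrow> (nat \<Rightarrow> (nat \<Rightarrow> real) set) \<Rightarrow> (nat \<Rightarrow> (nat \<Rightarrow> real) set) \<Rightarrow> (nat \<Rightarrow> real) set" where
  "prod_Gamma n d \<Omega> \<Gamma> = (\<Union>j<n. prod_set n d (\<lambda>l. if l = j then \<Gamma> l else Rtop (d l) closure_of \<Omega> l))"

definition elem_tensor ::
  "nat \<Rightarrow> (nat \<Rightarrow> nat) \<Rightarrow> (nat \<Rightarrow> (nat \<Rightarrow> real) \<Rightarrow> complex) \<Rightarrow> (nat \<Rightarrow> real) \<Rightarrow> complex" where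
  "elem_tensor n d f x = (\<Prod>j<n. f j (block d j x))"

definition complex_span :: "('a \<Rightarrow> complex) set \<Rightarrow> ('a \<Rightarrow> complex) set" where
  "complex_span S = {(\<lambda>x. \<Sum>g\<in>t. c g * g x) | t c. finite t \<and> t \<subseteq> S}"

definition H1_tensor ::
  "nat \<Rightarrow> (nat \<Rightarrow> nat) \<Rightarrow> (nat \<Rightarrow> (nat \<Rightarrow> real) set) \<Rightarrow> (nat \<Rightarrow> ((nat \<Rightarrow> real) \<Rightarrow> complex) set)
     \<Rightarrow> ((nat \<Rightarrow> real) \<Rightarrow> complex) set" where
  "H1_tensor n d \<Omega> H =
     H1_closure (\<Sum>j<n. d j) (prod_set n d \<Omega>) (complex_span {elem_tensor n d f | f. \<forall>j<n. f j \<in> H j})"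

end

theory Submission
  imports Defs
begin

text \<open>
  The two operators have the forms that define them on \<open>V\<close> and on the tensor product, so everything
  reduces to the equality of the form domains. A tensor of functions \<open>f\<^sub>j \<in> \<H>\<^sub>j\<close> lies in \<open>V\<close>: replacing
  the factors one at a time by test functions changes the \<open>H\<^sup>1\<close> norm little, because \<open>L\<^sup>2\<close> norms of
  tensors are products. Conversely let \<open>u\<close> be a test function vanishing near \<open>\<Gamma>\<close>. The projections
  of \<open>supp u \<inter> closure \<Omega>\<close> to the factors are compact and do not meet the \<open>\<Gamma>\<^sub>j\<close>, since the other
  components lie in the closures of the \<open>\<Omega>\<^sub>l\<close>; so there are cutoffs \<open>\<eta>\<^sub>j\<close>, test functions off \<open>\<Gamma>\<^sub>j\<close>, with
  \<open>u = u \<cdot> (\<eta>\<^sub>1 \<otimes> \<dots> \<otimes> \<eta>\<^sub>n)\<close> on \<open>\<Omega>\<close>. Approximating the left factor in \<open>C\<^sup>1\<close> by Bernstein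
  polynomials in one variable after the other turns the right hand side into a sum of tensors of test functions.
  That weak derivatives are unique is needed to work with \<open>H1_norm\<close>, which is defined through a choice of them.
\<close>

section \<open>One-variable calculus and a smooth step built from exp(-1/t)\<close>

section \<open>Smooth functions\<close>

text \<open>Two obstacles shape the proof. One is that derivatives have to be approximated along
  with values. For tensors this is tame: each coordinate belongs to one factor, so a partial
  derivative of a tensor is again a tensor. For a test function the Bernstein operator in one
  variable is suited to it: its weights depend on that variable alone, so it commutes with the other
  partial derivatives, and its own derivative is a Bernstein sum of difference quotients.
  Polynomials respect neither compact supports nor \<Gamma>, hence the cutoff factor stays outside
  the approximation and is multiplied back; as it is supported in a cube, C^1 closeness on that cube
  controls the H^1 norm. Errors are not accumulated over the variables, since each stage uses that
  the tensor product space is closed. The other obstacle is that the boundary of \<Omega> is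
  arbitrary: integration by parts is carried out on the whole space, against test functions
  supported in \<Omega>. Because the dimension is a term, derivatives are taken along coordinate
  lines \<open>x(i := t)\<close>.\<close>

fun cdiff :: "nat \<Rightarrow> (real \<Rightarrow> real) \<Rightarrow> bool" where
  "cdiff 0 f \<longleftrightarrow> continuous_on UNIV f"
| "cdiff (Suc k) f \<longleftrightarrow> (\<exists>f'. (\<forall>t. (f has_real_derivative f' t) (at t)) \<and> cdiff k f')"

lemma cdiff_SucI:
  "(\<And>t. (f has_real_derivative f' t) (at t)) \<Longrightarrow> cdiff k f' \<Longrightarrow> cdiff (Suc k) f"
  by auto

lemma cdiff_SucD: "cdiff (Suc k) f \<Longrightarrow> cdiff k f"
proof (induction k arbitrary: f)
  case 0
  then show ?case
    by (auto simp: continuous_on_eq_continuous_at intro: DERIV_isCont)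
next
  case (Suc k)
  then obtain f' where "\<forall>t. (f has_real_derivative f' t) (at t)" "cdiff (Suc k) f'"
    by auto
  with Suc.IH[of f'] show ?case by auto
qed

lemma cdiff_const: "cdiff k (\<lambda>_. c)"
  by (induction k arbitrary: c) (auto intro!: exI[of _ "\<lambda>_. 0"])

lemma cdiff_ident: "cdiff k (\<lambda>t. t)"
  by (cases k) (auto intro!: exI[of _ "\<lambda>_. 1"] cdiff_const)

lemma cdiff_add: "cdiff k f \<Longrightarrow> cdiff k g \<Longrightarrow> cdiff k (\<lambda>t. f t + g t)"
proof (induction k arbitrary: f g)
  case 0
  then show ?case by (auto intro: continuous_on_add)
next
  case (Suc k)
  then obtain f' g' where "\<forall>t. (f has_real_derivative f' t) (at t)" "cdiff k f'"
    "\<forall>t. (g has_real_derivative g' t) (at t)" "cdiff k g'" by auto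
  then show ?case using Suc.IH[of f' g']
    by (auto intro!: exI[of _ "\<lambda>t. f' t + g' t"] DERIV_add)
qed

lemma cdiff_mult: "cdiff k f \<Longrightarrow> cdiff k g \<Longrightarrow> cdiff k (\<lambda>t. f t * g t)"
proof (induction k arbitrary: f g)
  case 0
  then show ?case by (auto intro: continuous_on_mult)
next
  case (Suc k)
  then obtain f' g' where D: "\<forall>t. (f has_real_derivative f' t) (at t)" "cdiff k f'"
    "\<forall>t. (g has_real_derivative g' t) (at t)" "cdiff k g'" by auto
  have "cdiff k (\<lambda>t. f' t * g t + g' t * f t)"
    using D Suc.prems by (intro cdiff_add Suc.IH cdiff_SucD[of k f] cdiff_SucD[of k g])
  then show ?case using D
    by (auto intro!: exI[of _ "\<lambda>t. f' t * g t + g' t * f t"] DERIV_mult)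
qed

lemma cdiff_inverse:
  assumes "\<And>t. g t \<noteq> 0"
  shows "cdiff k g \<Longrightarrow> cdiff k (\<lambda>t. inverse (g t))"
proof (induction k)
  case 0
  then show ?case using assms by (auto intro: continuous_on_inverse)
next
  case (Suc k)
  then obtain g' where D: "\<forall>t. (g has_real_derivative g' t) (at t)" "cdiff k g'" by auto
  \<comment> \<open>The derivative -g'/g^2 is written as a product in which the inverse occurs
    twice, so that the induction hypothesis covers it.\<close>
  have "cdiff k (\<lambda>t. -1 * ((inverse (g t) * g' t) * inverse (g t)))"
    using D cdiff_SucD[OF Suc.prems] by (intro cdiff_mult cdiff_const Suc.IH)
  moreover have "((\<lambda>t. inverse (g t)) has_real_derivative
      -1 * ((inverse (g t) * g' t) * inverse (g t))) (at t)" for t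
    using D(1) assms[of t] by (auto intro!: derivative_eq_intros)
  ultimately show ?case by (intro cdiff_SucI)
qed

lemma cdiff_affine: "cdiff k f \<Longrightarrow> cdiff k (\<lambda>t. f (a * t + b))"
proof (induction k arbitrary: f)
  case 0
  then show ?case
    by (auto intro!: continuous_on_compose2[of UNIV f] continuous_intros)
next
  case (Suc k)
  then obtain f' where D: "\<forall>t. (f has_real_derivative f' t) (at t)" "cdiff k f'" by auto
  have "cdiff k (\<lambda>t. f' (a * t + b) * a)"
    by (intro cdiff_mult cdiff_const Suc.IH D)
  moreover have "((\<lambda>t. f (a * t + b)) has_real_derivative f' (a * t + b) * a) (at t)" for t
    by (rule DERIV_chain2[where g = "\<lambda>t. a * t + b"]) (use D in \<open>auto intro!: derivative_eq_intros\<close>)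
  ultimately show ?case by (intro cdiff_SucI)
qed

lemma cdiff_power: "cdiff k f \<Longrightarrow> cdiff k (\<lambda>t. f t ^ m)"
  by (induction m) (auto intro: cdiff_const cdiff_mult)

text \<open>The classical flat function exp(-1/t), extended by zero, with a polynomial factor in
  1/t. The factor makes the family closed under differentiation, so one induction over all
  polynomials reaches every order.\<close>

definition flat_fun :: "real poly \<Rightarrow> real \<Rightarrow> real" where
  "flat_fun p t = (if t > 0 then poly p (1 / t) * exp (- (1 / t)) else 0)"

lemma poly_times_exp_minus_tendsto_0: "((\<lambda>s::real. poly p s * exp (- s)) \<longlongrightarrow> 0) at_top"
proof -
  have "((\<lambda>s::real. \<Sum>i\<le>degree p. coeff p i * (s ^ i / exp s)) \<longlongrightarrow> (\<Sum>i\<le>degree p. coeff p i * 0)) at_top"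
    by (intro tendsto_sum tendsto_mult tendsto_const tendsto_power_div_exp_0)
  moreover have "(\<Sum>i\<le>degree p. coeff p i * (s ^ i / exp s)) = poly p s * exp (- s)" for s
    by (simp only: poly_altdef sum_distrib_right) (simp add: exp_minus field_simps)
  ultimately show ?thesis by simp
qed

text \<open>With s = 1/t one has d/dt = -s^2 d/ds, and p(s) exp(-s) has s-derivative (p' - p)(s)
  exp(-s); this gives the new polynomial s^2 (p - p'). Only t = 0 takes a limit.\<close>

lemma flat_fun_has_derivative:
  "(flat_fun p has_real_derivative flat_fun ([:0, 0, 1:] * (p - pderiv p)) t) (at t)"
proof -
  consider "t > 0" | "t < 0" | "t = 0" by linarith
  then show ?thesis
  proof cases
    case 1
    have "((\<lambda>t. poly p (1 / t) * exp (- (1 / t))) has_real_derivative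
        flat_fun ([:0, 0, 1:] * (p - pderiv p)) t) (at t)"
      using 1 by (auto intro!: derivative_eq_intros DERIV_chain2[OF poly_DERIV]
          simp: flat_fun_def field_simps power2_eq_square)
    moreover have "\<forall>\<^sub>F s in nhds t. poly p (1 / s) * exp (- (1 / s)) = flat_fun p s"
      using eventually_nhds_in_open[of "{0<..}" t] 1
      by (auto elim!: eventually_mono simp: flat_fun_def)
    ultimately show ?thesis
      using DERIV_cong_ev[OF refl, of "\<lambda>t. poly p (1 / t) * exp (- (1 / t))" "flat_fun p" t] by blast
  next
    case 2
    have "\<forall>\<^sub>F s in nhds t. 0 = flat_fun p s"
      using eventually_nhds_in_open[of "{..<0}" t] 2
      by (auto elim!: eventually_mono simp: flat_fun_def)
    then have "(flat_fun p has_real_derivative 0) (at t)"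
      using DERIV_cong_ev[OF refl, of "\<lambda>_. 0" "flat_fun p" t 0] by simp
    then show ?thesis using 2 by (simp add: flat_fun_def)
  next
    case 3
    \<comment> \<open>Dividing by t multiplies by s = 1/t, that is, replaces \<open>p\<close> by
      \<open>pCons 0 p\<close>; exponential decay beats this polynomial as well.\<close>
    have lim: "((\<lambda>t. flat_fun p t / t) \<longlongrightarrow> 0) (at_right 0)"
    proof -
      have "((\<lambda>t. poly (pCons 0 p) (inverse t) * exp (- inverse t)) \<longlongrightarrow> 0) (at_right 0)"
        by (rule filterlim_compose[OF poly_times_exp_minus_tendsto_0 filterlim_inverse_at_top_right])
      moreover have "\<forall>\<^sub>F t in at_right 0.
          poly (pCons 0 p) (inverse t) * exp (- inverse t) = flat_fun p t / t"
        using eventually_at_right_less[of "0::real"]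
        by eventually_elim (simp add: flat_fun_def field_simps)
      ultimately show ?thesis by (rule Lim_transform_eventually)
    qed
    moreover have "((\<lambda>t. flat_fun p t / t) \<longlongrightarrow> 0) (at_left 0)"
    proof (rule Lim_transform_eventually[OF tendsto_const])
      show "\<forall>\<^sub>F t in at_left 0. 0 = flat_fun p t / t"
        by (rule eventually_at_leftI[of "-1"]) (auto simp: flat_fun_def)
    qed
    ultimately have "((\<lambda>t. flat_fun p t / t) \<longlongrightarrow> 0) (at 0)"
      by (simp add: filterlim_split_at)
    then show ?thesis using 3 by (simp add: DERIV_def flat_fun_def)
  qed
qed

lemma cdiff_flat_fun: "cdiff k (flat_fun p)"
proof (induction k arbitrary: p)
  case 0
  show ?case
    using flat_fun_has_derivative[of p]
    by (auto simp: continuous_on_eq_continuous_at intro: DERIV_isCont)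
next
  case (Suc k)
  then show ?case using flat_fun_has_derivative[of p] by (auto simp del: mult_pCons_left)
qed

text \<open>The usual smooth transition: the numerator vanishes for t \<le> 0, and the second
  summand of the denominator for t \<ge> 1.\<close>

definition smooth_step :: "real \<Rightarrow> real" where
  "smooth_step t = flat_fun 1 t * inverse (flat_fun 1 t + flat_fun 1 (1 - t))"

lemma smooth_step_denominator_pos: "flat_fun 1 t + flat_fun 1 (1 - t) > 0"
  by (auto simp: flat_fun_def intro: add_pos_pos)

lemma cdiff_smooth_step: "cdiff k smooth_step"
proof -
  have 1: "cdiff k (\<lambda>t. flat_fun 1 (1 - t))"
    using cdiff_affine[OF cdiff_flat_fun[of k 1], of "-1" 1] by simp
  show ?thesis
    unfolding smooth_step_def[abs_def]
    by (intro cdiff_mult cdiff_flat_fun cdiff_inverse cdiff_add 1)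
      (metis smooth_step_denominator_pos less_irrefl)
qed

lemma smooth_step_nonpos: "t \<le> 0 \<Longrightarrow> smooth_step t = 0"
  by (simp add: smooth_step_def flat_fun_def)

lemma smooth_step_ge_1: "t \<ge> 1 \<Longrightarrow> smooth_step t = 1"
  by (simp add: smooth_step_def flat_fun_def)

lemma smooth_step_bounds: "0 \<le> smooth_step t" "smooth_step t \<le> 1"
proof -
  have "0 \<le> flat_fun 1 t" "0 \<le> flat_fun 1 (1 - t)"
    by (auto simp: flat_fun_def)
  then show "0 \<le> smooth_step t" "smooth_step t \<le> 1"
    using smooth_step_denominator_pos[of t] by (auto simp: smooth_step_def divide_inverse[symmetric])
qed

section \<open>Calculus along coordinate lines, for functions on extensional points\<close>

subsection \<open>Functions of several variables\<close>

lemma topspace_Rtop [simp]: "topspace (Rtop d) = PiE {..<d} (\<lambda>_. UNIV)"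
  by simp

lemma fun_upd_in_Rtop: "i < d \<Longrightarrow> x \<in> PiE {..<d} (\<lambda>_. UNIV) \<Longrightarrow> x(i := t) \<in> PiE {..<d} (\<lambda>_. UNIV)"
  by (auto simp: PiE_def extensional_def)

lemma partial_deriv_eqI:
  assumes "((\<lambda>t. u (x(i := t))) has_vector_derivative D) (at (x i))"
  shows "partial_deriv i u x = D"
  unfolding partial_deriv_def by (rule vector_derivative_at[OF assms])

lemma partial_deriv_cong:
  assumes "i < d" "x \<in> topspace (Rtop d)" "\<And>y. y \<in> topspace (Rtop d) \<Longrightarrow> u y = v y"
  shows "partial_deriv i u x = partial_deriv i v x"
  unfolding partial_deriv_def using assms by (simp add: fun_upd_in_Rtop)

text \<open>Functions are total, but a coordinate line through an extensional point consists of
  extensional points, so values elsewhere never enter.\<close>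

lemma C_k_cong:
  "(\<And>x. x \<in> topspace (Rtop d) \<Longrightarrow> u x = v x) \<Longrightarrow> C_k d k u = C_k d k v"
proof (induction k arbitrary: u v)
  case 0
  then show ?case by (auto intro: continuous_map_eq)
next
  case (Suc k)
  have "continuous_map (Rtop d) euclidean u = continuous_map (Rtop d) euclidean v"
    using Suc.prems by (auto intro: continuous_map_eq)
  moreover have "(\<lambda>t. u (x(i := t))) = (\<lambda>t. v (x(i := t)))" if "i < d" "x \<in> topspace (Rtop d)" for i x
    using that by (intro ext Suc.prems) (simp add: fun_upd_in_Rtop del: fun_upd_apply)
  moreover have "C_k d k (partial_deriv i u) = C_k d k (partial_deriv i v)" if "i < d" for i
    by (rule Suc.IH) (use Suc.prems that in \<open>auto intro: partial_deriv_cong\<close>)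
  ultimately show ?case by (auto simp del: topspace_Rtop topspace_product_topology)
qed

lemma continuous_map_euclidean_compose:
  "continuous_map X euclidean f \<Longrightarrow> continuous_on UNIV g \<Longrightarrow> continuous_map X euclidean (\<lambda>x. g (f x))"
  using continuous_map_compose[of X euclidean f euclidean g] by (simp add: o_def)

lemma continuous_map_complex_mult:
  fixes u v :: "'a \<Rightarrow> complex"
  assumes "continuous_map X euclidean u" "continuous_map X euclidean v"
  shows "continuous_map X euclidean (\<lambda>x. u x * v x)"
proof -
  have "continuous_map X euclidean (\<lambda>x. (u x, v x))"
    unfolding prod_topology_euclidean[symmetric]
    using assms by (simp add: continuous_map_pairwise o_def del: prod_topology_euclidean)
  then have "continuous_map X euclidean (\<lambda>x. (\<lambda>p. fst p * snd p) (u x, v x))"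
    by (rule continuous_map_euclidean_compose) (intro continuous_intros)
  then show ?thesis by simp
qed

lemma C_k_continuous: "C_k d k u \<Longrightarrow> continuous_map (Rtop d) euclidean u"
  by (cases k) auto

text \<open>Allows any family \<open>u'\<close> of candidate derivatives, which has to agree with
  \<open>partial_deriv\<close> at extensional points only.\<close>

lemma C_k_SucI:
  assumes "continuous_map (Rtop d) euclidean u"
    and "\<And>i x. i < d \<Longrightarrow> x \<in> topspace (Rtop d) \<Longrightarrow>
      ((\<lambda>t. u (x(i := t))) has_vector_derivative u' i x) (at (x i))"
    and "\<And>i. i < d \<Longrightarrow> C_k d k (u' i)"
  shows "C_k d (Suc k) u"
proof -
  have "C_k d k (partial_deriv i u)" if "i < d" for i
    using C_k_cong[of d "partial_deriv i u" "u' i" k] assms that partial_deriv_eqI by blast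
  then show ?thesis
    using assms(1,2) by (auto intro: differentiableI_vector)
qed

lemma C_k_partial_deriv: "C_k d (Suc k) u \<Longrightarrow> i < d \<Longrightarrow> C_k d k (partial_deriv i u)"
  by simp

lemma C_k_has_partial_deriv:
  assumes "C_k d (Suc k) u" "i < d" "x \<in> topspace (Rtop d)"
  shows "((\<lambda>t. u (x(i := t))) has_vector_derivative partial_deriv i u x) (at (x i))"
  using assms unfolding partial_deriv_def by (auto simp: vector_derivative_works[symmetric])

lemma C_k_has_partial_deriv_at:
  assumes "C_k d (Suc k) u" "i < d" "x \<in> topspace (Rtop d)"
  shows "((\<lambda>t. u (x(i := t))) has_vector_derivative partial_deriv i u (x(i := s))) (at s)"
  using C_k_has_partial_deriv[OF assms(1,2), of "x(i := s)"] assms(2,3) by (simp add: fun_upd_in_Rtop)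

declare C_k.simps(2) [simp del]

lemma C_k_SucD: "C_k d (Suc k) u \<Longrightarrow> C_k d k u"
proof (induction k arbitrary: u)
  case 0
  then show ?case by (simp only: C_k.simps)
next
  case (Suc k)
  show ?case
    by (rule C_k_SucI[where u' = "\<lambda>i. partial_deriv i u"])
      (use Suc in \<open>blast intro: C_k_continuous C_k_has_partial_deriv C_k_partial_deriv\<close>)+
qed

lemma C_k_const: "C_k d k (\<lambda>_. c)"
  by (induction k arbitrary: c) (auto intro!: C_k_SucI[where u' = "\<lambda>_ _. 0"])

lemma C_k_add: "C_k d k u \<Longrightarrow> C_k d k v \<Longrightarrow> C_k d k (\<lambda>x. u x + v x)"
proof (induction k arbitrary: u v)
  case 0
  then show ?case by (auto intro: continuous_map_add)
next
  case (Suc k)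
  show ?case
  proof (rule C_k_SucI)
    show "continuous_map (Rtop d) euclidean (\<lambda>x. u x + v x)"
      using Suc.prems[THEN C_k_continuous] by (rule continuous_map_add)
  next
    fix i x assume "i < d" "x \<in> topspace (Rtop d)"
    then show "((\<lambda>t. u (x(i := t)) + v (x(i := t))) has_vector_derivative
      partial_deriv i u x + partial_deriv i v x) (at (x i))"
      using Suc.prems by (intro has_vector_derivative_add C_k_has_partial_deriv)
  next
    fix i assume "i < d"
    then show "C_k d k (\<lambda>x. partial_deriv i u x + partial_deriv i v x)"
      using Suc.prems by (intro Suc.IH C_k_partial_deriv)
  qed
qed

lemma partial_derivative_mult:
  fixes u v :: "('a \<Rightarrow> real) \<Rightarrow> complex"
  assumes "((\<lambda>t. u (x(i := t))) has_vector_derivative u') (at (x i))"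
    and "((\<lambda>t. v (x(i := t))) has_vector_derivative v') (at (x i))"
  shows "((\<lambda>t. u (x(i := t)) * v (x(i := t))) has_vector_derivative u x * v' + u' * v x) (at (x i))"
proof -
  have mult: "f t = a \<Longrightarrow> g t = b \<Longrightarrow> ((\<lambda>t. f t * g t) has_vector_derivative a * g' + f' * b) (at t)"
    if "(f has_vector_derivative f') (at t)" "(g has_vector_derivative g') (at t)"
    for f g :: "real \<Rightarrow> complex" and f' g' a b t
    using has_vector_derivative_mult[OF that] by simp
  show ?thesis by (rule mult[OF assms]) (simp_all only: fun_upd_triv)
qed

lemma C_k_mult: "C_k d k u \<Longrightarrow> C_k d k v \<Longrightarrow> C_k d k (\<lambda>x. u x * v x)"
proof (induction k arbitrary: u v)
  case 0
  then show ?case by (auto intro: continuous_map_complex_mult)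
next
  case (Suc k)
  show ?case
  proof (rule C_k_SucI[where u' = "\<lambda>i x. u x * partial_deriv i v x + partial_deriv i u x * v x"])
    show "continuous_map (Rtop d) euclidean (\<lambda>x. u x * v x)"
      using Suc.prems[THEN C_k_continuous] by (rule continuous_map_complex_mult)
  next
    fix i x assume ix: "i < d" "x \<in> topspace (Rtop d)"
    show "((\<lambda>t. u (x(i := t)) * v (x(i := t))) has_vector_derivative
      u x * partial_deriv i v x + partial_deriv i u x * v x) (at (x i))"
      by (rule partial_derivative_mult[of u x i _ v, OF C_k_has_partial_deriv[OF Suc.prems(1) ix]
            C_k_has_partial_deriv[OF Suc.prems(2) ix]])
  next
    fix i assume "i < d"
    then show "C_k d k (\<lambda>x. u x * partial_deriv i v x + partial_deriv i u x * v x)"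
      using Suc.prems by (intro C_k_add Suc.IH C_k_partial_deriv C_k_SucD[of d k u] C_k_SucD[of d k v])
  qed
qed

lemma partial_deriv_mult:
  assumes "C_k d (Suc k) u" "C_k d (Suc k) v" "i < d" "x \<in> topspace (Rtop d)"
  shows "partial_deriv i (\<lambda>x. u x * v x) x = u x * partial_deriv i v x + partial_deriv i u x * v x"
  by (rule partial_deriv_eqI, rule partial_derivative_mult[of u x i _ v,
        OF C_k_has_partial_deriv[OF assms(1,3,4)] C_k_has_partial_deriv[OF assms(2,3,4)]])

lemma C_k_sum:
  "finite A \<Longrightarrow> (\<And>a. a \<in> A \<Longrightarrow> C_k d k (f a)) \<Longrightarrow> C_k d k (\<lambda>x. \<Sum>a\<in>A. f a x)"
  by (induction A rule: finite_induct) (auto intro: C_k_const C_k_add simp del: C_k.simps)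

lemma C_k_prod:
  "finite A \<Longrightarrow> (\<And>a. a \<in> A \<Longrightarrow> C_k d k (f a)) \<Longrightarrow> C_k d k (\<lambda>x. \<Prod>a\<in>A. f a x)"
  by (induction A rule: finite_induct) (auto intro: C_k_const C_k_mult simp del: C_k.simps)

lemma C_k_diff: "C_k d k u \<Longrightarrow> C_k d k v \<Longrightarrow> C_k d k (\<lambda>x. u x - v x)"
  using C_k_add[of d k u "\<lambda>x. (-1) * v x"] C_k_mult[OF C_k_const[of d k "-1"], of v] by simp

lemma partial_deriv_diff:
  assumes "C_k d (Suc k) u" "C_k d (Suc k) v" "i < d" "x \<in> topspace (Rtop d)"
  shows "partial_deriv i (\<lambda>x. u x - v x) x = partial_deriv i u x - partial_deriv i v x"
  using assms by (intro partial_deriv_eqI has_vector_derivative_diff C_k_has_partial_deriv[of d k])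

text \<open>The bridge from one variable to several: cutoffs and Bernstein weights are products and
  sums of such functions of a single coordinate.\<close>

lemma C_k_coordinate: "cdiff k f \<Longrightarrow> i < d \<Longrightarrow> C_k d k (\<lambda>x. of_real (f (x i)))"
proof (induction k arbitrary: f)
  case 0
  have "continuous_map (Rtop d) euclidean (\<lambda>x. x i)"
    using 0 by (intro continuous_map_product_projection) auto
  then show ?case
    using 0 by (auto intro!: continuous_map_euclidean_compose[where g = "\<lambda>t. of_real (f t)"] continuous_on_of_real)
next
  case (Suc k)
  then obtain f' where D: "\<And>t. (f has_real_derivative f' t) (at t)" "cdiff k f'" by auto
  have c: "continuous_on UNIV f"
    using D(1) by (auto simp: continuous_on_eq_continuous_at intro: DERIV_isCont)
  show ?case
  proof (rule C_k_SucI[where u' = "\<lambda>l x. if l = i then of_real (f' (x i)) else 0"])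
    have "continuous_map (Rtop d) euclidean (\<lambda>x. x i)"
      using Suc.prems by (intro continuous_map_product_projection) auto
    then show "continuous_map (Rtop d) euclidean (\<lambda>x. complex_of_real (f (x i)))"
      using c by (auto intro!: continuous_map_euclidean_compose[where g = "\<lambda>t. of_real (f t)"] continuous_on_of_real)
  next
    fix l x
    have "((\<lambda>t. complex_of_real (f t)) has_vector_derivative of_real (f' (x i))) (at (x i))"
      using D(1) by (simp add: has_vector_derivative_of_real has_real_derivative_iff_has_vector_derivative)
    then show "((\<lambda>t. complex_of_real (f ((x(l := t)) i))) has_vector_derivative
      (if l = i then of_real (f' (x i)) else 0)) (at (x l))" by auto
  next
    fix l
    show "C_k d k (\<lambda>x. if l = i then complex_of_real (f' (x i)) else 0)"
      using Suc.IH[OF D(2) Suc.prems(2)] C_k_const by (cases "l = i") auto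
  qed
qed

lemma closedin_supp: "closedin (Rtop d) (supp d u)"
  by (simp add: supp_def)

lemma not_in_supp: "x \<in> topspace (Rtop d) \<Longrightarrow> x \<notin> supp d u \<Longrightarrow> u x = 0"
  unfolding supp_def using closure_of_subset[of "{x \<in> topspace (Rtop d). u x \<noteq> 0}" "Rtop d"] by blast

lemma supp_minimal:
  "closedin (Rtop d) C \<Longrightarrow> (\<And>x. x \<in> topspace (Rtop d) \<Longrightarrow> x \<notin> C \<Longrightarrow> u x = 0) \<Longrightarrow> supp d u \<subseteq> C"
  unfolding supp_def by (rule closure_of_minimal) blast+

lemma continuous_map_fun_upd:
  assumes "i < d" "x \<in> topspace (Rtop d)"
  shows "continuous_map euclidean (Rtop d) (\<lambda>t. x(i := t))"
  unfolding continuous_map_componentwise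
proof (intro conjI ballI)
  show "(\<lambda>t. x(i := t)) ` topspace euclidean \<subseteq> extensional {..<d}"
    using assms by (auto simp: extensional_def)
  fix k
  show "continuous_map euclidean euclidean (\<lambda>t. (x(i := t)) k)"
    by (cases "k = i") auto
qed

text \<open>Off the support, which is closed, the function vanishes on a neighbourhood and hence on
  an open piece of the coordinate line, so its derivative is zero there too.\<close>

lemma supp_partial_deriv:
  assumes "i < d"
  shows "supp d (partial_deriv i u) \<subseteq> supp d u"
proof (rule supp_minimal[OF closedin_supp])
  fix x assume x: "x \<in> topspace (Rtop d)" "x \<notin> supp d u"
  let ?S = "{t. x(i := t) \<in> topspace (Rtop d) - supp d u}"
  have "open ?S"
    using openin_continuous_map_preimage[OF continuous_map_fun_upd[OF assms x(1)],
        of "topspace (Rtop d) - supp d u"] closedin_supp[of d u]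
    by (simp add: closedin_def)
  moreover have "x i \<in> ?S" using x by (simp only: mem_Collect_eq fun_upd_triv Diff_iff simp_thms)
  moreover have "0 = u (x(i := t))" if "t \<in> ?S" for t
    using that not_in_supp[of "x(i := t)" d u] by simp
  ultimately have "((\<lambda>t. u (x(i := t))) has_vector_derivative 0) (at (x i))"
    by (intro has_vector_derivative_transform_within_open[OF has_vector_derivative_const])
  then show "partial_deriv i u x = 0" by (rule partial_deriv_eqI)
qed

lemma compactin_supp:
  assumes "compactin (Rtop d) K" "supp d u \<subseteq> K"
  shows "compactin (Rtop d) (supp d u)"
  by (rule closed_compactin[OF assms closedin_supp])

subsection \<open>Test functions\<close>

lemma test_functionsI:
  assumes "smooth d u" "compactin (Rtop d) K" "closedin (Rtop d) K" "K \<subseteq> U"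
    and "\<And>x. x \<in> topspace (Rtop d) \<Longrightarrow> x \<notin> K \<Longrightarrow> u x = 0"
  shows "u \<in> test_functions d U"
proof -
  have "supp d u \<subseteq> K" by (rule supp_minimal) fact+
  then show ?thesis
    using assms by (auto simp: test_functions_def intro: compactin_supp)
qed

lemma test_functionsD:
  assumes "u \<in> test_functions d U"
  shows "smooth d u" "compactin (Rtop d) (supp d u)" "supp d u \<subseteq> U"
  using assms by (auto simp: test_functions_def)

lemma smoothD: "smooth d u \<Longrightarrow> C_k d k u"
  by (simp add: smooth_def)

lemma smooth_partial_deriv: "smooth d u \<Longrightarrow> i < d \<Longrightarrow> smooth d (partial_deriv i u)"
  by (auto simp: smooth_def intro: C_k_partial_deriv)

lemma test_functions_partial_deriv:
  assumes "u \<in> test_functions d U" "i < d"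
  shows "partial_deriv i u \<in> test_functions d U"
  by (rule test_functionsI[OF _ test_functionsD(2)[OF assms(1)] closedin_supp])
    (use assms test_functionsD[OF assms(1)] supp_partial_deriv[OF assms(2), of u] in
      \<open>auto intro: smooth_partial_deriv not_in_supp[where u = "partial_deriv i u" and d = d]
        simp del: topspace_Rtop topspace_product_topology\<close>)

lemma test_functions_mult:
  assumes "u \<in> test_functions d U" "smooth d v"
  shows "(\<lambda>x. u x * v x) \<in> test_functions d U"
  by (rule test_functionsI[OF _ test_functionsD(2)[OF assms(1)] closedin_supp])
    (use assms test_functionsD[OF assms(1)] in \<open>auto simp: smooth_def not_in_supp intro: C_k_mult\<close>)

lemma test_functions_mono: "U \<subseteq> U' \<Longrightarrow> test_functions d U \<subseteq> test_functions d U'"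
  by (auto simp: test_functions_def)

lemma test_functions_cmult:
  assumes "u \<in> test_functions d U"
  shows "(\<lambda>x. c * u x) \<in> test_functions d U"
  using test_functions_mult[OF assms, of "\<lambda>_. c"] by (simp add: smooth_def C_k_const mult.commute)

lemma test_functions_add:
  assumes "u \<in> test_functions d U" "v \<in> test_functions d U"
  shows "(\<lambda>x. u x + v x) \<in> test_functions d U"
proof (rule test_functionsI)
  show "smooth d (\<lambda>x. u x + v x)"
    using assms[THEN test_functionsD(1)] by (auto simp: smooth_def intro: C_k_add)
  show "compactin (Rtop d) (supp d u \<union> supp d v)"
    using assms[THEN test_functionsD(2)] by (rule compactin_Un)
qed (use assms[THEN test_functionsD(3)] in \<open>auto simp: not_in_supp closedin_supp intro: closedin_Un\<close>)

lemma test_functions_zero: "(\<lambda>_. 0) \<in> test_functions d U"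
  by (rule test_functionsI[where K = "{}"]) (auto simp: smooth_def C_k_const)

section \<open>Cubes, which are the closed balls of the maximum metric, and smooth cutoffs\<close>

definition cube :: "nat \<Rightarrow> (nat \<Rightarrow> real) \<Rightarrow> real \<Rightarrow> (nat \<Rightarrow> real) set" where
  "cube d a r = PiE {..<d} (\<lambda>i. {a i - r..a i + r})"

lemma compactin_cube: "compactin (Rtop d) (cube d a r)"
  unfolding cube_def by (auto simp: compactin_PiE)

lemma Hausdorff_Rtop: "Hausdorff_space (Rtop d)"
  by (auto simp: Hausdorff_space_product_topology)

lemma closedin_cube: "closedin (Rtop d) (cube d a r)"
  by (rule compactin_imp_closedin[OF Hausdorff_Rtop compactin_cube])

lemma openin_contains_cube:
  assumes "openin (Rtop d) U" "a \<in> U"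
  obtains r where "r > 0" "cube d a r \<subseteq> U"
proof -
  have "\<forall>x\<in>U. \<exists>X. (\<forall>i\<in>{..<d}. open (X i)) \<and> x \<in> PiE {..<d} X \<and> PiE {..<d} X \<subseteq> U"
    using assms(1) unfolding openin_product_topology_alt by simp
  then obtain X where X: "\<forall>i\<in>{..<d}. open (X i)" "a \<in> PiE {..<d} X" "PiE {..<d} X \<subseteq> U"
    using assms(2) by blast
  have "\<forall>i\<in>{..<d}. \<exists>e>0. cball (a i) e \<subseteq> X i"
    using X(1,2) by (meson PiE_mem open_contains_cball)
  then obtain e where e: "\<And>i. i < d \<Longrightarrow> e i > 0" "\<And>i. i < d \<Longrightarrow> cball (a i) (e i) \<subseteq> X i"
    by (metis lessThan_iff)
  \<comment> \<open>The entry 1 keeps the minimum defined in dimension 0.\<close>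
  define r where "r = Min (insert 1 (e ` {..<d}))"
  have r: "r > 0" "\<And>i. i < d \<Longrightarrow> r \<le> e i"
    using e(1) by (auto simp: r_def)
  have "cube d a r \<subseteq> PiE {..<d} X"
    unfolding cube_def
  proof (rule PiE_mono)
    fix i assume "i \<in> {..<d}"
    then show "{a i - r..a i + r} \<subseteq> X i"
      using e(2)[of i] r(2)[of i] by (force simp: dist_real_def)
  qed
  then show ?thesis using that r(1) X(3) by blast
qed

lemma openin_open_cube: "openin (Rtop d) (PiE {..<d} (\<lambda>i. {a i - r<..<a i + r}))"
  by (auto simp: openin_PiE)

lemma compactin_Rtop_bounded:
  assumes "compactin (Rtop d) K"
  obtains R where "R > 0" "K \<subseteq> cube d (\<lambda>_. 0) R"
proof -
  have "\<forall>i\<in>{..<d}. \<exists>r>0. \<forall>x\<in>K. \<bar>x i\<bar> \<le> r"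
  proof
    fix i assume "i \<in> {..<d}"
    then have "compactin euclidean ((\<lambda>x. x i) ` K)"
      by (intro image_compactin[OF assms continuous_map_product_projection])
    then have "bounded ((\<lambda>x. x i) ` K)" by (simp add: compact_imp_bounded)
    then show "\<exists>r>0. \<forall>x\<in>K. \<bar>x i\<bar> \<le> r" by (auto simp: bounded_pos)
  qed
  then obtain r where r: "\<And>i. i < d \<Longrightarrow> r i > 0" "\<And>i x. i < d \<Longrightarrow> x \<in> K \<Longrightarrow> \<bar>x i\<bar> \<le> r i"
    by (metis lessThan_iff)
  \<comment> \<open>The entry 1 makes the maximum positive and covers dimension 0.\<close>
  define R where "R = Max (insert 1 (r ` {..<d}))"
  have R: "R > 0" "\<And>i. i < d \<Longrightarrow> r i \<le> R"
    by (auto simp: R_def less_le_trans[OF zero_less_one Max_ge])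
  have "K \<subseteq> cube d (\<lambda>_. 0) R"
  proof
    fix x assume x: "x \<in> K"
    then have "x \<in> topspace (Rtop d)" using assms compactin_subset_topspace by blast
    moreover have "\<bar>x i\<bar> \<le> R" if "i < d" for i
      using r(2)[OF that x] R(2)[OF that] by linarith
    ultimately show "x \<in> cube d (\<lambda>_. 0) R"
      by (force simp: cube_def PiE_iff abs_le_iff)
  qed
  then show ?thesis using that R(1) by blast
qed

text \<open>In the variable s = (x_i - a_i)/r the two steps equal 1 for |s| \<le> 1, and one of them
  vanishes for |s| \<ge> 2. The product is therefore 1 on the cube of radius r and 0 off the cube of
  radius 2r.\<close>

definition plateau :: "nat \<Rightarrow> (nat \<Rightarrow> real) \<Rightarrow> real \<Rightarrow> (nat \<Rightarrow> real) \<Rightarrow> complex" where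
  "plateau d a r x = (\<Prod>i<d. of_real (smooth_step (2 + (x i - a i) / r) * smooth_step (2 - (x i - a i) / r)))"

lemma smooth_plateau: "smooth d (plateau d a r)"
  unfolding smooth_def
proof
  fix k
  have "cdiff k (\<lambda>t. smooth_step ((1 / r) * t + (2 - a i / r)) * smooth_step (- (1 / r) * t + (2 + a i / r)))" for i
    by (intro cdiff_mult cdiff_affine cdiff_smooth_step)
  moreover have "(\<lambda>t. smooth_step ((1 / r) * t + (2 - a i / r)) * smooth_step (- (1 / r) * t + (2 + a i / r))) =
     (\<lambda>t. smooth_step (2 + (t - a i) / r) * smooth_step (2 - (t - a i) / r))" for i
    by (simp add: diff_divide_distrib algebra_simps)
  ultimately have *: "cdiff k (\<lambda>t. smooth_step (2 + (t - a i) / r) * smooth_step (2 - (t - a i) / r))" for i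
    by metis
  show "C_k d k (plateau d a r)"
    unfolding plateau_def[abs_def]
    by (intro C_k_prod C_k_coordinate[OF *]) auto
qed

lemma plateau_eq_1: "r > 0 \<Longrightarrow> x \<in> cube d a r \<Longrightarrow> plateau d a r x = 1"
  unfolding plateau_def
proof (intro prod.neutral ballI)
  fix i assume *: "r > 0" "x \<in> cube d a r" "i \<in> {..<d}"
  then have "(x i - a i) / r \<le> 1" "- 1 \<le> (x i - a i) / r"
    by (auto simp: cube_def PiE_iff field_simps)
  then show "complex_of_real (smooth_step (2 + (x i - a i) / r) * smooth_step (2 - (x i - a i) / r)) = 1"
    by (simp add: smooth_step_ge_1)
qed

lemma plateau_eq_0:
  assumes "r > 0" "x \<in> topspace (Rtop d)" "x \<notin> cube d a (2 * r)"
  shows "plateau d a r x = 0"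
proof -
  obtain i where i: "i < d" "\<not> \<bar>x i - a i\<bar> \<le> 2 * r"
    using assms by (force simp: cube_def PiE_iff abs_le_iff)
  then have "(x i - a i) / r > 2 \<or> (x i - a i) / r < -2"
    using assms(1) by (auto simp: field_simps abs_le_iff)
  then have "smooth_step (2 + (x i - a i) / r) * smooth_step (2 - (x i - a i) / r) = 0"
    by (auto simp: smooth_step_nonpos)
  then show ?thesis using i(1) by (auto simp: plateau_def)
qed

text \<open>By compactness finitely many open cubes cover K, chosen so small that the closed cubes
  of twice their radius stay in U; the plateaus of these cubes are then combined.\<close>

lemma exists_cutoff:
  assumes K: "compactin (Rtop d) K" "K \<subseteq> U" and U: "openin (Rtop d) U"
  obtains \<eta> where "\<eta> \<in> test_functions d U" "\<And>x. x \<in> K \<Longrightarrow> \<eta> x = 1"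
proof -
  have "\<forall>a\<in>K. \<exists>r>0. cube d a (2 * r) \<subseteq> U"
  proof
    fix a assume "a \<in> K"
    then obtain r where "r > 0" "cube d a r \<subseteq> U"
      using openin_contains_cube[OF U] K(2) by blast
    then show "\<exists>r>0. cube d a (2 * r) \<subseteq> U" by (auto intro!: exI[of _ "r / 2"])
  qed
  then obtain r where r: "\<And>a. a \<in> K \<Longrightarrow> r a > 0" "\<And>a. a \<in> K \<Longrightarrow> cube d a (2 * r a) \<subseteq> U"
    by metis
  let ?B = "\<lambda>a. PiE {..<d} (\<lambda>i. {a i - r a<..<a i + r a})"
  have Ktop: "K \<subseteq> topspace (Rtop d)" using K(1) compactin_subset_topspace by blast
  have op: "openin (Rtop d) X" if "X \<in> ?B ` K" for X
  proof -
    obtain a where "X = ?B a" using \<open>X \<in> ?B ` K\<close> by (rule imageE)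
    then show ?thesis by (simp only: openin_open_cube)
  qed
  have cover: "K \<subseteq> \<Union> (?B ` K)"
  proof
    fix a assume a: "a \<in> K"
    then have "a \<in> ?B a" using r(1)[OF a] Ktop by (auto simp: PiE_iff)
    then show "a \<in> \<Union> (?B ` K)" using a by blast
  qed
  have "\<exists>\<F>. finite \<F> \<and> \<F> \<subseteq> ?B ` K \<and> K \<subseteq> \<Union>\<F>"
    by (rule compactinD[OF K(1) _ cover]) (rule op)
  then obtain \<F> where \<F>: "finite \<F> \<and> \<F> \<subseteq> ?B ` K \<and> K \<subseteq> \<Union>\<F>" by (rule exE)
  have "\<exists>A\<subseteq>K. finite A \<and> \<F> = ?B ` A"
    by (rule finite_subset_image) (use \<F> in simp_all)
  then obtain A where "A \<subseteq> K \<and> finite A \<and> \<F> = ?B ` A" by (rule exE)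
  with \<F> have A: "finite A" "A \<subseteq> K" "K \<subseteq> \<Union> (?B ` A)" by simp_all
  \<comment> \<open>A smooth substitute for the maximum: the value is 1 as soon as one plateau is 1,
    and 0 where all of them vanish.\<close>
  define \<eta> where "\<eta> = (\<lambda>x. 1 - (\<Prod>a\<in>A. 1 - plateau d a (r a) x))"
  have "\<eta> \<in> test_functions d U"
  proof (rule test_functionsI)
    show "smooth d \<eta>"
      unfolding \<eta>_def smooth_def
      using A(1) by (intro allI C_k_diff C_k_prod C_k_const smoothD[OF smooth_plateau])
    show "compactin (Rtop d) (\<Union>a\<in>A. cube d a (2 * r a))"
      using A(1) by (auto intro!: compactin_Union compactin_cube)
    show "closedin (Rtop d) (\<Union>a\<in>A. cube d a (2 * r a))"
      using A(1) by (auto intro!: closedin_Union closedin_cube)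
    show "(\<Union>a\<in>A. cube d a (2 * r a)) \<subseteq> U" using r(2) A(2) by blast
    fix x assume x: "x \<in> topspace (Rtop d)" "x \<notin> (\<Union>a\<in>A. cube d a (2 * r a))"
    then have "plateau d a (r a) x = 0" if "a \<in> A" for a
      using that A(2) by (intro plateau_eq_0 r) auto
    then show "\<eta> x = 0" by (simp add: \<eta>_def)
  qed
  moreover have "\<eta> x = 1" if xK: "x \<in> K" for x
  proof -
    have "x \<in> \<Union> (?B ` A)" using A(3) xK by (rule subsetD)
    then obtain a where a: "a \<in> A" "x \<in> ?B a" by (rule UN_E)
    have "?B a \<subseteq> cube d a (r a)" unfolding cube_def by (rule PiE_mono) auto
    then have "x \<in> cube d a (r a)" using a(2) by (rule subsetD)
    then have "plateau d a (r a) x = 1"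
      using a(1) A(2) by (intro plateau_eq_1 r) auto
    then have "(\<Prod>a\<in>A. 1 - plateau d a (r a) x) = 0" using a(1) A(1) by (auto intro!: prod_zero)
    then show ?thesis by (simp add: \<eta>_def)
  qed
  ultimately show ?thesis using that by blast
qed

section \<open>Coordinates of a product space and derivatives of tensors\<close>

subsection \<open>Blocks of coordinates\<close>

abbreviation offset :: "(nat \<Rightarrow> nat) \<Rightarrow> nat \<Rightarrow> nat" where
  "offset d j \<equiv> \<Sum>l<j. d l"

lemma offset_Suc_le: "l < j \<Longrightarrow> offset d l + d l \<le> offset d j"
proof -
  assume "l < j"
  then have "sum d {..<Suc l} \<le> sum d {..<j}" by (intro sum_mono2) auto
  then show ?thesis by simp
qed

lemma offset_add_less: "j < n \<Longrightarrow> i < d j \<Longrightarrow> offset d j + i < offset d n"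
  using offset_Suc_le[of j n d] by linarith

lemma offset_unique:
  assumes "i < d j" "i' < d l" "offset d j + i = offset d l + i'"
  shows "j = l \<and> i = i'"
proof -
  consider "j < l" | "l < j" | "j = l" by linarith
  then show ?thesis
    using assms offset_Suc_le[of j l d] offset_Suc_le[of l j d] by cases auto
qed

lemma offset_cases:
  assumes "k < offset d n"
  obtains j i where "j < n" "i < d j" "k = offset d j + i"
proof -
  have "\<exists>j<n. \<exists>i<d j. k = offset d j + i"
    using assms
  proof (induction n)
    case (Suc n)
    show ?case
    proof (cases "k < offset d n")
      case True
      then show ?thesis using Suc.IH less_SucI by blast
    next
      case False
      then have "k - offset d n < d n" "k = offset d n + (k - offset d n)"
        using Suc.prems by auto
      then show ?thesis by blast
    qed
  qed simp
  then show ?thesis using that by blast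
qed

lemma block_in: "block d j x \<in> PiE {..<d j} (\<lambda>_. UNIV)"
  by (auto simp: block_def)

lemma block_upd_same: "i < d j \<Longrightarrow> block d j (x(offset d j + i := t)) = (block d j x)(i := t)"
  by (auto simp: block_def fun_eq_iff)

lemma block_upd_other:
  "i < d j \<Longrightarrow> l \<noteq> j \<Longrightarrow> block d l (x(offset d j + i := t)) = block d l x"
  using offset_unique[of i d j _ l] by (auto simp: block_def fun_eq_iff) metis

lemma block_apply: "i < d j \<Longrightarrow> block d j x i = x (offset d j + i)"
  by (simp add: block_def)

lemma continuous_map_block:
  assumes "j < n"
  shows "continuous_map (Rtop (offset d n)) (Rtop (d j)) (block d j)"
  unfolding continuous_map_componentwise
proof (intro conjI ballI)
  show "block d j ` topspace (Rtop (offset d n)) \<subseteq> extensional {..<d j}"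
    by (auto simp: block_def)
  fix i assume i: "i \<in> {..<d j}"
  then have "continuous_map (Rtop (offset d n)) euclidean (\<lambda>x. x (offset d j + i))"
    using offset_add_less[OF assms] by (intro continuous_map_product_projection) auto
  then show "continuous_map (Rtop (offset d n)) euclidean (\<lambda>x. block d j x i)"
    using i by (simp add: block_apply)
qed

lemma block_partial_derivative:
  assumes "((\<lambda>t. u ((block d j x)(i := t))) has_vector_derivative u') (at (block d j x i))" "i < d j"
  shows "((\<lambda>t. u (block d j (x(offset d j + i := t)))) has_vector_derivative u') (at (x (offset d j + i)))"
  using assms by (simp only: block_upd_same block_apply)

lemma C_k_block:
  assumes "j < n"
  shows "C_k (d j) k u \<Longrightarrow> C_k (offset d n) k (\<lambda>x. u (block d j x))"
proof (induction k arbitrary: u)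
  case 0
  then show ?case
    using continuous_map_compose[OF continuous_map_block[OF assms, of d], of euclidean u] by (simp add: o_def)
next
  case (Suc k)
  \<comment> \<open>Moving a coordinate outside block \<open>j\<close> leaves
    \<open>block d j x\<close> fixed, hence the zero.\<close>
  define u' where "u' = (\<lambda>m x. if offset d j \<le> m \<and> m < offset d j + d j
      then partial_deriv (m - offset d j) u (block d j x) else 0)"
  show ?case
  proof (rule C_k_SucI[where u' = u'])
    show "continuous_map (Rtop (offset d n)) euclidean (\<lambda>x. u (block d j x))"
      using continuous_map_compose[OF continuous_map_block[OF assms, of d], of euclidean u] C_k_continuous[OF Suc.prems]
      by (simp add: o_def)
  next
    fix m x assume m: "m < offset d n" "x \<in> topspace (Rtop (offset d n))"
    obtain l i where l: "l < n" "i < d l" "m = offset d l + i" using offset_cases[OF m(1)] .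
    show "((\<lambda>t. u (block d j (x(m := t)))) has_vector_derivative u' m x) (at (x m))"
    proof (cases "l = j")
      case True
      then have m': "m = offset d j + i" "i < d j" using l by auto
      have "((\<lambda>t. u ((block d j x)(i := t))) has_vector_derivative partial_deriv i u (block d j x))
          (at (block d j x i))"
        by (rule C_k_has_partial_deriv[OF Suc.prems m'(2)]) (simp add: block_in)
      then have "((\<lambda>t. u (block d j (x(offset d j + i := t)))) has_vector_derivative
          partial_deriv i u (block d j x)) (at (x (offset d j + i)))"
        using m'(2) by (rule block_partial_derivative)
      moreover have "u' (offset d j + i) x = partial_deriv i u (block d j x)"
        using m'(2) by (simp add: u'_def)
      ultimately show ?thesis unfolding m'(1) by (simp only:)
    next
      case False
      have "\<not> (offset d j \<le> m \<and> m < offset d j + d j)"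
      proof
        assume "offset d j \<le> m \<and> m < offset d j + d j"
        then have "m - offset d j < d j" "offset d l + i = offset d j + (m - offset d j)"
          using l(3) by linarith+
        from offset_unique[where d = d, OF l(2) this] False show False by simp
      qed
      then have "u' m x = 0" unfolding u'_def by (rule if_not_P)
      moreover have "(\<lambda>t. u (block d j (x(m := t)))) = (\<lambda>_. u (block d j x))"
        unfolding l(3) by (intro ext arg_cong[of _ _ u] block_upd_other) (use l False in auto)
      ultimately show ?thesis by (simp only: has_vector_derivative_const)
    qed
  next
    fix m assume m: "m < offset d n"
    show "C_k (offset d n) k (u' m)"
    proof (cases "offset d j \<le> m \<and> m < offset d j + d j")
      case True
      then have "C_k (d j) k (partial_deriv (m - offset d j) u)"
        by (intro C_k_partial_deriv[OF Suc.prems]) auto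
      then show ?thesis using Suc.IH True by (simp add: u'_def)
    next
      case False
      then have "u' m = (\<lambda>_. 0)" unfolding u'_def by (intro ext if_not_P)
      then show ?thesis by (simp add: C_k_const)
    qed
  qed
qed

lemma elem_tensor_upd:
  assumes "j < n"
  shows "elem_tensor n d f x = f j (block d j x) * (\<Prod>l\<in>{..<n} - {j}. f l (block d l x))"
  unfolding elem_tensor_def using assms by (subst prod.remove[of _ j]) auto

text \<open>Along a line in a coordinate of block \<open>j\<close> the other factors are constant,
  so only the factor \<open>u j\<close> is differentiated.\<close>

lemma partial_deriv_elem_tensor:
  assumes "j < n" "i < d j" "C_k (d j) (Suc k) (u j)"
  shows "partial_deriv (offset d j + i) (elem_tensor n d u) x = elem_tensor n d (u(j := partial_deriv i (u j))) x"
proof (rule partial_deriv_eqI)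
  let ?m = "offset d j + i" and ?P = "\<Prod>l\<in>{..<n} - {j}. u l (block d l x)"
  have "((\<lambda>t. u j ((block d j x)(i := t))) has_vector_derivative partial_deriv i (u j) (block d j x))
      (at (block d j x i))"
    using assms(2) by (intro C_k_has_partial_deriv[OF assms(3)]) (auto simp: block_in)
  from block_partial_derivative[OF this assms(2)]
  have deriv: "((\<lambda>t. u j (block d j (x(?m := t))) * ?P) has_vector_derivative
      partial_deriv i (u j) (block d j x) * ?P) (at (x ?m))"
    by (rule has_vector_derivative_mult_left)
  have line: "(\<lambda>t. elem_tensor n d u (x(?m := t))) = (\<lambda>t. u j (block d j (x(?m := t))) * ?P)"
    unfolding elem_tensor_upd[OF assms(1)] using assms(2)
    by (intro ext arg_cong2[of _ _ _ _ "(*)"] refl prod.cong) (simp_all add: block_upd_other del: fun_upd_apply)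
  have at: "elem_tensor n d (u(j := partial_deriv i (u j))) x = partial_deriv i (u j) (block d j x) * ?P"
    unfolding elem_tensor_upd[OF assms(1)] by (auto intro: prod.cong)
  show "((\<lambda>t. elem_tensor n d u (x(?m := t))) has_vector_derivative
      elem_tensor n d (u(j := partial_deriv i (u j))) x) (at (x ?m))"
    unfolding line at by (rule deriv)
qed

section \<open>Measurability, compact supports and integration by parts on the whole space\<close>

section \<open>Integration over the domains\<close>

interpretation Rprod: product_sigma_finite "\<lambda>_::nat. lborel :: real measure"
  by (simp add: product_sigma_finite_def lborel.sigma_finite_measure_axioms)

lemma space_Rmeas [simp]: "space (Rmeas d) = PiE {..<d} (\<lambda>_. UNIV)"
  by (simp add: space_PiM)

text \<open>Links the product sigma-algebra to the product topology: on all functions the Borel sets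
  are the product sigma-algebra, and on extensional points the coordinates from \<open>d\<close> on
  are the constant \<open>undefined\<close>. Open sets of \<open>Rtop d\<close> are later pulled
  back along \<open>restrict\<close> to use it.\<close>

lemma measurable_Rmeas_to_borel: "(\<lambda>x. x) \<in> measurable (Rmeas d) (borel :: (nat \<Rightarrow> real) measure)"
proof -
  have "(\<lambda>x i. x i) \<in> measurable (Rmeas d) (PiM UNIV (\<lambda>_. borel :: real measure))"
  proof (rule measurable_PiM_single')
    fix i :: nat
    show "(\<lambda>x. x i) \<in> measurable (Rmeas d) (borel :: real measure)"
    proof (cases "i < d")
      case True
      then have "(\<lambda>x. x i) \<in> measurable (Rmeas d) (lborel :: real measure)"
        by (intro measurable_component_singleton) auto
      then show ?thesis by simp
    next
      case False
      have "(\<lambda>x. x i) \<in> measurable (Rmeas d) (borel :: real measure) \<longleftrightarrow>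
        (\<lambda>_. undefined) \<in> measurable (Rmeas d) (borel :: real measure)"
        by (rule measurable_cong) (use False in \<open>auto simp: PiE_iff extensional_def\<close>)
      then show ?thesis by simp
    qed
  qed auto
  then show ?thesis
    using measurable_cong_sets[OF refl sets_PiM_equal_borel] by blast
qed

lemma continuous_map_restrict: "continuous_map euclidean (Rtop d) (\<lambda>x. restrict x {..<d})"
  unfolding continuous_map_componentwise
  by (auto simp: continuous_on_product_coordinates)

lemma sets_Rmeas_openin:
  assumes "openin (Rtop d) U"
  shows "U \<in> sets (Rmeas d)"
proof -
  have "open {x. restrict x {..<d} \<in> U}"
    using openin_continuous_map_preimage[OF continuous_map_restrict assms] by simp
  then have "(\<lambda>x. x) -` {x. restrict x {..<d} \<in> U} \<inter> space (Rmeas d) \<in> sets (Rmeas d)"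
    by (intro measurable_sets[OF measurable_Rmeas_to_borel]) auto
  also have "(\<lambda>x. x) -` {x. restrict x {..<d} \<in> U} \<inter> space (Rmeas d) = U"
    using openin_subset[OF assms] by (auto simp: PiE_restrict)
  finally show ?thesis .
qed

lemma sets_Rmeas_closedin:
  assumes "closedin (Rtop d) C"
  shows "C \<in> sets (Rmeas d)"
proof -
  have "space (Rmeas d) - (topspace (Rtop d) - C) \<in> sets (Rmeas d)"
    using assms by (intro sets.compl_sets sets_Rmeas_openin) (auto simp: closedin_def)
  moreover have "space (Rmeas d) - (topspace (Rtop d) - C) = C"
    using closedin_subset[OF assms] by auto
  ultimately show ?thesis by simp
qed

lemma borel_measurable_Rmeas_continuous:
  fixes u :: "_ \<Rightarrow> 'b::real_normed_vector"
  assumes "continuous_map (Rtop d) euclidean u"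
  shows "u \<in> borel_measurable (Rmeas d)"
proof (rule borel_measurableI)
  fix S :: "'b set" assume "open S"
  then have "openin (Rtop d) {x \<in> topspace (Rtop d). u x \<in> S}"
    by (intro openin_continuous_map_preimage[OF assms]) auto
  moreover have "{x \<in> topspace (Rtop d). u x \<in> S} = u -` S \<inter> space (Rmeas d)" by auto
  ultimately show "u -` S \<inter> space (Rmeas d) \<in> sets (Rmeas d)"
    using sets_Rmeas_openin by metis
qed

lemma cube_iff: "x \<in> cube d a r \<longleftrightarrow> x \<in> PiE {..<d} (\<lambda>_. UNIV) \<and> (\<forall>i<d. \<bar>x i - a i\<bar> \<le> r)"
proof -
  have "x i \<in> {a i - r..a i + r} \<longleftrightarrow> \<bar>x i - a i\<bar> \<le> r" for i by (auto simp: abs_le_iff)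
  then show ?thesis by (simp only: cube_def PiE_iff) auto
qed

lemma emeasure_cube_finite: "emeasure (Rmeas d) (cube d a r) < \<infinity>"
  unfolding cube_def
  by (subst Rprod.emeasure_PiM) (auto simp: ennreal_prod_eq_top less_top[symmetric] emeasure_lborel_Icc_eq)

lemma integrable_Rmeas_bounded:
  fixes u :: "_ \<Rightarrow> 'b::{banach, second_countable_topology}"
  assumes "u \<in> borel_measurable (Rmeas d)"
    and "\<And>x. x \<in> cube d a r \<Longrightarrow> norm (u x) \<le> B"
    and "\<And>x. x \<in> topspace (Rtop d) \<Longrightarrow> x \<notin> cube d a r \<Longrightarrow> u x = 0"
  shows "integrable (Rmeas d) u"
proof (rule integrableI_bounded_set[OF _ assms(1) emeasure_cube_finite])
  show "cube d a r \<in> sets (Rmeas d)" by (rule sets_Rmeas_closedin[OF closedin_cube])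
  show "AE x in Rmeas d. x \<in> cube d a r \<longrightarrow> norm (u x) \<le> B" using assms(2) by auto
  show "AE x in Rmeas d. x \<notin> cube d a r \<longrightarrow> u x = 0" by (rule AE_I2) (use assms(3) in auto)
qed

lemma continuous_map_compact_bounded:
  fixes u :: "_ \<Rightarrow> 'b::real_normed_vector"
  assumes "continuous_map (Rtop d) euclidean u" "compactin (Rtop d) K"
  obtains B where "B > 0" "\<And>x. x \<in> K \<Longrightarrow> norm (u x) \<le> B"
proof -
  have "compactin euclidean (u ` K)" using image_compactin[OF assms(2,1)] .
  then have "bounded (u ` K)" by (simp add: compact_imp_bounded)
  then obtain B where "B > 0" "\<forall>y\<in>u ` K. norm y \<le> B" unfolding bounded_pos by blast
  then show ?thesis using that by blast
qed

lemma supp_in_cube: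
  assumes "compactin (Rtop d) (supp d u)"
  obtains R where "R > 0" "\<And>x. x \<in> topspace (Rtop d) \<Longrightarrow> x \<notin> cube d (\<lambda>_. 0) R \<Longrightarrow> u x = 0"
proof -
  obtain R where "R > 0" "supp d u \<subseteq> cube d (\<lambda>_. 0) R"
    using compactin_Rtop_bounded[OF assms] .
  then show ?thesis using that not_in_supp by blast
qed

lemma integrable_compact_supp:
  assumes "continuous_map (Rtop d) euclidean u" "compactin (Rtop d) (supp d u)"
  shows "integrable (Rmeas d) u"
proof -
  obtain R where R: "\<And>x. x \<in> topspace (Rtop d) \<Longrightarrow> x \<notin> cube d (\<lambda>_. 0) R \<Longrightarrow> u x = 0"
    using supp_in_cube[OF assms(2)] by blast
  obtain B where "\<And>x. x \<in> cube d (\<lambda>_. 0) R \<Longrightarrow> norm (u x) \<le> B"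
    using continuous_map_compact_bounded[OF assms(1) compactin_cube] by blast
  with R show ?thesis
    by (intro integrable_Rmeas_bounded[OF borel_measurable_Rmeas_continuous[OF assms(1)]])
qed

text \<open>Fubini singles out the variable \<open>i\<close>; the inner integral is, by the
  fundamental theorem of calculus, a difference of two values of u outside its support.\<close>

lemma integral_partial_deriv_eq_0:
  assumes "C_k d (Suc 0) u" "compactin (Rtop d) (supp d u)" "i < d"
  shows "(LINT x|Rmeas d. partial_deriv i u x) = 0"
proof -
  let ?F = "partial_deriv i u" and ?I = "{..<d} - {i}"
  have Fc: "continuous_map (Rtop d) euclidean ?F"
    using C_k_partial_deriv[OF assms(1,3)] by (rule C_k_continuous)
  obtain R where R: "R > 0" "supp d u \<subseteq> cube d (\<lambda>_. 0) R"
    using compactin_Rtop_bounded[OF assms(2)] .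
  have zero: "u x = 0" "?F x = 0" if "x \<in> topspace (Rtop d)" "\<bar>x i\<bar> > R" for x
  proof -
    have "x \<notin> cube d (\<lambda>_. 0) R"
    proof
      assume "x \<in> cube d (\<lambda>_. 0) R"
      then show False using that(2) assms(3) by (simp add: cube_iff) (meson not_le)
    qed
    then have "x \<notin> supp d u" using R(2) by blast
    then show "u x = 0" "?F x = 0"
      using not_in_supp[OF that(1)] supp_partial_deriv[OF assms(3), of u] by blast+
  qed
  have "integrable (Rmeas d) ?F"
    using assms(2) supp_partial_deriv[OF assms(3)]
    by (intro integrable_compact_supp[OF Fc] compactin_supp)
  moreover have ins: "{..<d} = insert i ?I" using assms(3) by auto
  ultimately have int: "integrable (PiM (insert i ?I) (\<lambda>_. lborel)) ?F" by simp
  have "(LINT x|Rmeas d. ?F x) = (LINT x|PiM (insert i ?I) (\<lambda>_. lborel). ?F x)"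
    using ins by simp
  also have "\<dots> = (\<integral>x. (\<integral>y. ?F (x(i := y)) \<partial>lborel) \<partial>PiM ?I (\<lambda>_. lborel))"
    by (rule Rprod.product_integral_insert[OF _ _ int]) auto
  also have "\<dots> = (\<integral>x. 0 \<partial>PiM ?I (\<lambda>_. lborel :: real measure))"
  proof (rule Bochner_Integration.integral_cong[OF refl])
    fix x assume "x \<in> space (PiM ?I (\<lambda>_. lborel :: real measure))"
    then have x': "x(i := 0) \<in> topspace (Rtop d)"
      using assms(3) by (auto simp: space_PiM PiE_iff extensional_def)
    \<comment> \<open>The point x lives on the index set without \<open>i\<close>; x0 is a point of
      the full space on the same line.\<close>
    define x0 where "x0 = x(i := 0)"
    have x0: "x0 \<in> topspace (Rtop d)" "\<And>y. x(i := y) = x0(i := y)"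
      using x' by (auto simp: x0_def)
    have line: "x0(i := y) \<in> topspace (Rtop d)" for y
      using x0(1) assms(3) fun_upd_in_Rtop by auto
    have z: "u (x0(i := y)) = 0" "?F (x0(i := y)) = 0" if "\<bar>y\<bar> > R" for y
      using zero[OF line] that by auto
    \<comment> \<open>The endpoints are moved to R + 1 because u is known to vanish only where |x i|
      > R.\<close>
    have "(\<integral>y. ?F (x(i := y)) \<partial>lborel) =
        (\<integral>y. indicator {- (R + 1)..R + 1} y *\<^sub>R ?F (x0(i := y)) \<partial>lborel)"
      unfolding x0(2)
    proof (rule Bochner_Integration.integral_cong[OF refl])
      fix y
      show "?F (x0(i := y)) = indicator {- (R + 1)..R + 1} y *\<^sub>R ?F (x0(i := y))"
        using z(2)[of y] by (cases "y \<in> {- (R + 1)..R + 1}") auto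
    qed
    also have "\<dots> = u (x0(i := R + 1)) - u (x0(i := - (R + 1)))"
    proof (rule integral_FTC_Icc)
      show "- (R + 1) \<le> R + 1" using R(1) by simp
      show "((\<lambda>y. u (x0(i := y))) has_vector_derivative ?F (x0(i := y))) (at y within {- (R + 1)..R + 1})" for y
        by (rule has_vector_derivative_at_within[OF C_k_has_partial_deriv_at[OF assms(1,3) x0(1)]])
      have "continuous_map euclidean euclidean (?F \<circ> (\<lambda>y. x0(i := y)))"
        by (rule continuous_map_compose[OF continuous_map_fun_upd[OF assms(3) x0(1)] Fc])
      then have "continuous_on UNIV (\<lambda>y. ?F (x0(i := y)))" by (simp add: o_def)
      then show "continuous_on {- (R + 1)..R + 1} (\<lambda>y. ?F (x0(i := y)))"
        by (rule continuous_on_subset) simp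
    qed
    also have "\<dots> = 0" using z(1) R(1) by simp
    finally show "(\<integral>y. ?F (x(i := y)) \<partial>lborel) = 0" .
  qed
  finally show ?thesis by simp
qed

section \<open>Lebesgue measure as a product over blocks\<close>

subsection \<open>Product of blocks\<close>

text \<open>Finds the block that contains the coordinate \<open>k\<close>; blocks of dimension 0 are
  skipped by the strict inequality. It is used to invert the decomposition into blocks.\<close>

definition block_index :: "(nat \<Rightarrow> nat) \<Rightarrow> nat \<Rightarrow> nat" where
  "block_index d k = (LEAST j. k < offset d (Suc j))"

lemma block_index_offset: "i < d j \<Longrightarrow> block_index d (offset d j + i) = j"
  unfolding block_index_def
proof (rule Least_equality)
  fix l assume i: "i < d j" and "offset d j + i < offset d (Suc l)"
  then show "j \<le> l" using offset_Suc_le[of l j d] by (cases "l < j") auto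
qed simp

definition concat_blocks :: "nat \<Rightarrow> (nat \<Rightarrow> nat) \<Rightarrow> (nat \<Rightarrow> nat \<Rightarrow> real) \<Rightarrow> nat \<Rightarrow> real" where
  "concat_blocks n d y = (\<lambda>k\<in>{..<offset d n}. y (block_index d k) (k - offset d (block_index d k)))"

lemma concat_blocks_offset:
  "j < n \<Longrightarrow> i < d j \<Longrightarrow> concat_blocks n d y (offset d j + i) = y j i"
  by (simp add: concat_blocks_def offset_add_less block_index_offset)

lemma block_concat_blocks:
  assumes "j < n" "y j \<in> PiE {..<d j} (\<lambda>_. UNIV)"
  shows "block d j (concat_blocks n d y) = y j"
proof
  fix i
  show "block d j (concat_blocks n d y) i = y j i"
    using assms by (cases "i < d j") (auto simp: block_def concat_blocks_offset PiE_iff extensional_def)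
qed

lemma prod_lessThan_add:
  "(\<Prod>k<a + b. g k) = (\<Prod>k<a. g k) * (\<Prod>i<b. g (a + i))" for a b :: nat
  and g :: "nat \<Rightarrow> 'a::comm_monoid_mult"
  by (induction b) (auto simp: ac_simps)

lemma prod_offset: "(\<Prod>k<offset d n. g k) = (\<Prod>j<n. \<Prod>i<d j. g (offset d j + i))"
  for g :: "nat \<Rightarrow> 'a::comm_monoid_mult"
  by (induction n) (auto simp: prod_lessThan_add)

interpretation Rblocks: product_sigma_finite "\<lambda>j::nat. Rmeas (d j)" for d
  by (simp add: product_sigma_finite_def Rprod.sigma_finite)

lemma measurable_concat_blocks:
  "concat_blocks n d \<in> measurable (PiM {..<n} (\<lambda>j. Rmeas (d j))) (Rmeas (offset d n))"
  unfolding concat_blocks_def[abs_def]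
proof (rule measurable_restrict)
  fix k assume "k \<in> {..<offset d n}"
  then obtain j i where ji: "j < n" "i < d j" "k = offset d j + i" using offset_cases[of k d n] by auto
  have "(\<lambda>y. y j i) \<in> measurable (PiM {..<n} (\<lambda>j. Rmeas (d j))) lborel"
    by (rule measurable_compose[of "\<lambda>y. y j" _ "Rmeas (d j)" "\<lambda>x. x i"])
      (use ji in \<open>auto intro!: measurable_component_singleton\<close>)
  then show "(\<lambda>y. y (block_index d k) (k - offset d (block_index d k)))
      \<in> measurable (PiM {..<n} (\<lambda>j. Rmeas (d j))) lborel"
    using ji by (simp add: block_index_offset)
qed

text \<open>Product measures are determined by their values on boxes. The preimage of a box is a box
  of boxes, and \<open>prod_offset\<close> regroups the product of the side measures.\<close>

lemma distr_concat_blocks: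
  "distr (PiM {..<n} (\<lambda>j. Rmeas (d j))) (Rmeas (offset d n)) (concat_blocks n d) = Rmeas (offset d n)"
proof (rule Rprod.PiM_eqI)
  fix A :: "nat \<Rightarrow> real set" assume A: "\<And>k. k \<in> {..<offset d n} \<Longrightarrow> A k \<in> sets lborel"
  let ?P = "PiM {..<n} (\<lambda>j. Rmeas (d j))" and ?B = "\<lambda>j. PiE {..<d j} (\<lambda>i. A (offset d j + i))"
  have mA: "A (offset d j + i) \<in> sets lborel" if "j < n" "i < d j" for j i
    using A offset_add_less[of j n i d] that by auto
  have "concat_blocks n d -` PiE {..<offset d n} A \<inter> space ?P = PiE {..<n} ?B"
  proof (rule set_eqI)
    fix y
    have "(\<forall>k<offset d n. concat_blocks n d y k \<in> A k) \<longleftrightarrow> (\<forall>j<n. \<forall>i<d j. y j i \<in> A (offset d j + i))"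
      (is "?L = ?R")
    proof
      assume ?L
      then show ?R using offset_add_less concat_blocks_offset by metis
    next
      assume ?R
      show ?L
      proof (intro allI impI)
        fix k assume "k < offset d n"
        then obtain j i where "j < n" "i < d j" "k = offset d j + i" by (rule offset_cases)
        then show "concat_blocks n d y k \<in> A k" using \<open>?R\<close> by (simp add: concat_blocks_offset)
      qed
    qed
    moreover have "concat_blocks n d y \<in> extensional {..<offset d n}"
      by (simp add: concat_blocks_def)
    ultimately show "y \<in> concat_blocks n d -` PiE {..<offset d n} A \<inter> space ?P \<longleftrightarrow> y \<in> PiE {..<n} ?B"
      by (auto simp: space_PiM PiE_iff)
  qed
  then have "emeasure (distr ?P (Rmeas (offset d n)) (concat_blocks n d)) (PiE {..<offset d n} A) =
      emeasure ?P (PiE {..<n} ?B)"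
    using A by (subst emeasure_distr[OF measurable_concat_blocks]) (auto intro!: sets_PiM_I_finite)
  also have "\<dots> = (\<Prod>j<n. emeasure (Rmeas (d j)) (?B j))"
    using mA by (intro Rblocks.emeasure_PiM) (auto intro!: sets_PiM_I_finite)
  also have "\<dots> = (\<Prod>j<n. \<Prod>i<d j. emeasure lborel (A (offset d j + i)))"
    using mA by (intro prod.cong refl Rprod.emeasure_PiM) auto
  also have "\<dots> = (\<Prod>k<offset d n. emeasure lborel (A k))" by (rule prod_offset[symmetric])
  finally show "emeasure (distr ?P (Rmeas (offset d n)) (concat_blocks n d)) (PiE {..<offset d n} A) =
      (\<Prod>k<offset d n. emeasure lborel (A k))" .
qed auto

lemma measurable_block:
  assumes "j < n"
  shows "block d j \<in> measurable (Rmeas (offset d n)) (Rmeas (d j))"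
  unfolding block_def[abs_def]
  by (intro measurable_restrict measurable_component_singleton) (use offset_add_less[OF assms] in auto)

text \<open>The reason why L^2 norms of tensors are products. In this nonnegative form integrability
  of a tensor is a result, obtained from finiteness of the right hand side, and not a
  condition.\<close>

lemma nn_integral_block_prod:
  assumes f: "\<And>j. j < n \<Longrightarrow> f j \<in> borel_measurable (Rmeas (d j))"
  shows "(\<integral>\<^sup>+x. (\<Prod>j<n. f j (block d j x)) \<partial>Rmeas (offset d n)) = (\<Prod>j<n. \<integral>\<^sup>+x. f j x \<partial>Rmeas (d j))"
proof -
  have "(\<lambda>x. f j (block d j x)) \<in> borel_measurable (Rmeas (offset d n))" if "j < n" for j
    using measurable_compose[OF measurable_block[OF that, of d] f[OF that]] .
  then have m: "(\<lambda>x. \<Prod>j<n. f j (block d j x)) \<in> borel_measurable (Rmeas (offset d n))"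
    by (intro borel_measurable_prod_ennreal) auto
  have "(\<integral>\<^sup>+x. (\<Prod>j<n. f j (block d j x)) \<partial>Rmeas (offset d n)) =
     (\<integral>\<^sup>+y. (\<Prod>j<n. f j (block d j (concat_blocks n d y))) \<partial>PiM {..<n} (\<lambda>j. Rmeas (d j)))"
    using nn_integral_distr[OF measurable_concat_blocks[of n d], of "\<lambda>x. \<Prod>j<n. f j (block d j x)"] m
    by (simp only: distr_concat_blocks)
  also have "\<dots> = (\<integral>\<^sup>+y. (\<Prod>j<n. f j (y j)) \<partial>PiM {..<n} (\<lambda>j. Rmeas (d j)))"
    by (intro nn_integral_cong prod.cong refl) (auto simp: space_PiM PiE_iff block_concat_blocks)
  also have "\<dots> = (\<Prod>j<n. \<integral>\<^sup>+x. f j x \<partial>Rmeas (d j))"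
    using f by (intro Rblocks.product_nn_integral_prod) auto
  finally show ?thesis .
qed

section \<open>The fundamental lemma of the calculus of variations, L^2 estimates and weak
  gradients\<close>

section \<open>Weak derivatives\<close>

text \<open>The real and the imaginary part are each compared with zero as densities of the same set
  function.\<close>

lemma set_integrals_zero_imp_AE_zero:
  fixes f :: "'a \<Rightarrow> complex"
  assumes f: "integrable M f" and zero: "\<And>A. A \<in> sets M \<Longrightarrow> (LINT x|M. indicator A x *\<^sub>R f x) = 0"
  shows "AE x in M. f x = 0"
proof -
  have real: "AE x in M. L (f x) = 0" if L: "bounded_linear L" for L :: "complex \<Rightarrow> real"
  proof (rule density_unique_real)
    show int: "integrable M (\<lambda>x. L (f x))" by (rule integrable_bounded_linear[OF L f])
    fix A assume A: "A \<in> sets M"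
    have "(LINT x|M. L (indicator A x *\<^sub>R f x)) = L (LINT x|M. indicator A x *\<^sub>R f x)"
      by (rule integral_bounded_linear[OF L]) (use A f in \<open>auto intro: integrable_mult_indicator\<close>)
    then show "(\<integral>x\<in>A. L (f x) \<partial>M) = (\<integral>x\<in>A. 0 \<partial>M)"
      using zero[OF A] linear_simps[OF L] by (simp add: set_lebesgue_integral_def)
  qed simp
  have "AE x in M. Re (f x) = 0" "AE x in M. Im (f x) = 0"
    using real[OF bounded_linear_Re] real[OF bounded_linear_Im] .
  then show ?thesis by eventually_elim (simp add: complex_eq_iff)
qed

text \<open>These sets are stable under intersection, generate the product sigma-algebra, and have
  indicators that are pointwise limits of products of smooth steps.\<close>

definition upper_orthant :: "nat \<Rightarrow> (nat \<Rightarrow> real) \<Rightarrow> (nat \<Rightarrow> real) set" where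
  "upper_orthant d a = {x \<in> PiE {..<d} (\<lambda>_. UNIV). \<forall>i<d. a i < x i}"

lemma sets_Rmeas_eq_orthants:
  "sets (Rmeas d) = sigma_sets (PiE {..<d} (\<lambda>_. UNIV)) (range (upper_orthant d))"
proof -
  \<comment> \<open>\<open>sets_PiM_sigma\<close> asks for countably many generators that cover each
    factor.\<close>
  have cover: "\<exists>S\<subseteq>range greaterThan. countable S \<and> (UNIV :: real set) = \<Union>S"
  proof (intro exI[of _ "range (\<lambda>m::nat. {- real m<..})"] conjI)
    show "(UNIV :: real set) = (\<Union>m::nat. {- real m<..})"
    proof safe
      fix x :: real
      obtain m :: nat where "- x < real m" using reals_Archimedean2 by blast
      then show "x \<in> (\<Union>m::nat. {- real m<..})" by (auto intro!: exI[of _ m])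
    qed simp
  qed auto
  have "sets (Rmeas d) = sets (PiM {..<d} (\<lambda>_. sigma UNIV (range greaterThan :: real set set)))"
    by (rule sets_PiM_cong) (auto simp: borel_Ioi)
  also have "\<dots> = sets (sigma (PiE {..<d} (\<lambda>_. UNIV))
      {{f \<in> PiE {..<d} (\<lambda>_. UNIV). \<forall>i\<in>j. f i \<in> A i} | A j. j \<in> {{..<d}} \<and>
        A \<in> Pi j (\<lambda>_. range greaterThan :: real set set)})"
    by (rule sets_PiM_sigma) (use cover in auto)
  also have "{{f \<in> PiE {..<d} (\<lambda>_. UNIV). \<forall>i\<in>j. f i \<in> A i} | A j. j \<in> {{..<d}} \<and>
        A \<in> Pi j (\<lambda>_. range greaterThan :: real set set)} = range (upper_orthant d)" (is "?L = ?R")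
  proof (intro equalityI subsetI)
    fix X assume "X \<in> ?L"
    then obtain A where A: "X = {f \<in> PiE {..<d} (\<lambda>_. UNIV). \<forall>i\<in>{..<d}. f i \<in> A i}"
      "\<forall>i\<in>{..<d}. A i \<in> range (greaterThan :: real \<Rightarrow> _)" by (auto simp: Pi_iff)
    then have "\<forall>i\<in>{..<d}. \<exists>a. A i = {a<..}" by blast
    then obtain a where "\<And>i. i \<in> {..<d} \<Longrightarrow> A i = {a i<..}" by metis
    then have "X = upper_orthant d a" unfolding A(1) upper_orthant_def by auto
    then show "X \<in> ?R" by blast
  next
    fix X assume "X \<in> ?R"
    then obtain a where "X = upper_orthant d a" by blast
    then have X: "X = {f \<in> PiE {..<d} (\<lambda>_. UNIV). \<forall>i\<in>{..<d}. f i \<in> {a i<..}}"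
      "(\<lambda>i. {a i<..}) \<in> Pi {..<d} (\<lambda>_. range greaterThan)"
      by (auto simp: upper_orthant_def)
    show "X \<in> ?L"
      by (intro CollectI exI[of _ "\<lambda>i. {a i<..}"] exI[of _ "{..<d}"] conjI X) simp
  qed
  finally show ?thesis by (simp add: upper_orthant_def[abs_def] image_subset_iff)
qed

lemma Int_stable_orthants: "Int_stable (range (upper_orthant d))"
proof (rule Int_stableI)
  fix A B assume "A \<in> range (upper_orthant d)" "B \<in> range (upper_orthant d)"
  then obtain a b where "A = upper_orthant d a" "B = upper_orthant d b" by blast
  then have "A \<inter> B = upper_orthant d (\<lambda>i. max (a i) (b i))"
    by (auto simp: upper_orthant_def)
  then show "A \<inter> B \<in> range (upper_orthant d)" by blast
qed

text \<open>A Dynkin argument: the sets over which f integrates to zero are closed under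
  complements, by \<open>total\<close>, and under countable disjoint unions, so they contain
  whatever the orthants generate.\<close>

lemma AE_zero_if_orthants:
  fixes f :: "_ \<Rightarrow> complex"
  assumes f: "integrable (Rmeas d) f" and total: "(LINT x|Rmeas d. f x) = 0"
    and orth: "\<And>a. (LINT x|Rmeas d. indicator (upper_orthant d a) x *\<^sub>R f x) = 0"
  shows "AE x in Rmeas d. f x = 0"
proof (rule set_integrals_zero_imp_AE_zero[OF f])
  let ?O = "PiE {..<d} (\<lambda>_. UNIV :: real set)"
  fix A assume "A \<in> sets (Rmeas d)"
  then have A: "A \<in> sigma_sets ?O (range (upper_orthant d))" by (simp add: sets_Rmeas_eq_orthants)
  show "(LINT x|Rmeas d. indicator A x *\<^sub>R f x) = 0"
  proof (rule sigma_sets_induct_disjoint[OF Int_stable_orthants _ A])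
    show "range (upper_orthant d) \<subseteq> Pow ?O" by (auto simp: upper_orthant_def)
  next
    fix B assume "B \<in> range (upper_orthant d)"
    then show "(LINT x|Rmeas d. indicator B x *\<^sub>R f x) = 0" using orth by blast
  next
    fix B assume B: "B \<in> sigma_sets ?O (range (upper_orthant d))"
      "(LINT x|Rmeas d. indicator B x *\<^sub>R f x) = 0"
    then have mB: "B \<in> sets (Rmeas d)" by (simp add: sets_Rmeas_eq_orthants)
    have "(LINT x|Rmeas d. indicator (?O - B) x *\<^sub>R f x) =
        (LINT x|Rmeas d. f x - indicator B x *\<^sub>R f x)"
      by (rule Bochner_Integration.integral_cong) (auto simp: indicator_def)
    also have "\<dots> = 0"
      using B(2) total f mB by (subst Bochner_Integration.integral_diff) (auto intro: integrable_mult_indicator)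
    finally show "(LINT x|Rmeas d. indicator (?O - B) x *\<^sub>R f x) = 0" .
  next
    fix B :: "nat \<Rightarrow> _" assume B: "disjoint_family B" "range B \<subseteq> sigma_sets ?O (range (upper_orthant d))"
      "\<And>i. (LINT x|Rmeas d. indicator (B i) x *\<^sub>R f x) = 0"
    then have mB: "B i \<in> sets (Rmeas d)" for i by (auto simp: sets_Rmeas_eq_orthants)
    have "(LINT x:(\<Union>i. B i)|Rmeas d. f x) = (\<Sum>i. (LINT x:(B i)|Rmeas d. f x))"
      using B(1) mB f by (intro lebesgue_integral_countable_add)
        (auto simp: disjoint_family_on_def set_integrable_def intro!: integrable_mult_indicator)
    then show "(LINT x|Rmeas d. indicator (\<Union>i. B i) x *\<^sub>R f x) = 0"
      using B(3) by (simp add: set_lebesgue_integral_def)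
  qed simp
qed

lemma smooth_orthant_approx: "smooth d (\<lambda>x. \<Prod>i<d. of_real (smooth_step (m * (x i - a i))))"
  unfolding smooth_def
proof
  fix k
  have "cdiff k (\<lambda>t. smooth_step (m * t + (- m * a i)))" for i
    by (intro cdiff_affine cdiff_smooth_step)
  then have "cdiff k (\<lambda>t. smooth_step (m * (t - a i)))" for i
    by (simp add: algebra_simps)
  then show "C_k d k (\<lambda>x. \<Prod>i<d. of_real (smooth_step (m * (x i - a i))))"
    by (intro C_k_prod C_k_coordinate[where f = "\<lambda>t. smooth_step (m * (t - a _))"]) auto
qed

text \<open>For s > 0 the argument m s exceeds 1 eventually and the step is 1; for s \<le> 0 the
  step is 0 for every m. The limit is thus the indicator of an orthant with strict
  inequalities.\<close>

lemma orthant_approx_tendsto: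
  assumes "x \<in> PiE {..<d} (\<lambda>_. UNIV)"
  shows "(\<lambda>m. \<Prod>i<d. complex_of_real (smooth_step (real m * (x i - a i)))) \<longlonglongrightarrow> indicator (upper_orthant d a) x"
proof -
  have lim: "(\<lambda>m. complex_of_real (smooth_step (real m * s))) \<longlonglongrightarrow> (if s > 0 then 1 else 0)" for s
  proof (cases "s > 0")
    case True
    obtain m0 :: nat where m0: "1 / s < real m0" using reals_Archimedean2 by blast
    have "\<forall>\<^sub>F m in sequentially. 1 = complex_of_real (smooth_step (real m * s))"
      using eventually_ge_at_top[of m0]
    proof eventually_elim
      case (elim m)
      then have "1 / s \<le> real m" using m0 by linarith
      then have "1 \<le> real m * s" using True by (simp add: field_simps)
      then show ?case by (simp add: smooth_step_ge_1)
    qed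
    then show ?thesis using True by (simp add: Lim_transform_eventually[OF tendsto_const])
  next
    case False
    then have "real m * s \<le> 0" for m by (simp add: mult_nonneg_nonpos)
    then show ?thesis using False by (simp add: smooth_step_nonpos)
  qed
  have "(\<lambda>m. \<Prod>i<d. complex_of_real (smooth_step (real m * (x i - a i)))) \<longlonglongrightarrow>
      (\<Prod>i<d. if x i - a i > 0 then 1 else 0)"
    by (intro tendsto_prod lim)
  also have "(\<Prod>i<d. if x i - a i > 0 then 1 else 0) = (indicator (upper_orthant d a) x :: complex)"
  proof (cases "\<forall>i<d. a i < x i")
    case True
    then show ?thesis using assms by (simp add: upper_orthant_def)
  next
    case False
    then obtain i where "i < d" "\<not> a i < x i" by blast
    then have "(\<Prod>i<d. if x i - a i > 0 then 1 else 0) = (0 :: complex)"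
      by (intro prod_zero) auto
    moreover have "x \<notin> upper_orthant d a"
      using \<open>i < d\<close> \<open>\<not> a i < x i\<close> by (auto simp: upper_orthant_def)
    ultimately show ?thesis by simp
  qed
  finally show ?thesis .
qed

lemma sets_orthant [measurable]: "upper_orthant d a \<in> sets (Rmeas d)"
  unfolding sets_Rmeas_eq_orthants by (rule sigma_sets.Basic) blast

text \<open>Dominated convergence carries the hypothesis from smooth products to indicators of
  orthants; |f| dominates because the products lie between 0 and 1. The functions u need not have
  compact support, as f itself is integrable on the whole space.\<close>

lemma AE_zero_if_test_integrals_zero:
  assumes f: "integrable (Rmeas d) f"
    and zero: "\<And>u. smooth d u \<Longrightarrow> (LINT x|Rmeas d. f x * u x) = 0"
  shows "AE x in Rmeas d. f x = (0 :: complex)"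
proof (rule AE_zero_if_orthants[OF f])
  show "(LINT x|Rmeas d. f x) = 0" using zero[of "\<lambda>_. 1"] by (simp add: smooth_def C_k_const)
next
  fix a
  let ?p = "\<lambda>m x. \<Prod>i<d. complex_of_real (smooth_step (real m * (x i - a i)))"
  have "(\<lambda>m. LINT x|Rmeas d. f x * ?p m x) \<longlonglongrightarrow> (LINT x|Rmeas d. indicator (upper_orthant d a) x *\<^sub>R f x)"
  proof (rule integral_dominated_convergence[where w = "\<lambda>x. norm (f x)"])
    show "(\<lambda>x. indicator (upper_orthant d a) x *\<^sub>R f x) \<in> borel_measurable (Rmeas d)"
      using f by measurable
    show "(\<lambda>x. f x * ?p m x) \<in> borel_measurable (Rmeas d)" for m
      using f borel_measurable_Rmeas_continuous[OF C_k_continuous[OF smoothD[OF smooth_orthant_approx]]]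
      by (intro borel_measurable_times) auto
    show "AE x in Rmeas d. (\<lambda>m. f x * ?p m x) \<longlonglongrightarrow> indicator (upper_orthant d a) x *\<^sub>R f x"
    proof (rule AE_I2)
      fix x assume "x \<in> space (Rmeas d)"
      then have "(\<lambda>m. f x * ?p m x) \<longlonglongrightarrow> f x * indicator (upper_orthant d a) x"
        by (intro tendsto_mult tendsto_const orthant_approx_tendsto) simp
      then show "(\<lambda>m. f x * ?p m x) \<longlonglongrightarrow> indicator (upper_orthant d a) x *\<^sub>R f x"
        by (cases "x \<in> upper_orthant d a") simp_all
    qed
    show "AE x in Rmeas d. norm (f x * ?p m x) \<le> norm (f x)" for m
    proof (rule AE_I2)
      fix x
      have "norm (?p m x) \<le> 1"
        by (simp add: prod_norm[symmetric] abs_of_nonneg smooth_step_bounds prod_le_1)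
      then show "norm (f x * ?p m x) \<le> norm (f x)"
        by (subst norm_mult) (rule mult_left_le, simp_all)
    qed
    show "integrable (Rmeas d) (\<lambda>x. norm (f x))" using f by simp
  qed
  then show "(LINT x|Rmeas d. indicator (upper_orthant d a) x *\<^sub>R f x) = 0"
    using zero[OF smooth_orthant_approx] by (simp add: LIMSEQ_const_iff)
qed

subsection \<open>The space \<open>L\<^sup>2\<close>\<close>

lemma L2_normsq: "(L2_norm d \<Omega> f)\<^sup>2 = (LINT x|dom_meas d \<Omega>. (cmod (f x))\<^sup>2)"
  by (simp add: L2_norm_def)

lemma L2D: "f \<in> L2 d \<Omega> \<Longrightarrow> f \<in> borel_measurable (dom_meas d \<Omega>)"
  "f \<in> L2 d \<Omega> \<Longrightarrow> integrable (dom_meas d \<Omega>) (\<lambda>x. (cmod (f x))\<^sup>2)"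
  by (auto simp: L2_def)

lemma space_dom_meas: "space (dom_meas d \<Omega>) \<subseteq> \<Omega>"
  by (auto simp: space_restrict_space)

lemma L2_cong: "f \<in> L2 d \<Omega> \<Longrightarrow> (\<And>x. x \<in> \<Omega> \<Longrightarrow> f x = g x) \<Longrightarrow> g \<in> L2 d \<Omega>"
proof -
  assume f: "f \<in> L2 d \<Omega>" and eq: "\<And>x. x \<in> \<Omega> \<Longrightarrow> f x = g x"
  have eq': "f x = g x" if "x \<in> space (dom_meas d \<Omega>)" for x
    using eq that space_dom_meas by blast
  have "g \<in> borel_measurable (dom_meas d \<Omega>)"
    using L2D(1)[OF f] by (subst measurable_cong[OF eq'[symmetric]])
  moreover have "integrable (dom_meas d \<Omega>) (\<lambda>x. (cmod (g x))\<^sup>2)"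
    using L2D(2)[OF f] Bochner_Integration.integrable_cong[OF refl, of "dom_meas d \<Omega>" "\<lambda>x. (cmod (f x))\<^sup>2" "\<lambda>x. (cmod (g x))\<^sup>2"] eq'
    by simp
  ultimately show ?thesis by (simp add: L2_def)
qed

lemma L2_norm_cong: "(\<And>x. x \<in> \<Omega> \<Longrightarrow> f x = g x) \<Longrightarrow> L2_norm d \<Omega> f = L2_norm d \<Omega> g"
  unfolding L2_norm_def using space_dom_meas[of d \<Omega>]
  by (intro arg_cong[of _ _ sqrt] Bochner_Integration.integral_cong) auto

lemma L2_norm_cong_AE:
  assumes "f \<in> L2 d \<Omega>" "g \<in> L2 d \<Omega>" "AE x in dom_meas d \<Omega>. f x = g x"
  shows "L2_norm d \<Omega> f = L2_norm d \<Omega> g"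
proof -
  have "(LINT x|dom_meas d \<Omega>. (cmod (f x))\<^sup>2) = (LINT x|dom_meas d \<Omega>. (cmod (g x))\<^sup>2)"
  proof (rule integral_cong_AE)
    show "AE x in dom_meas d \<Omega>. (cmod (f x))\<^sup>2 = (cmod (g x))\<^sup>2"
      using assms(3) by eventually_elim simp
  qed (use assms L2D in auto)
  then show ?thesis by (simp add: L2_norm_def)
qed

text \<open>Stands in for the triangle inequality: norms are estimated through their squares, and
  the factor 2 is absorbed in the choice of epsilons.\<close>

lemma cmod_add_sq_le: "(cmod (a + b))\<^sup>2 \<le> 2 * (cmod a)\<^sup>2 + 2 * (cmod b)\<^sup>2"
proof -
  have "(cmod (a + b))\<^sup>2 \<le> (cmod a + cmod b)\<^sup>2"
    by (intro power_mono norm_triangle_ineq) auto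
  also have "\<dots> \<le> 2 * (cmod a)\<^sup>2 + 2 * (cmod b)\<^sup>2"
    using sum_squares_bound[of "cmod a" "cmod b"] by (simp add: power2_sum)
  finally show ?thesis .
qed

lemma L2_add:
  assumes "f \<in> L2 d \<Omega>" "g \<in> L2 d \<Omega>"
  shows "(\<lambda>x. f x + g x) \<in> L2 d \<Omega>"
    "(L2_norm d \<Omega> (\<lambda>x. f x + g x))\<^sup>2 \<le> 2 * (L2_norm d \<Omega> f)\<^sup>2 + 2 * (L2_norm d \<Omega> g)\<^sup>2"
proof -
  let ?w = "\<lambda>x. 2 * (cmod (f x))\<^sup>2 + 2 * (cmod (g x))\<^sup>2"
  note [measurable] = L2D(1)[OF assms(1)] L2D(1)[OF assms(2)]
  have w: "integrable (dom_meas d \<Omega>) ?w"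
    using L2D(2)[OF assms(1)] L2D(2)[OF assms(2)] by simp
  have int: "integrable (dom_meas d \<Omega>) (\<lambda>x. (cmod (f x + g x))\<^sup>2)"
    by (rule Bochner_Integration.integrable_bound[OF w]) (auto intro!: AE_I2 cmod_add_sq_le)
  then show "(\<lambda>x. f x + g x) \<in> L2 d \<Omega>" by (simp add: L2_def)
  have "(LINT x|dom_meas d \<Omega>. (cmod (f x + g x))\<^sup>2) \<le> (LINT x|dom_meas d \<Omega>. ?w x)"
    by (rule integral_mono[OF int w]) (rule cmod_add_sq_le)
  then show "(L2_norm d \<Omega> (\<lambda>x. f x + g x))\<^sup>2 \<le> 2 * (L2_norm d \<Omega> f)\<^sup>2 + 2 * (L2_norm d \<Omega> g)\<^sup>2"
    using L2D(2)[OF assms(1)] L2D(2)[OF assms(2)] by (simp add: L2_normsq)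
qed

lemma L2_cmult:
  assumes "f \<in> L2 d \<Omega>"
  shows "(\<lambda>x. c * f x) \<in> L2 d \<Omega>" "L2_norm d \<Omega> (\<lambda>x. c * f x) = cmod c * L2_norm d \<Omega> f"
  using L2D[OF assms]
  by (auto simp: L2_def L2_norm_def norm_mult power_mult_distrib real_sqrt_mult)

lemma L2_diff:
  assumes "f \<in> L2 d \<Omega>" "g \<in> L2 d \<Omega>"
  shows "(\<lambda>x. f x - g x) \<in> L2 d \<Omega>"
  using L2_add(1)[OF assms(1) L2_cmult(1)[OF assms(2)], of "-1"] by simp

text \<open>Young's inequality with a free weight s. It plays the part of the Cauchy-Schwarz
  inequality once s is fitted to the size of the factors.\<close>

lemma cmod_mult_le: "cmod (a * b) \<le> (s * (cmod a)\<^sup>2 + (cmod b)\<^sup>2 / s) / 2" if "s > 0"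
proof -
  have "0 \<le> (s * cmod a - cmod b)\<^sup>2" by simp
  then have "2 * s * (cmod a * cmod b) \<le> s\<^sup>2 * (cmod a)\<^sup>2 + (cmod b)\<^sup>2"
    by (simp add: power2_diff power_mult_distrib algebra_simps)
  then show ?thesis using that by (simp add: norm_mult field_simps power2_eq_square)
qed

lemma L2_mult:
  assumes "f \<in> L2 d \<Omega>" "g \<in> L2 d \<Omega>"
  shows "integrable (dom_meas d \<Omega>) (\<lambda>x. f x * g x)"
    "s > 0 \<Longrightarrow> cmod (LINT x|dom_meas d \<Omega>. f x * g x) \<le> (s * (L2_norm d \<Omega> f)\<^sup>2 + (L2_norm d \<Omega> g)\<^sup>2 / s) / 2"
proof -
  note [measurable] = L2D(1)[OF assms(1)] L2D(1)[OF assms(2)]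
  have w: "integrable (dom_meas d \<Omega>) (\<lambda>x. (s * (cmod (f x))\<^sup>2 + (cmod (g x))\<^sup>2 / s) / 2)" for s
    using L2D(2)[OF assms(1)] L2D(2)[OF assms(2)] by simp
  show int: "integrable (dom_meas d \<Omega>) (\<lambda>x. f x * g x)"
    by (rule Bochner_Integration.integrable_bound[OF w[of 1]])
      (simp, rule AE_I2, rule order_trans[OF cmod_mult_le[OF zero_less_one]], simp)
  assume "s > 0"
  have "cmod (LINT x|dom_meas d \<Omega>. f x * g x) \<le> (LINT x|dom_meas d \<Omega>. cmod (f x * g x))"
    by (rule integral_norm_bound)
  also have "\<dots> \<le> (LINT x|dom_meas d \<Omega>. (s * (cmod (f x))\<^sup>2 + (cmod (g x))\<^sup>2 / s) / 2)"
    by (rule integral_mono[OF integrable_norm[OF int] w cmod_mult_le[OF \<open>s > 0\<close>]])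
  also have "\<dots> = (s * (L2_norm d \<Omega> f)\<^sup>2 + (L2_norm d \<Omega> g)\<^sup>2 / s) / 2"
    using L2D(2)[OF assms(1)] L2D(2)[OF assms(2)] by (simp add: L2_normsq)
  finally show "cmod (LINT x|dom_meas d \<Omega>. f x * g x) \<le> (s * (L2_norm d \<Omega> f)\<^sup>2 + (L2_norm d \<Omega> g)\<^sup>2 / s) / 2" .
qed

lemma open_in_Rmeas: "openin (Rtop d) \<Omega> \<Longrightarrow> \<Omega> \<inter> space (Rmeas d) \<in> sets (Rmeas d)"
  by (intro sets.Int sets_Rmeas_openin sets.top)

lemma L2_compact_supp:
  assumes "openin (Rtop d) \<Omega>" "continuous_map (Rtop d) euclidean u" "compactin (Rtop d) (supp d u)"
  shows "u \<in> L2 d \<Omega>"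
proof -
  have "continuous_map (Rtop d) euclidean (\<lambda>x. u x * cnj (u x))"
    by (intro continuous_map_complex_mult assms(2) continuous_map_euclidean_compose[OF assms(2)] continuous_intros)
  moreover have "compactin (Rtop d) (supp d (\<lambda>x. u x * cnj (u x)))"
    by (rule compactin_supp[OF assms(3)], rule supp_minimal[OF closedin_supp]) (simp add: not_in_supp)
  ultimately have "integrable (Rmeas d) (\<lambda>x. u x * cnj (u x))"
    by (rule integrable_compact_supp)
  then have "integrable (Rmeas d) (\<lambda>x. norm (u x * cnj (u x)))" by (rule integrable_norm)
  then have "integrable (Rmeas d) (\<lambda>x. (cmod (u x))\<^sup>2)"
    by (simp add: norm_mult power2_eq_square)
  then have "integrable (dom_meas d \<Omega>) (\<lambda>x. (cmod (u x))\<^sup>2)"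
    using assms(1) by (subst integrable_restrict_space[OF open_in_Rmeas])
      (auto intro: integrable_mult_indicator sets_Rmeas_openin simp del: real_scaleR_def)
  moreover have "u \<in> borel_measurable (dom_meas d \<Omega>)"
    by (intro measurable_restrict_space1 borel_measurable_Rmeas_continuous assms(2))
  ultimately show ?thesis by (simp add: L2_def)
qed

lemma L2_test_function:
  "openin (Rtop d) \<Omega> \<Longrightarrow> u \<in> test_functions d U \<Longrightarrow> u \<in> L2 d \<Omega>"
  by (intro L2_compact_supp) (auto dest: test_functionsD intro: C_k_continuous[OF smoothD])

lemma integral_dom_meas_supp:
  fixes u :: "_ \<Rightarrow> complex"
  assumes "openin (Rtop d) \<Omega>" "\<And>x. x \<in> topspace (Rtop d) \<Longrightarrow> x \<notin> \<Omega> \<Longrightarrow> u x = 0"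
  shows "(LINT x|dom_meas d \<Omega>. u x) = (LINT x|Rmeas d. u x)"
  unfolding integral_restrict_space[OF open_in_Rmeas[OF assms(1)]]
  by (rule Bochner_Integration.integral_cong) (use assms(2) in \<open>auto simp: indicator_def\<close>)

subsection \<open>Weak gradients\<close>

text \<open>Localization: h is multiplied by cutoffs of countably many cubes that exhaust \<Omega>,
  and the exceptional null sets are united.\<close>

lemma AE_zero_if_orthogonal_to_test_functions:
  assumes \<Omega>: "openin (Rtop d) \<Omega>" and h: "h \<in> L2 d \<Omega>"
    and zero: "\<And>\<phi>. \<phi> \<in> test_functions d \<Omega> \<Longrightarrow> (LINT x|dom_meas d \<Omega>. h x * \<phi> x) = 0"
  shows "AE x in dom_meas d \<Omega>. h x = 0"
proof -
  \<comment> \<open>Extended by zero, h \<eta> is integrable on the whole space, and \<eta> u is a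
    test function on \<Omega> for every smooth u, so the lemma for smooth functions applies.\<close>
  have loc: "AE x in Rmeas d. x \<in> \<Omega> \<longrightarrow> h x * \<eta> x = 0" if \<eta>: "\<eta> \<in> test_functions d \<Omega>" for \<eta>
  proof -
    let ?f = "\<lambda>x. indicator \<Omega> x *\<^sub>R (h x * \<eta> x)"
    have "integrable (dom_meas d \<Omega>) (\<lambda>x. h x * \<eta> x)"
      by (rule L2_mult(1)[OF h L2_test_function[OF \<Omega> \<eta>]])
    then have "integrable (Rmeas d) ?f"
      by (simp add: integrable_restrict_space[OF open_in_Rmeas[OF \<Omega>]])
    moreover have "(LINT x|Rmeas d. ?f x * u x) = 0" if "smooth d u" for u
    proof -
      have "(LINT x|Rmeas d. ?f x * u x) = (LINT x|dom_meas d \<Omega>. h x * (\<eta> x * u x))"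
        by (simp add: integral_restrict_space[OF open_in_Rmeas[OF \<Omega>]] mult.assoc)
      then show ?thesis using zero[OF test_functions_mult[OF \<eta> that]] by simp
    qed
    ultimately have "AE x in Rmeas d. ?f x = 0" by (rule AE_zero_if_test_integrals_zero)
    then show ?thesis by eventually_elim auto
  qed
  define Q where "Q = {(c, m :: nat). c \<in> PiE {..<d} (\<lambda>_. \<rat>) \<and> cube d c (1 / real (Suc m)) \<subseteq> \<Omega>}"
  have "countable Q"
    by (rule countable_subset[of _ "PiE {..<d} (\<lambda>_. \<rat>) \<times> UNIV"])
      (auto simp: Q_def intro!: countable_SIGMA countable_PiE countable_rat)
  moreover have "AE x in Rmeas d. x \<in> cube d (fst q) (1 / real (Suc (snd q))) \<longrightarrow> h x = 0" if "q \<in> Q" for q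
  proof -
    have sub: "cube d (fst q) (1 / real (Suc (snd q))) \<subseteq> \<Omega>" using that by (auto simp: Q_def)
    obtain \<eta> where \<eta>: "\<eta> \<in> test_functions d \<Omega>"
      "\<And>x. x \<in> cube d (fst q) (1 / real (Suc (snd q))) \<Longrightarrow> \<eta> x = 1"
      using exists_cutoff[OF compactin_cube sub \<Omega>] by blast
    from loc[OF \<eta>(1)] show ?thesis
      by eventually_elim (use \<eta>(2) sub in \<open>auto simp del: of_nat_Suc\<close>)
  qed
  ultimately have AE: "AE x in Rmeas d. \<forall>q\<in>Q. x \<in> cube d (fst q) (1 / real (Suc (snd q))) \<longrightarrow> h x = 0"
    by (subst AE_ball_countable) auto
  have cover: "\<exists>q\<in>Q. x \<in> cube d (fst q) (1 / real (Suc (snd q)))" if x: "x \<in> \<Omega>" for x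
  proof -
    obtain r where r: "r > 0" "cube d x r \<subseteq> \<Omega>" using openin_contains_cube[OF \<Omega> x] .
    obtain m :: nat where m: "2 / r < real m" using reals_Archimedean2 by blast
    \<comment> \<open>A rational centre is found within \<delta> of x in each coordinate; the cube
      of radius \<delta> around it then lies in the cube of radius 2 \<delta> \<le> r around
      x.\<close>
    define \<delta> where "\<delta> = 1 / real (Suc m)"
    have \<delta>: "\<delta> > 0" "2 * \<delta> \<le> r"
      using m r(1) by (auto simp: \<delta>_def field_simps)
    have "\<forall>i. \<exists>q\<in>\<rat>. x i - \<delta> < q \<and> q < x i + \<delta>"
      using \<delta>(1) by (intro allI Rats_dense_in_real) simp
    then obtain c where c: "\<And>i. c i \<in> \<rat>" "\<And>i. x i - \<delta> < c i" "\<And>i. c i < x i + \<delta>" by metis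
    \<comment> \<open>The centre has to be extensional in order to occur in the countable set
      Q.\<close>
    define c' where "c' = restrict c {..<d}"
    have cc: "\<bar>x i - c' i\<bar> \<le> \<delta>" if "i < d" for i
      using c(2,3)[of i] that by (auto simp: c'_def)
    have xt: "x \<in> PiE {..<d} (\<lambda>_. UNIV)" using openin_subset[OF \<Omega>] x by auto
    have "cube d c' \<delta> \<subseteq> cube d x r"
    proof
      fix y assume y: "y \<in> cube d c' \<delta>"
      have "\<bar>y i - x i\<bar> \<le> r" if "i < d" for i
      proof -
        have "\<bar>y i - c' i\<bar> \<le> \<delta>" using y that by (simp add: cube_iff)
        then show ?thesis using cc[OF that] \<delta>(2) by linarith
      qed
      then show "y \<in> cube d x r" using y by (simp add: cube_iff)
    qed
    then have "(c', m) \<in> Q" using r(2) c(1) by (auto simp: Q_def c'_def \<delta>_def)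
    moreover have "x \<in> cube d c' \<delta>" using cc xt by (simp add: cube_iff)
    ultimately show ?thesis unfolding \<delta>_def by force
  qed
  have "AE x in Rmeas d. x \<in> \<Omega> \<longrightarrow> h x = 0"
    using AE by eventually_elim (use cover in blast)
  then show ?thesis by (simp only: AE_restrict_space_iff[OF open_in_Rmeas[OF \<Omega>]])
qed

text \<open>Carries the gradient as an explicit witness. Sums, limits and tensors come with a
  natural gradient, whereas \<open>weak_deriv\<close> is only a choice that need not respect any
  operation.\<close>

definition weak_grad ::
  "nat \<Rightarrow> (nat \<Rightarrow> real) set \<Rightarrow> ((nat \<Rightarrow> real) \<Rightarrow> complex) \<Rightarrow> (nat \<Rightarrow> (nat \<Rightarrow> real) \<Rightarrow> complex) \<Rightarrow> bool" where
  "weak_grad d \<Omega> f G \<longleftrightarrow> f \<in> L2 d \<Omega> \<and> (\<forall>i<d. G i \<in> L2 d \<Omega> \<and> is_weak_deriv d \<Omega> i f (G i))"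

lemma weak_gradD:
  assumes "weak_grad d \<Omega> f G"
  shows "f \<in> L2 d \<Omega>" "i < d \<Longrightarrow> G i \<in> L2 d \<Omega>" "i < d \<Longrightarrow> is_weak_deriv d \<Omega> i f (G i)"
  using assms by (auto simp: weak_grad_def)

lemma weak_grad_H1: "weak_grad d \<Omega> f G \<Longrightarrow> f \<in> H1 d \<Omega>"
  by (auto simp: weak_grad_def H1_def)

lemma weak_grad_weak_deriv:
  assumes "f \<in> H1 d \<Omega>"
  shows "weak_grad d \<Omega> f (\<lambda>i. weak_deriv d \<Omega> i f)"
proof -
  have "weak_deriv d \<Omega> i f \<in> L2 d \<Omega> \<and> is_weak_deriv d \<Omega> i f (weak_deriv d \<Omega> i f)" if "i < d" for i
  proof -
    have "\<exists>g. g \<in> L2 d \<Omega> \<and> is_weak_deriv d \<Omega> i f g" using assms that by (auto simp: H1_def)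
    from someI_ex[OF this] show ?thesis by (simp only: weak_deriv_def)
  qed
  then show ?thesis using assms by (auto simp: weak_grad_def H1_def)
qed

context
  fixes d :: nat and \<Omega> :: "(nat \<Rightarrow> real) set"
  assumes open_\<Omega>: "openin (Rtop d) \<Omega>"
begin

lemma weak_grad_unique:
  assumes "weak_grad d \<Omega> f G" "weak_grad d \<Omega> f G'" "i < d"
  shows "AE x in dom_meas d \<Omega>. G i x = G' i x"
proof -
  note G = weak_gradD(2,3)[OF assms(1,3)] and G' = weak_gradD(2,3)[OF assms(2,3)]
  have "AE x in dom_meas d \<Omega>. G i x - G' i x = 0"
  proof (rule AE_zero_if_orthogonal_to_test_functions[OF open_\<Omega> L2_diff[OF G(1) G'(1)]])
    fix \<phi> assume \<phi>: "\<phi> \<in> test_functions d \<Omega>"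
    have "- (LINT x|dom_meas d \<Omega>. G i x * \<phi> x) = - (LINT x|dom_meas d \<Omega>. G' i x * \<phi> x)"
      using G(2) G'(2) \<phi> unfolding is_weak_deriv_def by metis
    then show "(LINT x|dom_meas d \<Omega>. (G i x - G' i x) * \<phi> x) = 0"
      using L2_mult(1)[OF G(1) L2_test_function[OF open_\<Omega> \<phi>]] L2_mult(1)[OF G'(1) L2_test_function[OF open_\<Omega> \<phi>]]
      by (simp add: left_diff_distrib)
  qed
  then show ?thesis by simp
qed

text \<open>The derivatives chosen inside \<open>H1_norm\<close> agree almost everywhere with the
  gradient at hand, so the norm may be computed from the latter.\<close>

lemma H1_normsq:
  assumes "weak_grad d \<Omega> f G"
  shows "(H1_norm d \<Omega> f)\<^sup>2 = (L2_norm d \<Omega> f)\<^sup>2 + (\<Sum>i<d. (L2_norm d \<Omega> (G i))\<^sup>2)"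
proof -
  note W = weak_grad_weak_deriv[OF weak_grad_H1[OF assms]]
  have "L2_norm d \<Omega> (weak_deriv d \<Omega> i f) = L2_norm d \<Omega> (G i)" if "i < d" for i
    by (rule L2_norm_cong_AE[OF weak_gradD(2)[OF W that] weak_gradD(2)[OF assms that]
          weak_grad_unique[OF W assms that]])
  then show ?thesis by (simp add: H1_norm_def sum_nonneg)
qed

lemma weak_grad_add:
  assumes "weak_grad d \<Omega> f F" "weak_grad d \<Omega> g G"
  shows "weak_grad d \<Omega> (\<lambda>x. f x + g x) (\<lambda>i x. F i x + G i x)"
proof -
  note f = weak_gradD[OF assms(1)] and g = weak_gradD[OF assms(2)]
  have "is_weak_deriv d \<Omega> i (\<lambda>x. f x + g x) (\<lambda>x. F i x + G i x)" if i: "i < d" for i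
    unfolding is_weak_deriv_def
  proof
    fix \<phi> assume \<phi>: "\<phi> \<in> test_functions d \<Omega>"
    note L = L2_test_function[OF open_\<Omega> \<phi>] L2_test_function[OF open_\<Omega> test_functions_partial_deriv[OF \<phi> i]]
    have "(LINT x|dom_meas d \<Omega>. f x * partial_deriv i \<phi> x) = - (LINT x|dom_meas d \<Omega>. F i x * \<phi> x)"
      "(LINT x|dom_meas d \<Omega>. g x * partial_deriv i \<phi> x) = - (LINT x|dom_meas d \<Omega>. G i x * \<phi> x)"
      using f(3)[OF i] g(3)[OF i] \<phi> by (auto simp: is_weak_deriv_def)
    then show "(LINT x|dom_meas d \<Omega>. (f x + g x) * partial_deriv i \<phi> x) =
        - (LINT x|dom_meas d \<Omega>. (F i x + G i x) * \<phi> x)"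
      using L2_mult(1)[OF f(1) L(2)] L2_mult(1)[OF g(1) L(2)]
        L2_mult(1)[OF f(2)[OF i] L(1)] L2_mult(1)[OF g(2)[OF i] L(1)]
      by (simp add: distrib_right)
  qed
  then show ?thesis using f(1,2) g(1,2) by (auto simp: weak_grad_def intro!: L2_add)
qed

lemma weak_grad_cmult:
  assumes "weak_grad d \<Omega> f F"
  shows "weak_grad d \<Omega> (\<lambda>x. c * f x) (\<lambda>i x. c * F i x)"
  using assms by (auto simp: weak_grad_def is_weak_deriv_def mult.assoc intro!: L2_cmult)

lemma weak_grad_diff:
  assumes "weak_grad d \<Omega> f F" "weak_grad d \<Omega> g G"
  shows "weak_grad d \<Omega> (\<lambda>x. f x - g x) (\<lambda>i x. F i x - G i x)"
  using weak_grad_add[OF assms(1) weak_grad_cmult[OF assms(2), of "-1"]] by simp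

lemma is_weak_deriv_cong:
  assumes "\<And>x. x \<in> \<Omega> \<Longrightarrow> f x = g x"
  shows "is_weak_deriv d \<Omega> i f h = is_weak_deriv d \<Omega> i g h"
proof -
  have "(LINT x|dom_meas d \<Omega>. f x * partial_deriv i \<phi> x) = (LINT x|dom_meas d \<Omega>. g x * partial_deriv i \<phi> x)" for \<phi>
    using space_dom_meas[of d \<Omega>] assms by (intro Bochner_Integration.integral_cong) auto
  then show ?thesis by (simp add: is_weak_deriv_def)
qed

lemma weak_grad_cong:
  assumes "weak_grad d \<Omega> f G" "\<And>x. x \<in> \<Omega> \<Longrightarrow> f x = g x"
  shows "weak_grad d \<Omega> g G"
  using assms is_weak_deriv_cong[of f g] L2_cong[of f d \<Omega> g] by (auto simp: weak_grad_def)

text \<open>For functions that agree on \<Omega> the choice operator sees the same predicate, so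
  their weak derivatives are literally equal.\<close>

lemma H1_norm_cong:
  assumes "\<And>x. x \<in> \<Omega> \<Longrightarrow> f x = g x"
  shows "H1_norm d \<Omega> f = H1_norm d \<Omega> g"
proof -
  have "weak_deriv d \<Omega> i f = weak_deriv d \<Omega> i g" for i
    using is_weak_deriv_cong[OF assms] by (simp add: weak_deriv_def)
  then show ?thesis using L2_norm_cong[OF assms] by (simp add: H1_norm_def)
qed

text \<open>The gradient is a closed operator: the defining identity passes to the limit because
  both of its sides are continuous in L^2.\<close>

lemma weak_grad_limit:
  assumes f: "f \<in> L2 d \<Omega>" and G: "\<And>i. i < d \<Longrightarrow> G i \<in> L2 d \<Omega>"
    and approx: "\<And>\<epsilon>. \<epsilon> > 0 \<Longrightarrow> \<exists>f' G'. weak_grad d \<Omega> f' G' \<and> (L2_norm d \<Omega> (\<lambda>x. f x - f' x))\<^sup>2 \<le> \<epsilon> \<and>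
      (\<forall>i<d. (L2_norm d \<Omega> (\<lambda>x. G i x - G' i x))\<^sup>2 \<le> \<epsilon>)"
  shows "weak_grad d \<Omega> f G"
proof -
  have "is_weak_deriv d \<Omega> i f (G i)" if i: "i < d" for i
    unfolding is_weak_deriv_def
  proof
    fix \<phi> assume \<phi>: "\<phi> \<in> test_functions d \<Omega>"
    let ?\<phi>' = "partial_deriv i \<phi>"
    note L = L2_test_function[OF open_\<Omega> \<phi>] L2_test_function[OF open_\<Omega> test_functions_partial_deriv[OF \<phi> i]]
    define z where "z = (LINT x|dom_meas d \<Omega>. f x * ?\<phi>' x) + (LINT x|dom_meas d \<Omega>. G i x * \<phi> x)"
    \<comment> \<open>The norms come from the test function and its derivative, the 2 from the two
      approximation errors after division by \<epsilon>.\<close>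
    define C where "C = (L2_norm d \<Omega> \<phi>)\<^sup>2 + (L2_norm d \<Omega> ?\<phi>')\<^sup>2 + 2"
    have bound: "cmod z \<le> C * \<epsilon> / 2" if \<epsilon>: "\<epsilon> > 0" for \<epsilon>
    proof -
      obtain f' G' where A: "weak_grad d \<Omega> f' G'" "(L2_norm d \<Omega> (\<lambda>x. f x - f' x))\<^sup>2 \<le> \<epsilon>\<^sup>2"
        "(L2_norm d \<Omega> (\<lambda>x. G i x - G' i x))\<^sup>2 \<le> \<epsilon>\<^sup>2"
        \<comment> \<open>Squared errors of size \<epsilon>^2 together with the weight 1/\<epsilon>
          in Young's inequality make every term linear in \<epsilon>.\<close>
        using approx[of "\<epsilon>\<^sup>2"] \<epsilon> i by auto
      note f' = weak_gradD[OF A(1)]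
      have "(LINT x|dom_meas d \<Omega>. f' x * ?\<phi>' x) + (LINT x|dom_meas d \<Omega>. G' i x * \<phi> x) = 0"
        using f'(3)[OF i] \<phi> by (simp add: is_weak_deriv_def)
      then have "z = (LINT x|dom_meas d \<Omega>. (f x - f' x) * ?\<phi>' x) + (LINT x|dom_meas d \<Omega>. (G i x - G' i x) * \<phi> x)"
        using L2_mult(1)[OF f L(2)] L2_mult(1)[OF f'(1) L(2)] L2_mult(1)[OF G[OF i] L(1)]
          L2_mult(1)[OF f'(2)[OF i] L(1)]
        by (simp add: z_def left_diff_distrib algebra_simps)
      then have "cmod z \<le> cmod (LINT x|dom_meas d \<Omega>. (f x - f' x) * ?\<phi>' x) +
          cmod (LINT x|dom_meas d \<Omega>. (G i x - G' i x) * \<phi> x)"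
        by (simp add: norm_triangle_ineq)
      also have "\<dots> \<le> (1 / \<epsilon> * (L2_norm d \<Omega> (\<lambda>x. f x - f' x))\<^sup>2 + (L2_norm d \<Omega> ?\<phi>')\<^sup>2 / (1 / \<epsilon>)) / 2 +
          (1 / \<epsilon> * (L2_norm d \<Omega> (\<lambda>x. G i x - G' i x))\<^sup>2 + (L2_norm d \<Omega> \<phi>)\<^sup>2 / (1 / \<epsilon>)) / 2"
        using \<epsilon> f' G i by (intro add_mono L2_mult(2) L2_diff f L) auto
      also have "\<dots> \<le> (1 / \<epsilon> * \<epsilon>\<^sup>2 + (L2_norm d \<Omega> ?\<phi>')\<^sup>2 / (1 / \<epsilon>)) / 2 +
          (1 / \<epsilon> * \<epsilon>\<^sup>2 + (L2_norm d \<Omega> \<phi>)\<^sup>2 / (1 / \<epsilon>)) / 2"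
        using \<epsilon> A(2,3) by (intro add_mono divide_right_mono mult_left_mono order_refl) auto
      also have "\<dots> = C * \<epsilon> / 2"
        using \<epsilon> by (simp add: C_def field_simps power2_eq_square)
      finally show ?thesis .
    qed
    have "C > 0" by (simp add: C_def add_nonneg_pos)
    have "cmod z \<le> e" if "e > 0" for e
      using bound[of "e / C"] \<open>C > 0\<close> that by simp
    then have "z = 0" by (metis field_le_epsilon add_0 norm_le_zero_iff)
    then show "(LINT x|dom_meas d \<Omega>. f x * ?\<phi>' x) = - (LINT x|dom_meas d \<Omega>. G i x * \<phi> x)"
      by (simp add: z_def add_eq_0_iff2)
  qed
  then show ?thesis using f G by (simp add: weak_grad_def)
qed

text \<open>The derivative of u \<phi> integrates to zero over the whole space, and off \<Omega>
  both \<phi> and its derivative vanish. So no boundary term arises, although u may be nonzero at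
  the boundary.\<close>

lemma weak_grad_C1:
  assumes u: "C_k d (Suc 0) u" "compactin (Rtop d) (supp d u)"
  shows "weak_grad d \<Omega> u (\<lambda>i. partial_deriv i u)"
proof -
  have du: "continuous_map (Rtop d) euclidean (partial_deriv i u)" "compactin (Rtop d) (supp d (partial_deriv i u))"
    if "i < d" for i
    using C_k_continuous[OF C_k_partial_deriv[OF u(1) that]] compactin_supp[OF u(2) supp_partial_deriv[OF that]] .
  have "is_weak_deriv d \<Omega> i u (partial_deriv i u)" if i: "i < d" for i
    unfolding is_weak_deriv_def
  proof
    fix \<phi> assume \<phi>: "\<phi> \<in> test_functions d \<Omega>"
    note \<phi>' = test_functions_partial_deriv[OF \<phi> i]
    have C\<phi>: "C_k d (Suc 0) \<phi>" by (rule smoothD[OF test_functionsD(1)[OF \<phi>]])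
    have prod: "C_k d (Suc 0) (\<lambda>x. u x * \<phi> x)" by (rule C_k_mult[OF u(1) C\<phi>])
    have "supp d (\<lambda>x. u x * \<phi> x) \<subseteq> supp d u"
      by (rule supp_minimal[OF closedin_supp]) (simp add: not_in_supp)
    then have "(LINT x|Rmeas d. partial_deriv i (\<lambda>x. u x * \<phi> x) x) = 0"
      by (intro integral_partial_deriv_eq_0[OF prod _ i] compactin_supp[OF u(2)])
    also have "(LINT x|Rmeas d. partial_deriv i (\<lambda>x. u x * \<phi> x) x) =
        (LINT x|Rmeas d. u x * partial_deriv i \<phi> x + partial_deriv i u x * \<phi> x)"
    proof (rule Bochner_Integration.integral_cong[OF refl])
      fix x assume "x \<in> space (Rmeas d)"
      then have "x \<in> topspace (Rtop d)" by simp
      then show "partial_deriv i (\<lambda>x. u x * \<phi> x) x = u x * partial_deriv i \<phi> x + partial_deriv i u x * \<phi> x"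
        by (rule partial_deriv_mult[OF u(1) C\<phi> i])
    qed
    also have "\<dots> = (LINT x|dom_meas d \<Omega>. u x * partial_deriv i \<phi> x + partial_deriv i u x * \<phi> x)"
    proof (rule integral_dom_meas_supp[OF open_\<Omega>, symmetric])
      fix x assume x: "x \<in> topspace (Rtop d)" "x \<notin> \<Omega>"
      then have "\<phi> x = 0" "partial_deriv i \<phi> x = 0"
        using test_functionsD(3)[OF \<phi>] test_functionsD(3)[OF \<phi>'] not_in_supp[OF x(1)] by blast+
      then show "u x * partial_deriv i \<phi> x + partial_deriv i u x * \<phi> x = 0" by simp
    qed
    also have "\<dots> = (LINT x|dom_meas d \<Omega>. u x * partial_deriv i \<phi> x) + (LINT x|dom_meas d \<Omega>. partial_deriv i u x * \<phi> x)"
      by (intro Bochner_Integration.integral_add L2_mult(1) L2_compact_supp[OF open_\<Omega>] L2_test_function[OF open_\<Omega> \<phi>]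
          L2_test_function[OF open_\<Omega> \<phi>'] du i u(2) C_k_continuous[OF u(1)])
    finally show "(LINT x|dom_meas d \<Omega>. u x * partial_deriv i \<phi> x) = - (LINT x|dom_meas d \<Omega>. partial_deriv i u x * \<phi> x)"
      by (simp add: add_eq_0_iff2)
  qed
  then show ?thesis
    using L2_compact_supp[OF open_\<Omega>] du u C_k_continuous[OF u(1)] by (simp add: weak_grad_def)
qed

subsection \<open>Closed subspaces of \<open>H\<^sup>1\<close>\<close>

lemma H1_add: "f \<in> H1 d \<Omega> \<Longrightarrow> g \<in> H1 d \<Omega> \<Longrightarrow> (\<lambda>x. f x + g x) \<in> H1 d \<Omega>"
  using weak_grad_add[OF weak_grad_weak_deriv weak_grad_weak_deriv] by (rule weak_grad_H1)

lemma H1_cmult: "f \<in> H1 d \<Omega> \<Longrightarrow> (\<lambda>x. c * f x) \<in> H1 d \<Omega>"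
  using weak_grad_cmult[OF weak_grad_weak_deriv] by (rule weak_grad_H1)

lemma H1_diff: "f \<in> H1 d \<Omega> \<Longrightarrow> g \<in> H1 d \<Omega> \<Longrightarrow> (\<lambda>x. f x - g x) \<in> H1 d \<Omega>"
  using weak_grad_diff[OF weak_grad_weak_deriv weak_grad_weak_deriv] by (rule weak_grad_H1)

lemma H1_cong: "f \<in> H1 d \<Omega> \<Longrightarrow> (\<And>x. x \<in> \<Omega> \<Longrightarrow> f x = g x) \<Longrightarrow> g \<in> H1 d \<Omega>"
  using weak_grad_cong[OF weak_grad_weak_deriv] weak_grad_H1 by blast

lemma H1_norm_nonneg: "0 \<le> H1_norm d \<Omega> f"
  by (simp add: H1_norm_def sum_nonneg)

lemma H1_norm_add:
  assumes "f \<in> H1 d \<Omega>" "g \<in> H1 d \<Omega>"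
  shows "(H1_norm d \<Omega> (\<lambda>x. f x + g x))\<^sup>2 \<le> 2 * (H1_norm d \<Omega> f)\<^sup>2 + 2 * (H1_norm d \<Omega> g)\<^sup>2"
proof -
  note f = weak_grad_weak_deriv[OF assms(1)] and g = weak_grad_weak_deriv[OF assms(2)]
  let ?F = "\<lambda>i. weak_deriv d \<Omega> i f" and ?G = "\<lambda>i. weak_deriv d \<Omega> i g"
  have "(H1_norm d \<Omega> (\<lambda>x. f x + g x))\<^sup>2 =
      (L2_norm d \<Omega> (\<lambda>x. f x + g x))\<^sup>2 + (\<Sum>i<d. (L2_norm d \<Omega> (\<lambda>x. ?F i x + ?G i x))\<^sup>2)"
    by (rule H1_normsq[OF weak_grad_add[OF f g]])
  also have "\<dots> \<le> (2 * (L2_norm d \<Omega> f)\<^sup>2 + 2 * (L2_norm d \<Omega> g)\<^sup>2) +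
      (\<Sum>i<d. 2 * (L2_norm d \<Omega> (?F i))\<^sup>2 + 2 * (L2_norm d \<Omega> (?G i))\<^sup>2)"
    by (intro add_mono sum_mono L2_add(2) weak_gradD[OF f] weak_gradD[OF g]) auto
  also have "\<dots> = 2 * (H1_norm d \<Omega> f)\<^sup>2 + 2 * (H1_norm d \<Omega> g)\<^sup>2"
    by (simp add: H1_normsq[OF f] H1_normsq[OF g] sum.distrib sum_distrib_left)
  finally show ?thesis .
qed

lemma H1_norm_cmult:
  assumes "f \<in> H1 d \<Omega>"
  shows "H1_norm d \<Omega> (\<lambda>x. c * f x) = cmod c * H1_norm d \<Omega> f"
proof -
  note f = weak_grad_weak_deriv[OF assms]
  have "(H1_norm d \<Omega> (\<lambda>x. c * f x))\<^sup>2 = (cmod c * H1_norm d \<Omega> f)\<^sup>2"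
    using weak_gradD[OF f] by (simp add: H1_normsq[OF weak_grad_cmult[OF f]] H1_normsq[OF f] L2_cmult(2)
      power_mult_distrib distrib_left sum_distrib_left)
  then show ?thesis by (simp add: H1_norm_nonneg power2_eq_iff_nonneg)
qed

lemma H1_closureI:
  assumes "f \<in> H1 d \<Omega>" "\<And>\<epsilon>. \<epsilon> > 0 \<Longrightarrow> \<exists>g\<in>S. (H1_norm d \<Omega> (\<lambda>x. f x - g x))\<^sup>2 < \<epsilon>"
  shows "f \<in> H1_closure d \<Omega> S"
proof -
  have "\<exists>g\<in>S. H1_norm d \<Omega> (\<lambda>x. f x - g x) < \<epsilon>" if "\<epsilon> > 0" for \<epsilon>
    using assms(2)[of "\<epsilon>\<^sup>2"] that power2_less_imp_less[of _ \<epsilon>] by auto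
  then show ?thesis using assms(1) by (simp add: H1_closure_def)
qed

lemma H1_closureD:
  assumes "f \<in> H1_closure d \<Omega> S"
  shows "f \<in> H1 d \<Omega>" "\<epsilon> > 0 \<Longrightarrow> \<exists>g\<in>S. (H1_norm d \<Omega> (\<lambda>x. f x - g x))\<^sup>2 < \<epsilon>"
proof -
  show "f \<in> H1 d \<Omega>" using assms by (simp add: H1_closure_def)
  assume "\<epsilon> > 0"
  then obtain g where g: "g \<in> S" "H1_norm d \<Omega> (\<lambda>x. f x - g x) < sqrt \<epsilon>"
    using assms unfolding H1_closure_def by (fastforce dest: spec[of _ "sqrt \<epsilon>"])
  then have "(H1_norm d \<Omega> (\<lambda>x. f x - g x))\<^sup>2 < (sqrt \<epsilon>)\<^sup>2"
    using H1_norm_nonneg by (intro power_strict_mono) auto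
  then show "\<exists>g\<in>S. (H1_norm d \<Omega> (\<lambda>x. f x - g x))\<^sup>2 < \<epsilon>" using g(1) \<open>\<epsilon> > 0\<close> by auto
qed

lemma H1_norm_zero: "H1_norm d \<Omega> (\<lambda>x. 0) = 0"
proof -
  have "(\<lambda>_. 0) \<in> L2 d \<Omega>" by (simp add: L2_def)
  then have "weak_grad d \<Omega> (\<lambda>_. 0) (\<lambda>_ _. 0)" by (simp add: weak_grad_def is_weak_deriv_def)
  from H1_normsq[OF this] show ?thesis by (simp add: L2_norm_def)
qed

lemma H1_closure_subset: "S \<subseteq> H1 d \<Omega> \<Longrightarrow> S \<subseteq> H1_closure d \<Omega> S"
proof
  fix f assume "S \<subseteq> H1 d \<Omega>" "f \<in> S"
  then show "f \<in> H1_closure d \<Omega> S"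
    by (intro H1_closureI) (auto intro!: bexI[of _ f] simp: H1_norm_zero)
qed

lemma H1_closure_closed:
  assumes S: "S \<subseteq> H1 d \<Omega>" and f: "f \<in> H1 d \<Omega>"
    and approx: "\<And>\<epsilon>. \<epsilon> > 0 \<Longrightarrow> \<exists>g\<in>H1_closure d \<Omega> S. (H1_norm d \<Omega> (\<lambda>x. f x - g x))\<^sup>2 < \<epsilon>"
  shows "f \<in> H1_closure d \<Omega> S"
proof (rule H1_closureI[OF f])
  fix \<epsilon> :: real assume "\<epsilon> > 0"
  then obtain g where g: "g \<in> H1_closure d \<Omega> S" "(H1_norm d \<Omega> (\<lambda>x. f x - g x))\<^sup>2 < \<epsilon> / 4"
    using approx[of "\<epsilon> / 4"] by auto
  then obtain h where h: "h \<in> S" "(H1_norm d \<Omega> (\<lambda>x. g x - h x))\<^sup>2 < \<epsilon> / 4"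
    using H1_closureD(2)[OF g(1), of "\<epsilon> / 4"] \<open>\<epsilon> > 0\<close> by auto
  have "(H1_norm d \<Omega> (\<lambda>x. (f x - g x) + (g x - h x)))\<^sup>2 \<le>
      2 * (H1_norm d \<Omega> (\<lambda>x. f x - g x))\<^sup>2 + 2 * (H1_norm d \<Omega> (\<lambda>x. g x - h x))\<^sup>2"
    using f g(1) h(1) S by (intro H1_norm_add H1_diff) (auto dest: H1_closureD)
  then have "(H1_norm d \<Omega> (\<lambda>x. f x - h x))\<^sup>2 < \<epsilon>" using g(2) h(2) by simp
  then show "\<exists>g\<in>S. (H1_norm d \<Omega> (\<lambda>x. f x - g x))\<^sup>2 < \<epsilon>" using h(1) by blast
qed

text \<open>Serves both inclusions of the form domains: it is enough to place the generators in the
  other closure.\<close>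

lemma H1_closure_mono_closure:
  assumes "S \<subseteq> H1_closure d \<Omega> S'" "S' \<subseteq> H1 d \<Omega>"
  shows "H1_closure d \<Omega> S \<subseteq> H1_closure d \<Omega> S'"
proof
  fix f assume f: "f \<in> H1_closure d \<Omega> S"
  show "f \<in> H1_closure d \<Omega> S'"
    using assms(1) H1_closureD(2)[OF f] by (intro H1_closure_closed[OF assms(2) H1_closureD(1)[OF f]]) blast
qed

lemma H1_closure_cong:
  assumes "f \<in> H1_closure d \<Omega> S" "\<And>x. x \<in> \<Omega> \<Longrightarrow> f x = g x"
  shows "g \<in> H1_closure d \<Omega> S"
proof (rule H1_closureI)
  show "g \<in> H1 d \<Omega>" using H1_cong[OF H1_closureD(1)[OF assms(1)] assms(2)] .
  fix \<epsilon> :: real assume "\<epsilon> > 0"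
  moreover have "H1_norm d \<Omega> (\<lambda>x. f x - h x) = H1_norm d \<Omega> (\<lambda>x. g x - h x)" for h
    by (rule H1_norm_cong) (simp add: assms(2))
  ultimately show "\<exists>h\<in>S. (H1_norm d \<Omega> (\<lambda>x. g x - h x))\<^sup>2 < \<epsilon>"
    using H1_closureD(2)[OF assms(1)] by simp
qed

text \<open>Closure of S under addition is asked only up to values off \<Omega>: a restricted
  function is \<open>undefined\<close> there, and a sum of two such functions need not be of this
  form.\<close>

lemma H1_closure_add:
  assumes S: "S \<subseteq> H1 d \<Omega>" and add: "\<And>f g. f \<in> S \<Longrightarrow> g \<in> S \<Longrightarrow> \<exists>h\<in>S. \<forall>x\<in>\<Omega>. h x = f x + g x"
    and fg: "f \<in> H1_closure d \<Omega> S" "g \<in> H1_closure d \<Omega> S"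
  shows "(\<lambda>x. f x + g x) \<in> H1_closure d \<Omega> S"
proof (rule H1_closureI)
  note fH = H1_closureD(1)[OF fg(1)] and gH = H1_closureD(1)[OF fg(2)]
  show "(\<lambda>x. f x + g x) \<in> H1 d \<Omega>" by (rule H1_add[OF fH gH])
  fix \<epsilon> :: real assume "\<epsilon> > 0"
  then obtain f' g' where f': "f' \<in> S" "(H1_norm d \<Omega> (\<lambda>x. f x - f' x))\<^sup>2 < \<epsilon> / 4"
    and g': "g' \<in> S" "(H1_norm d \<Omega> (\<lambda>x. g x - g' x))\<^sup>2 < \<epsilon> / 4"
    using H1_closureD(2)[OF fg(1), of "\<epsilon> / 4"] H1_closureD(2)[OF fg(2), of "\<epsilon> / 4"] by auto
  obtain h where h: "h \<in> S" "\<forall>x\<in>\<Omega>. h x = f' x + g' x" using add[OF f'(1) g'(1)] by blast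
  have "H1_norm d \<Omega> (\<lambda>x. f x + g x - h x) = H1_norm d \<Omega> (\<lambda>x. (f x - f' x) + (g x - g' x))"
    by (rule H1_norm_cong) (use h(2) in simp)
  moreover have "(H1_norm d \<Omega> (\<lambda>x. (f x - f' x) + (g x - g' x)))\<^sup>2 \<le>
      2 * (H1_norm d \<Omega> (\<lambda>x. f x - f' x))\<^sup>2 + 2 * (H1_norm d \<Omega> (\<lambda>x. g x - g' x))\<^sup>2"
    using fH gH f'(1) g'(1) S by (intro H1_norm_add H1_diff) auto
  ultimately have "(H1_norm d \<Omega> (\<lambda>x. f x + g x - h x))\<^sup>2 < \<epsilon>" using f'(2) g'(2) by simp
  then show "\<exists>h\<in>S. (H1_norm d \<Omega> (\<lambda>x. f x + g x - h x))\<^sup>2 < \<epsilon>" using h(1) by blast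
qed

lemma H1_closure_cmult:
  assumes S: "S \<subseteq> H1 d \<Omega>" and cmult: "\<And>f c. f \<in> S \<Longrightarrow> \<exists>h\<in>S. \<forall>x\<in>\<Omega>. h x = c * f x"
    and f: "f \<in> H1_closure d \<Omega> S"
  shows "(\<lambda>x. c * f x) \<in> H1_closure d \<Omega> S"
proof (rule H1_closureI)
  note fH = H1_closureD(1)[OF f]
  show "(\<lambda>x. c * f x) \<in> H1 d \<Omega>" by (rule H1_cmult[OF fH])
  fix \<epsilon> :: real assume \<epsilon>: "\<epsilon> > 0"
  \<comment> \<open>The summand 1 permits division by K also when c = 0.\<close>
  define K where "K = (cmod c)\<^sup>2 + 1"
  have K: "K > 0" "(cmod c)\<^sup>2 \<le> K" by (auto simp: K_def add_nonneg_pos)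
  obtain f' where f': "f' \<in> S" "(H1_norm d \<Omega> (\<lambda>x. f x - f' x))\<^sup>2 < \<epsilon> / K"
    using H1_closureD(2)[OF f, of "\<epsilon> / K"] \<epsilon> K(1) by auto
  obtain h where h: "h \<in> S" "\<forall>x\<in>\<Omega>. h x = c * f' x" using cmult[OF f'(1)] by blast
  have "H1_norm d \<Omega> (\<lambda>x. c * f x - h x) = H1_norm d \<Omega> (\<lambda>x. c * (f x - f' x))"
    by (rule H1_norm_cong) (use h(2) in \<open>simp add: algebra_simps\<close>)
  also have "\<dots> = cmod c * H1_norm d \<Omega> (\<lambda>x. f x - f' x)"
    using fH f'(1) S by (intro H1_norm_cmult H1_diff) auto
  finally have "(H1_norm d \<Omega> (\<lambda>x. c * f x - h x))\<^sup>2 = (cmod c)\<^sup>2 * (H1_norm d \<Omega> (\<lambda>x. f x - f' x))\<^sup>2"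
    by (simp add: power_mult_distrib)
  also have "\<dots> \<le> K * (H1_norm d \<Omega> (\<lambda>x. f x - f' x))\<^sup>2"
    using K(2) by (intro mult_right_mono) auto
  also have "\<dots> < \<epsilon>" using f'(2) K(1) by (simp add: field_simps)
  finally show "\<exists>h\<in>S. (H1_norm d \<Omega> (\<lambda>x. c * f x - h x))\<^sup>2 < \<epsilon>" using h(1) by blast
qed

end

section \<open>Norms and gradients of tensors, and the inclusion of the tensor product in V\<close>

section \<open>Elementary tensors\<close>

lemma openin_prod_set:
  assumes "\<And>j. j < n \<Longrightarrow> openin (Rtop (d j)) (S j)"
  shows "openin (Rtop (offset d n)) (prod_set n d S)"
proof -
  have "openin (Rtop (offset d n)) ((\<Inter>j\<in>{..<n}. {x \<in> topspace (Rtop (offset d n)). block d j x \<in> S j})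
      \<inter> topspace (Rtop (offset d n)))"
  proof (rule openin_INT)
    fix j assume "j \<in> {..<n}"
    then have "j < n" by simp
    then show "openin (Rtop (offset d n)) {x \<in> topspace (Rtop (offset d n)). block d j x \<in> S j}"
      by (intro openin_continuous_map_preimage[OF continuous_map_block[of j n d]] assms)
  qed simp
  moreover have "(\<Inter>j\<in>{..<n}. {x \<in> topspace (Rtop (offset d n)). block d j x \<in> S j})
      \<inter> topspace (Rtop (offset d n)) = prod_set n d S"
    unfolding prod_set_def by blast
  ultimately show ?thesis by (simp only:)
qed

lemma closedin_prod_set:
  assumes "\<And>j. j < n \<Longrightarrow> closedin (Rtop (d j)) (S j)"
  shows "closedin (Rtop (offset d n)) (prod_set n d S)"
proof -
  let ?X = "\<lambda>j. {x \<in> topspace (Rtop (offset d n)). block d j x \<in> S j}"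
  have "closedin (Rtop (offset d n)) (\<Inter>(insert (topspace (Rtop (offset d n))) (?X ` {..<n})))"
  proof (rule closedin_Inter)
    fix X assume "X \<in> insert (topspace (Rtop (offset d n))) (?X ` {..<n})"
    then consider "X = topspace (Rtop (offset d n))" | j where "j < n" "X = ?X j" by blast
    then show "closedin (Rtop (offset d n)) X"
    proof cases
      case 1
      show ?thesis unfolding 1 by (rule closedin_topspace)
    next
      case 2
      show ?thesis unfolding 2(2)
        by (rule closedin_continuous_map_preimage[OF continuous_map_block[OF 2(1), of d] assms[OF 2(1)]])
    qed
  qed simp
  moreover have "\<Inter>(insert (topspace (Rtop (offset d n))) (?X ` {..<n})) = prod_set n d S"
    unfolding prod_set_def by blast
  ultimately show ?thesis by (simp only:)
qed

lemma compactin_prod_set: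
  assumes "\<And>j. j < n \<Longrightarrow> compactin (Rtop (d j)) (K j)"
  shows "compactin (Rtop (offset d n)) (prod_set n d K)"
proof -
  have "\<exists>R. K j \<subseteq> cube (d j) (\<lambda>_. 0) R" if "j < n" for j
    using compactin_Rtop_bounded[OF assms[OF that]] by blast
  then obtain R where R: "\<And>j. j < n \<Longrightarrow> K j \<subseteq> cube (d j) (\<lambda>_. 0) (R j)" by metis
  define M where "M = Max (insert 0 (R ` {..<n}))"
  have M: "R j \<le> M" if "j < n" for j using that by (auto simp: M_def)
  have "prod_set n d K \<subseteq> cube (offset d n) (\<lambda>_. 0) M"
  proof
    fix x assume x: "x \<in> prod_set n d K"
    have "\<bar>x k\<bar> \<le> M" if "k < offset d n" for k
    proof -
      obtain j i where ji: "j < n" "i < d j" "k = offset d j + i" using offset_cases[OF \<open>k < offset d n\<close>] .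
      have "block d j x \<in> K j" using x ji(1) by (simp add: prod_set_def)
      then have "block d j x \<in> cube (d j) (\<lambda>_. 0) (R j)" using R[OF ji(1)] by blast
      then have "\<bar>block d j x i\<bar> \<le> R j" using ji(2) by (simp add: cube_iff)
      then show ?thesis using M[OF ji(1)] ji by (simp add: block_apply)
    qed
    then show "x \<in> cube (offset d n) (\<lambda>_. 0) M" using x by (simp add: cube_iff prod_set_def)
  qed
  moreover have "closedin (Rtop (offset d n)) (prod_set n d K)"
    by (intro closedin_prod_set compactin_imp_closedin[OF Hausdorff_Rtop] assms)
  ultimately show ?thesis by (rule closed_compactin[OF compactin_cube])
qed

lemma prod_indicator:
  "x \<in> topspace (Rtop (offset d n)) \<Longrightarrow>
    (\<Prod>j<n. indicator (S j) (block d j x)) = (indicator (prod_set n d S) x :: ennreal)"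
proof (cases "\<forall>j<n. block d j x \<in> S j")
  case False
  then obtain j where "j < n" "block d j x \<notin> S j" by blast
  then have "(\<Prod>j<n. indicator (S j) (block d j x)) = (0 :: ennreal)" by (intro prod_zero bexI[of _ j]) auto
  moreover have "x \<notin> prod_set n d S" using False by (auto simp: prod_set_def)
  ultimately show ?thesis by simp
qed (auto simp: prod_set_def)

lemma L2_nn_integral:
  assumes "f \<in> L2 d \<Omega>"
  shows "(\<integral>\<^sup>+x. ennreal ((cmod (f x))\<^sup>2) \<partial>dom_meas d \<Omega>) = ennreal ((L2_norm d \<Omega> f)\<^sup>2)"
  unfolding L2_normsq by (rule nn_integral_eq_integral[OF L2D(2)[OF assms]]) simp

text \<open>The squared modulus of a tensor, times the indicator of the product domain, is a product
  of functions of the single blocks; Tonelli's theorem then gives finiteness and the value at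
  once.\<close>

lemma elem_tensor_L2:
  assumes \<Omega>: "\<And>j. j < n \<Longrightarrow> openin (Rtop (d j)) (\<Omega> j)" and f: "\<And>j. j < n \<Longrightarrow> f j \<in> L2 (d j) (\<Omega> j)"
  shows "elem_tensor n d f \<in> L2 (offset d n) (prod_set n d \<Omega>)"
    and "(L2_norm (offset d n) (prod_set n d \<Omega>) (elem_tensor n d f))\<^sup>2 = (\<Prod>j<n. (L2_norm (d j) (\<Omega> j) (f j))\<^sup>2)"
proof -
  let ?D = "offset d n" and ?O = "prod_set n d \<Omega>"
  let ?F = "elem_tensor n d f"
  have O: "openin (Rtop ?D) ?O" by (rule openin_prod_set[OF \<Omega>])
  have "(\<lambda>x. f j (block d j x)) \<in> borel_measurable (dom_meas ?D ?O)" if "j < n" for j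
  proof (rule measurable_compose[OF _ L2D(1)[OF f[OF that]]])
    show "block d j \<in> measurable (dom_meas ?D ?O) (dom_meas (d j) (\<Omega> j))"
      by (rule measurable_restrict_space3[OF measurable_block[OF that]]) (use that in \<open>auto simp: prod_set_def\<close>)
  qed
  then have meas: "?F \<in> borel_measurable (dom_meas ?D ?O)"
    unfolding elem_tensor_def[abs_def] by (intro borel_measurable_prod) auto
  let ?g = "\<lambda>j x. ennreal ((cmod (f j x))\<^sup>2) * indicator (\<Omega> j) x"
  have g: "?g j \<in> borel_measurable (Rmeas (d j))" if "j < n" for j
    using L2D(1)[OF f[OF that]]
    by (subst borel_measurable_restrict_space_iff_ennreal[OF open_in_Rmeas[OF \<Omega>[OF that]], symmetric]) simp
  have "(\<integral>\<^sup>+x. ennreal ((cmod (?F x))\<^sup>2) \<partial>dom_meas ?D ?O) =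
      (\<integral>\<^sup>+x. ennreal ((cmod (?F x))\<^sup>2) * indicator ?O x \<partial>Rmeas ?D)"
    by (rule nn_integral_restrict_space[OF open_in_Rmeas[OF O]])
  also have "\<dots> = (\<integral>\<^sup>+x. (\<Prod>j<n. ?g j (block d j x)) \<partial>Rmeas ?D)"
  proof (rule nn_integral_cong)
    fix x assume "x \<in> space (Rmeas ?D)"
    then have x: "x \<in> topspace (Rtop ?D)" by simp
    have "ennreal ((cmod (?F x))\<^sup>2) = (\<Prod>j<n. ennreal ((cmod (f j (block d j x)))\<^sup>2))"
      by (simp add: elem_tensor_def prod_norm[symmetric] prod_power_distrib prod_ennreal)
    then show "ennreal ((cmod (?F x))\<^sup>2) * indicator ?O x = (\<Prod>j<n. ?g j (block d j x))"
      by (simp only: prod.distrib prod_indicator[OF x])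
  qed
  also have "\<dots> = (\<Prod>j<n. \<integral>\<^sup>+x. ?g j x \<partial>Rmeas (d j))" by (rule nn_integral_block_prod[OF g])
  also have "\<dots> = (\<Prod>j<n. ennreal ((L2_norm (d j) (\<Omega> j) (f j))\<^sup>2))"
  proof (rule prod.cong[OF refl])
    fix j assume "j \<in> {..<n}"
    then have j: "j < n" by simp
    show "(\<integral>\<^sup>+x. ?g j x \<partial>Rmeas (d j)) = ennreal ((L2_norm (d j) (\<Omega> j) (f j))\<^sup>2)"
      unfolding L2_nn_integral[OF f[OF j], symmetric] nn_integral_restrict_space[OF open_in_Rmeas[OF \<Omega>[OF j]]] ..
  qed
  also have "\<dots> = ennreal (\<Prod>j<n. (L2_norm (d j) (\<Omega> j) (f j))\<^sup>2)" by (rule prod_ennreal) simp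
  finally have nn: "(\<integral>\<^sup>+x. ennreal ((cmod (?F x))\<^sup>2) \<partial>dom_meas ?D ?O) =
      ennreal (\<Prod>j<n. (L2_norm (d j) (\<Omega> j) (f j))\<^sup>2)" .
  have "integrable (dom_meas ?D ?O) (\<lambda>x. (cmod (?F x))\<^sup>2)"
    using meas by (intro integrableI_nonneg) (auto simp: nn)
  then show L2: "?F \<in> L2 ?D ?O" using meas by (simp add: L2_def)
  show "(L2_norm ?D ?O ?F)\<^sup>2 = (\<Prod>j<n. (L2_norm (d j) (\<Omega> j) (f j))\<^sup>2)"
    using L2_nn_integral[OF L2] nn by (simp add: prod_nonneg)
qed

lemma elem_tensor_cong: "(\<And>j. j < n \<Longrightarrow> f j = g j) \<Longrightarrow> elem_tensor n d f = elem_tensor n d g"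
  unfolding elem_tensor_def[abs_def] by (intro ext prod.cong) auto

lemma elem_tensor_diff:
  assumes "m < n"
  shows "elem_tensor n d (h(m := a)) x - elem_tensor n d (h(m := b)) x =
    elem_tensor n d (h(m := (\<lambda>y. a y - b y))) x"
proof -
  have "(\<Prod>l\<in>{..<n} - {m}. (h(m := c)) l (block d l x)) = (\<Prod>l\<in>{..<n} - {m}. h l (block d l x))" for c
    by (rule prod.cong) auto
  then show ?thesis
    by (simp only: elem_tensor_upd[OF assms] fun_upd_same left_diff_distrib)
qed

text \<open>Isolates the slot that is being changed; the product over the other slots is a constant
  in the replacement argument.\<close>

lemma elem_tensor_upd_normsq:
  assumes \<Omega>: "\<And>j. j < n \<Longrightarrow> openin (Rtop (d j)) (\<Omega> j)" and m: "m < n"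
    and h: "\<And>j. j < n \<Longrightarrow> j \<noteq> m \<Longrightarrow> h j \<in> L2 (d j) (\<Omega> j)" and a: "a \<in> L2 (d m) (\<Omega> m)"
  shows "(L2_norm (offset d n) (prod_set n d \<Omega>) (elem_tensor n d (h(m := a))))\<^sup>2 =
    (L2_norm (d m) (\<Omega> m) a)\<^sup>2 * (\<Prod>l\<in>{..<n} - {m}. (L2_norm (d l) (\<Omega> l) (h l))\<^sup>2)"
proof -
  let ?N = "\<lambda>l. (L2_norm (d l) (\<Omega> l) ((h(m := a)) l))\<^sup>2"
  have "(L2_norm (offset d n) (prod_set n d \<Omega>) (elem_tensor n d (h(m := a))))\<^sup>2 = (\<Prod>l<n. ?N l)"
    by (rule elem_tensor_L2(2)[OF \<Omega>]) (use h a in auto)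
  also have "\<dots> = ?N m * (\<Prod>l\<in>{..<n} - {m}. ?N l)"
    using m by (intro prod.remove) auto
  also have "(\<Prod>l\<in>{..<n} - {m}. ?N l) = (\<Prod>l\<in>{..<n} - {m}. (L2_norm (d l) (\<Omega> l) (h l))\<^sup>2)"
    by (rule prod.cong) auto
  finally show ?thesis by (simp only: fun_upd_same)
qed

lemma smooth_elem_tensor:
  assumes "\<And>j. j < n \<Longrightarrow> smooth (d j) (u j)"
  shows "smooth (offset d n) (elem_tensor n d u)"
  unfolding smooth_def elem_tensor_def[abs_def]
  using assms by (intro allI C_k_prod C_k_block) (auto simp: smooth_def)

lemma elem_tensor_test_function:
  assumes "\<And>j. j < n \<Longrightarrow> u j \<in> test_functions (d j) (U j)"
  shows "elem_tensor n d u \<in> test_functions (offset d n) (prod_set n d U)"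
proof (rule test_functionsI)
  show "smooth (offset d n) (elem_tensor n d u)"
    by (rule smooth_elem_tensor[OF test_functionsD(1)[OF assms]])
  show "compactin (Rtop (offset d n)) (prod_set n d (\<lambda>j. supp (d j) (u j)))"
    by (rule compactin_prod_set[OF test_functionsD(2)[OF assms]])
  show "closedin (Rtop (offset d n)) (prod_set n d (\<lambda>j. supp (d j) (u j)))"
    by (rule closedin_prod_set[OF closedin_supp])
  show "prod_set n d (\<lambda>j. supp (d j) (u j)) \<subseteq> prod_set n d U"
    using test_functionsD(3)[OF assms] unfolding prod_set_def by blast
next
  fix x assume "x \<in> topspace (Rtop (offset d n))" "x \<notin> prod_set n d (\<lambda>j. supp (d j) (u j))"
  then obtain j where j: "j < n" "block d j x \<notin> supp (d j) (u j)" unfolding prod_set_def by blast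
  then have "u j (block d j x) = 0" by (intro not_in_supp) (simp_all add: block_in)
  then show "elem_tensor n d u x = 0" using j(1) by (auto simp: elem_tensor_def)
qed

text \<open>The product rule for tensors: the coordinate \<open>k\<close> belongs to exactly one
  block, whose factor is replaced by its derivative in the corresponding local coordinate.\<close>

definition tensor_grad ::
  "nat \<Rightarrow> (nat \<Rightarrow> nat) \<Rightarrow> (nat \<Rightarrow> (nat \<Rightarrow> real) \<Rightarrow> complex) \<Rightarrow> (nat \<Rightarrow> nat \<Rightarrow> (nat \<Rightarrow> real) \<Rightarrow> complex)
    \<Rightarrow> nat \<Rightarrow> (nat \<Rightarrow> real) \<Rightarrow> complex" where
  "tensor_grad n d f G k = elem_tensor n d (f(block_index d k := G (block_index d k) (k - offset d (block_index d k))))"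

lemma tensor_grad_offset:
  "i < d j \<Longrightarrow> tensor_grad n d f G (offset d j + i) = elem_tensor n d (f(j := G j i))"
  by (simp add: tensor_grad_def block_index_offset)

abbreviation restricted_test_functions ::
  "nat \<Rightarrow> (nat \<Rightarrow> real) set \<Rightarrow> (nat \<Rightarrow> real) set \<Rightarrow> ((nat \<Rightarrow> real) \<Rightarrow> complex) set" where
  "restricted_test_functions d \<Omega> U \<equiv> (\<lambda>u. restrict u \<Omega>) ` test_functions d U"

lemma restrict_test_function_H1:
  assumes "openin (Rtop d) \<Omega>" "u \<in> test_functions d U"
  shows "restrict u \<Omega> \<in> H1 d \<Omega>"
proof -
  have "weak_grad d \<Omega> u (\<lambda>i. partial_deriv i u)"
    by (rule weak_grad_C1[OF assms(1) smoothD[OF test_functionsD(1)[OF assms(2)]] test_functionsD(2)[OF assms(2)]])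
  from weak_grad_H1[OF this] show ?thesis by (rule H1_cong[OF assms(1)]) simp
qed

lemma H1_vanishing_memI:
  assumes "openin (Rtop d) \<Omega>" "u \<in> test_functions d (topspace (Rtop d) - \<Gamma>)" "\<And>x. x \<in> \<Omega> \<Longrightarrow> f x = u x"
  shows "f \<in> H1_vanishing d \<Omega> \<Gamma>"
proof -
  have "restrict u \<Omega> \<in> H1_vanishing d \<Omega> \<Gamma>"
    unfolding H1_vanishing_def
    by (rule subsetD[OF H1_closure_subset[OF assms(1)]])
      (use assms(2) restrict_test_function_H1[OF assms(1)] in blast)+
  then show ?thesis
    unfolding H1_vanishing_def by (rule H1_closure_cong[OF assms(1)]) (simp add: assms(3))
qed

lemma H1_vanishing_cmult:
  assumes "openin (Rtop d) \<Omega>" "f \<in> H1_vanishing d \<Omega> \<Gamma>"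
  shows "(\<lambda>x. c * f x) \<in> H1_vanishing d \<Omega> \<Gamma>"
  using assms(2) unfolding H1_vanishing_def
proof (rule H1_closure_cmult[OF assms(1), rotated -1])
  show "restricted_test_functions d \<Omega> (topspace (Rtop d) - \<Gamma>) \<subseteq> H1 d \<Omega>"
    using restrict_test_function_H1[OF assms(1)] by blast
  fix g c assume "g \<in> restricted_test_functions d \<Omega> (topspace (Rtop d) - \<Gamma>)"
  then obtain u where u: "u \<in> test_functions d (topspace (Rtop d) - \<Gamma>)" "g = restrict u \<Omega>" by blast
  from imageI[OF test_functions_cmult[OF u(1)], of "\<lambda>u. restrict u \<Omega>" c]
  show "\<exists>h\<in>restricted_test_functions d \<Omega> (topspace (Rtop d) - \<Gamma>). \<forall>x\<in>\<Omega>. h x = c * g x"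
    by (rule bexI[rotated]) (simp add: u(2))
qed

lemma H1_vanishing_add:
  assumes "openin (Rtop d) \<Omega>" "f \<in> H1_vanishing d \<Omega> \<Gamma>" "g \<in> H1_vanishing d \<Omega> \<Gamma>"
  shows "(\<lambda>x. f x + g x) \<in> H1_vanishing d \<Omega> \<Gamma>"
  using assms(2,3) unfolding H1_vanishing_def
proof (rule H1_closure_add[OF assms(1), rotated 2])
  show "restricted_test_functions d \<Omega> (topspace (Rtop d) - \<Gamma>) \<subseteq> H1 d \<Omega>"
    using restrict_test_function_H1[OF assms(1)] by blast
  fix g h assume "g \<in> restricted_test_functions d \<Omega> (topspace (Rtop d) - \<Gamma>)"
    "h \<in> restricted_test_functions d \<Omega> (topspace (Rtop d) - \<Gamma>)"
  then obtain u v where u: "u \<in> test_functions d (topspace (Rtop d) - \<Gamma>)" "g = restrict u \<Omega>"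
    and v: "v \<in> test_functions d (topspace (Rtop d) - \<Gamma>)" "h = restrict v \<Omega>" by blast
  from imageI[OF test_functions_add[OF u(1) v(1)], of "\<lambda>u. restrict u \<Omega>"]
  show "\<exists>k\<in>restricted_test_functions d \<Omega> (topspace (Rtop d) - \<Gamma>). \<forall>x\<in>\<Omega>. k x = g x + h x"
    by (rule bexI[rotated]) (simp add: u(2) v(2))
qed

lemma H1_vanishing_H1: "f \<in> H1_vanishing d \<Omega> \<Gamma> \<Longrightarrow> f \<in> H1 d \<Omega>"
  by (simp add: H1_vanishing_def H1_closure_def)

text \<open>Splits the H^1 error into one bound for the function and one for each derivative, since
  these enter different components of the gradient of a tensor.\<close>

lemma H1_vanishing_approx:
  assumes \<Omega>: "openin (Rtop d) \<Omega>" and f: "f \<in> H1_vanishing d \<Omega> \<Gamma>" and "\<epsilon> > 0" and F: "weak_grad d \<Omega> f F"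
  obtains u where "u \<in> test_functions d (topspace (Rtop d) - \<Gamma>)"
    "(L2_norm d \<Omega> (\<lambda>x. f x - u x))\<^sup>2 \<le> \<epsilon>"
    "\<And>i. i < d \<Longrightarrow> (L2_norm d \<Omega> (\<lambda>x. F i x - partial_deriv i u x))\<^sup>2 \<le> \<epsilon>"
proof -
  obtain g where g: "g \<in> restricted_test_functions d \<Omega> (topspace (Rtop d) - \<Gamma>)"
    "(H1_norm d \<Omega> (\<lambda>x. f x - g x))\<^sup>2 < \<epsilon>"
    using H1_closureD(2)[OF \<Omega> f[unfolded H1_vanishing_def] \<open>\<epsilon> > 0\<close>] by blast
  then obtain u where u: "u \<in> test_functions d (topspace (Rtop d) - \<Gamma>)" "g = restrict u \<Omega>" by blast
  have "H1_norm d \<Omega> (\<lambda>x. f x - g x) = H1_norm d \<Omega> (\<lambda>x. f x - u x)"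
    by (rule H1_norm_cong[OF \<Omega>]) (simp add: u(2))
  moreover have grad: "weak_grad d \<Omega> u (\<lambda>i. partial_deriv i u)"
    by (rule weak_grad_C1[OF \<Omega> smoothD[OF test_functionsD(1)[OF u(1)]] test_functionsD(2)[OF u(1)]])
  ultimately have le: "(L2_norm d \<Omega> (\<lambda>x. f x - u x))\<^sup>2 +
      (\<Sum>i<d. (L2_norm d \<Omega> (\<lambda>x. F i x - partial_deriv i u x))\<^sup>2) < \<epsilon>"
    using g(2) H1_normsq[OF \<Omega> weak_grad_diff[OF \<Omega> F grad]] by simp
  have "(L2_norm d \<Omega> (\<lambda>x. F i x - partial_deriv i u x))\<^sup>2 \<le>
      (\<Sum>i<d. (L2_norm d \<Omega> (\<lambda>x. F i x - partial_deriv i u x))\<^sup>2)" if "i < d" for i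
    by (rule member_le_sum) (use that in auto)
  moreover have "0 \<le> (\<Sum>i<d. (L2_norm d \<Omega> (\<lambda>x. F i x - partial_deriv i u x))\<^sup>2)" by (simp add: sum_nonneg)
  ultimately show ?thesis
    using le by (intro that[OF u(1)]) (smt (verit) zero_le_power2)+
qed

lemma prod_Gamma_disjoint:
  assumes "x \<in> prod_set n d (\<lambda>j. topspace (Rtop (d j)) - \<Gamma> j)"
  shows "x \<in> topspace (Rtop (offset d n)) - prod_Gamma n d \<Omega> \<Gamma>"
proof -
  have "block d j x \<notin> \<Gamma> j" if "j < n" for j using assms that unfolding prod_set_def by blast
  moreover have "\<exists>j<n. block d j x \<in> \<Gamma> j" if x: "x \<in> prod_Gamma n d \<Omega> \<Gamma>"
  proof -
    obtain j where "j < n" "x \<in> prod_set n d (\<lambda>l. if l = j then \<Gamma> l else Rtop (d l) closure_of \<Omega> l)"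
      using x unfolding prod_Gamma_def by blast
    then have "block d j x \<in> \<Gamma> j" unfolding prod_set_def by force
    then show ?thesis using \<open>j < n\<close> by blast
  qed
  moreover have "x \<in> topspace (Rtop (offset d n))" using assms unfolding prod_set_def by blast
  ultimately show ?thesis by blast
qed

text \<open>The general factors are replaced by test functions one at a time; \<open>m\<close> counts the factors
  that are still general.\<close>

lemma elem_tensor_H1_vanishing:
  assumes \<Omega>: "\<And>j. j < n \<Longrightarrow> openin (Rtop (d j)) (\<Omega> j)"
    and "m \<le> n"
    and "\<And>j. j < m \<Longrightarrow> f j \<in> H1_vanishing (d j) (\<Omega> j) (\<Gamma> j) \<and> weak_grad (d j) (\<Omega> j) (f j) (G j)"
    and "\<And>j. m \<le> j \<Longrightarrow> j < n \<Longrightarrow> f j \<in> test_functions (d j) (topspace (Rtop (d j)) - \<Gamma> j) \<and>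
      G j = (\<lambda>i. partial_deriv i (f j))"
  shows "elem_tensor n d f \<in> H1_vanishing (offset d n) (prod_set n d \<Omega>) (prod_Gamma n d \<Omega> \<Gamma>) \<and>
    weak_grad (offset d n) (prod_set n d \<Omega>) (elem_tensor n d f) (tensor_grad n d f G)"
  using assms(2-4)
proof (induction m arbitrary: f G)
  case 0
  let ?D = "offset d n" and ?O = "prod_set n d \<Omega>" and ?F = "elem_tensor n d f"
  have O: "openin (Rtop ?D) ?O" by (rule openin_prod_set[OF \<Omega>])
  have f: "f j \<in> test_functions (d j) (topspace (Rtop (d j)) - \<Gamma> j)" "G j = (\<lambda>i. partial_deriv i (f j))"
    if "j < n" for j using 0(3)[OF _ that] by auto
  have "?F \<in> test_functions ?D (prod_set n d (\<lambda>j. topspace (Rtop (d j)) - \<Gamma> j))"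
    by (rule elem_tensor_test_function[OF f(1)])
  then have test: "?F \<in> test_functions ?D (topspace (Rtop ?D) - prod_Gamma n d \<Omega> \<Gamma>)"
    using test_functions_mono[OF subsetI[OF prod_Gamma_disjoint]] by blast
  then have mem: "?F \<in> H1_vanishing ?D ?O (prod_Gamma n d \<Omega> \<Gamma>)"
    by (rule H1_vanishing_memI[OF O]) simp
  have grad: "weak_grad ?D ?O ?F (\<lambda>k. partial_deriv k ?F)"
    by (rule weak_grad_C1[OF O smoothD[OF test_functionsD(1)[OF test]] test_functionsD(2)[OF test]])
  have "partial_deriv k ?F = tensor_grad n d f G k" if kD: "k < ?D" for k
  proof -
    obtain j i where ji: "j < n" "i < d j" "k = offset d j + i" using offset_cases[OF kD] .
    have "C_k (d j) (Suc 0) (f j)" by (rule smoothD[OF test_functionsD(1)[OF f(1)[OF ji(1)]]])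
    then show ?thesis
      unfolding ji(3) tensor_grad_offset[of i d j, OF ji(2)] f(2)[OF ji(1)]
      by (intro ext partial_deriv_elem_tensor ji(1,2))
  qed
  then have "weak_grad ?D ?O ?F (tensor_grad n d f G)" using grad by (simp add: weak_grad_def)
  with mem show ?case by blast
next
  case (Suc m)
  let ?D = "offset d n" and ?O = "prod_set n d \<Omega>" and ?\<Gamma> = "prod_Gamma n d \<Omega> \<Gamma>"
  let ?F = "elem_tensor n d f" and ?N = "\<lambda>f. (L2_norm (offset d n) (prod_set n d \<Omega>) f)\<^sup>2"
  have O: "openin (Rtop ?D) ?O" by (rule openin_prod_set[OF \<Omega>])
  have m: "m < n" using Suc.prems(1) by simp
  have grad: "weak_grad (d j) (\<Omega> j) (f j) (G j)" if "j < n" for j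
  proof (cases "j < Suc m")
    case True
    then show ?thesis using Suc.prems(2) by blast
  next
    case False
    then have t: "f j \<in> test_functions (d j) (topspace (Rtop (d j)) - \<Gamma> j)" "G j = (\<lambda>i. partial_deriv i (f j))"
      using Suc.prems(3)[of j] that by auto
    show ?thesis unfolding t(2)
      by (rule weak_grad_C1[OF \<Omega>[OF that] smoothD[OF test_functionsD(1)[OF t(1)]] test_functionsD(2)[OF t(1)]])
  qed
  note fL2 = weak_gradD(1)[OF grad] and GL2 = weak_gradD(2)[OF grad]
  \<comment> \<open>The factors of the \<open>k\<close>-th partial derivative of the tensor.\<close>
  define h where "h k = f(block_index d k := G (block_index d k) (k - offset d (block_index d k)))" for k
  have h: "h k l \<in> L2 (d l) (\<Omega> l)" if kl: "k < ?D" "l < n" for k l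
  proof -
    obtain j i where ji: "j < n" "i < d j" "k = offset d j + i" using offset_cases[OF kl(1)] .
    then show ?thesis using fL2 GL2 kl(2) by (simp add: h_def block_index_offset)
  qed
  define P where "P h = (\<Prod>l\<in>{..<n} - {m}. (L2_norm (d l) (\<Omega> l) (h l))\<^sup>2)" for h
  have P: "0 \<le> P h" for h by (simp add: P_def prod_nonneg)
  \<comment> \<open>One bound for the remaining factors, valid for the tensor and for all its
    partial derivatives; the 1 makes it positive, so that \<epsilon> / M is a legitimate
    accuracy.\<close>
  define M where "M = P f + (\<Sum>k<?D. P (h k)) + 1"
  have M: "M > 0" "P f \<le> M" "k < ?D \<Longrightarrow> P (h k) \<le> M" for k
  proof -
    have s: "0 \<le> (\<Sum>k<?D. P (h k))" by (simp add: sum_nonneg P)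
    then show "M > 0" "P f \<le> M" using P[of f] by (auto simp: M_def)
    assume "k < ?D"
    then have "P (h k) \<le> (\<Sum>k<?D. P (h k))" by (intro member_le_sum) (auto simp: P)
    then show "P (h k) \<le> M" using P[of f] by (simp add: M_def)
  qed
  have approx: "\<exists>f' G'. elem_tensor n d f' \<in> H1_vanishing ?D ?O ?\<Gamma> \<and>
      weak_grad ?D ?O (elem_tensor n d f') (tensor_grad n d f' G') \<and>
      ?N (\<lambda>x. ?F x - elem_tensor n d f' x) \<le> \<epsilon> \<and>
      (\<forall>k<?D. ?N (\<lambda>x. tensor_grad n d f G k x - tensor_grad n d f' G' k x) \<le> \<epsilon>)" if "\<epsilon> > 0" for \<epsilon>
  proof -
    have fm: "f m \<in> H1_vanishing (d m) (\<Omega> m) (\<Gamma> m)" using Suc.prems(2)[of m] by simp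
    have "\<epsilon> / M > 0" using \<open>\<epsilon> > 0\<close> M(1) by simp
    then obtain u where u: "u \<in> test_functions (d m) (topspace (Rtop (d m)) - \<Gamma> m)"
      "(L2_norm (d m) (\<Omega> m) (\<lambda>x. f m x - u x))\<^sup>2 \<le> \<epsilon> / M"
      "\<And>i. i < d m \<Longrightarrow> (L2_norm (d m) (\<Omega> m) (\<lambda>x. G m i x - partial_deriv i u x))\<^sup>2 \<le> \<epsilon> / M"
      using H1_vanishing_approx[OF \<Omega>[OF m] fm _ grad[OF m], of "\<epsilon> / M"] by blast
    define f' where "f' = f(m := u)"
    define G' where "G' = G(m := (\<lambda>i. partial_deriv i u))"
    \<comment> \<open>With slot \<open>m\<close> filled by a test function one general factor fewer
      is left. The gradient is part of the induction, as the distance between the tensors is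
      measured through it.\<close>
    have IH: "elem_tensor n d f' \<in> H1_vanishing ?D ?O ?\<Gamma> \<and>
      weak_grad ?D ?O (elem_tensor n d f') (tensor_grad n d f' G')"
    proof (rule Suc.IH)
      show "m \<le> n" using m by simp
      fix j
      show "f' j \<in> H1_vanishing (d j) (\<Omega> j) (\<Gamma> j) \<and> weak_grad (d j) (\<Omega> j) (f' j) (G' j)" if "j < m"
        using Suc.prems(2)[of j] that by (simp add: f'_def G'_def)
      show "f' j \<in> test_functions (d j) (topspace (Rtop (d j)) - \<Gamma> j) \<and> G' j = (\<lambda>i. partial_deriv i (f' j))"
        if "m \<le> j" "j < n"
        using Suc.prems(3)[of j] u(1) that by (cases "j = m") (simp_all add: f'_def G'_def)
    qed
    have uL2: "u \<in> L2 (d m) (\<Omega> m)" by (rule L2_test_function[OF \<Omega>[OF m] u(1)])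
    have bound: "?N (\<lambda>x. elem_tensor n d (g(m := a)) x - elem_tensor n d (g(m := b)) x) \<le> \<epsilon>"
      if g: "\<And>l. l < n \<Longrightarrow> l \<noteq> m \<Longrightarrow> g l \<in> L2 (d l) (\<Omega> l)" and a: "a \<in> L2 (d m) (\<Omega> m)" and b: "b \<in> L2 (d m) (\<Omega> m)"
        and le: "(L2_norm (d m) (\<Omega> m) (\<lambda>x. a x - b x))\<^sup>2 \<le> \<epsilon> / M" and PM: "P g \<le> M" for g a b
    proof -
      have "?N (\<lambda>x. elem_tensor n d (g(m := a)) x - elem_tensor n d (g(m := b)) x) =
          (L2_norm (d m) (\<Omega> m) (\<lambda>x. a x - b x))\<^sup>2 * P g"
        unfolding elem_tensor_diff[OF m] P_def by (rule elem_tensor_upd_normsq[where d = d and \<Omega> = \<Omega>, OF \<Omega> m g L2_diff[OF a b]])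
      also have "\<dots> \<le> \<epsilon> / M * M" by (rule mult_mono[OF le PM]) (use P \<open>\<epsilon> / M > 0\<close> in auto)
      also have "\<dots> = \<epsilon>" using M(1) by simp
      finally show ?thesis .
    qed
    have 1: "?N (\<lambda>x. ?F x - elem_tensor n d f' x) \<le> \<epsilon>"
      using bound[of f "f m" u] fL2 uL2 u(2) M(2) m by (simp add: f'_def)
    have 2: "?N (\<lambda>x. tensor_grad n d f G k x - tensor_grad n d f' G' k x) \<le> \<epsilon>" if k: "k < ?D" for k
    proof -
      obtain j i where ji: "j < n" "i < d j" "k = offset d j + i" using offset_cases[OF k] .
      have hk: "h k = f(j := G j i)" using ji by (simp add: h_def block_index_offset)
      show ?thesis
      proof (cases "j = m")
        case True
        have pdL2: "partial_deriv i u \<in> L2 (d m) (\<Omega> m)"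
          using ji(2) True by (intro L2_test_function[OF \<Omega>[OF m] test_functions_partial_deriv[OF u(1)]]) simp
        \<comment> \<open>The derivative falls on the replaced factor, so the error is that of its
          \<open>i\<close>-th derivative.\<close>
        have "tensor_grad n d f G k = elem_tensor n d ((h k)(m := G m i))"
          "tensor_grad n d f' G' k = elem_tensor n d ((h k)(m := partial_deriv i u))"
          using ji True hk by (simp_all add: tensor_grad_offset f'_def G'_def)
        then show ?thesis
          using bound[of "h k" "G m i" "partial_deriv i u"] h[OF k] GL2[OF m] pdL2 u(3)[of i] M(3)[OF k] ji(2) True
          by simp
      next
        case False
        \<comment> \<open>The derivative falls on another factor; the updates at \<open>j\<close>
          and \<open>m\<close> commute, and slot \<open>m\<close> contributes the plain error of
          \<open>u\<close> against \<open>f m\<close>.\<close>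
        have "tensor_grad n d f G k = elem_tensor n d ((h k)(m := f m))"
          "tensor_grad n d f' G' k = elem_tensor n d ((h k)(m := u))"
          using ji False hk by (simp_all add: tensor_grad_offset f'_def G'_def fun_upd_twist[of m j])
            (auto intro!: elem_tensor_cong)
        then show ?thesis
          using bound[of "h k" "f m" u] h[OF k] fL2[OF m] uL2 u(2) M(3)[OF k] by simp
      qed
    qed
    show ?thesis using IH 1 2 by blast
  qed
  have FL2: "?F \<in> L2 ?D ?O" by (rule elem_tensor_L2(1)[where d = d and \<Omega> = \<Omega>, OF \<Omega> fL2])
  have GradL2: "tensor_grad n d f G k \<in> L2 ?D ?O" if "k < ?D" for k
    unfolding tensor_grad_def h_def[symmetric]
    by (rule elem_tensor_L2(1)[where d = d and \<Omega> = \<Omega>, OF \<Omega> h[OF that]])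
  have wg: "weak_grad ?D ?O ?F (tensor_grad n d f G)"
    by (rule weak_grad_limit[OF O FL2 GradL2]) (use approx in blast)+
  moreover have "?F \<in> H1_vanishing ?D ?O ?\<Gamma>"
    unfolding H1_vanishing_def
  proof (rule H1_closure_closed[OF O _ weak_grad_H1[OF wg]])
    show "restricted_test_functions ?D ?O (topspace (Rtop ?D) - ?\<Gamma>) \<subseteq> H1 ?D ?O"
      using restrict_test_function_H1[OF O] by blast
    fix \<epsilon> :: real assume \<epsilon>: "\<epsilon> > 0"
    define r where "r = real ?D"
    \<comment> \<open>One error for the function and one for each of the r partial derivatives
      amount to (r + 1) \<delta> < \<epsilon>.\<close>
    define \<delta> where "\<delta> = \<epsilon> / (r + 2)"
    have "r \<ge> 0" unfolding r_def by (rule of_nat_0_le_iff)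
    then have "\<delta> > 0" "\<epsilon> = \<delta> * (r + 2)" using \<epsilon> by (simp_all add: \<delta>_def)
    then have \<delta>: "\<delta> > 0" "\<delta> + r * \<delta> < \<epsilon>" by (simp_all add: algebra_simps)
    obtain f' G' where A: "elem_tensor n d f' \<in> H1_vanishing ?D ?O ?\<Gamma>"
      "weak_grad ?D ?O (elem_tensor n d f') (tensor_grad n d f' G')"
      "?N (\<lambda>x. ?F x - elem_tensor n d f' x) \<le> \<delta>"
      "\<And>k. k < ?D \<Longrightarrow> ?N (\<lambda>x. tensor_grad n d f G k x - tensor_grad n d f' G' k x) \<le> \<delta>"
      using approx[OF \<delta>(1)] by blast
    have "(H1_norm ?D ?O (\<lambda>x. ?F x - elem_tensor n d f' x))\<^sup>2 =
        ?N (\<lambda>x. ?F x - elem_tensor n d f' x) +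
        (\<Sum>k<?D. ?N (\<lambda>x. tensor_grad n d f G k x - tensor_grad n d f' G' k x))"
      by (rule H1_normsq[OF O weak_grad_diff[OF O wg A(2)]])
    also have "\<dots> \<le> \<delta> + (\<Sum>k<?D. \<delta>)" by (intro add_mono sum_mono A(3,4)) simp
    also have "\<dots> < \<epsilon>" using \<delta>(2) by (simp add: r_def)
    finally show "\<exists>g\<in>H1_closure ?D ?O (restricted_test_functions ?D ?O (topspace (Rtop ?D) - ?\<Gamma>)).
        (H1_norm ?D ?O (\<lambda>x. ?F x - g x))\<^sup>2 < \<epsilon>"
      using A(1) unfolding H1_vanishing_def by blast
  qed
  ultimately show ?case by blast
qed

lemma complex_span_subset:
  assumes "S \<subseteq> W" "(\<lambda>_. 0) \<in> W" "\<And>f g. f \<in> W \<Longrightarrow> g \<in> W \<Longrightarrow> (\<lambda>x. f x + g x) \<in> W"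
    "\<And>f c. f \<in> W \<Longrightarrow> (\<lambda>x. c * f x) \<in> W"
  shows "complex_span S \<subseteq> W"
proof
  fix f assume "f \<in> complex_span S"
  then obtain t c where t: "finite t" "t \<subseteq> S" "f = (\<lambda>x. \<Sum>g\<in>t. c g * g x)"
    unfolding complex_span_def by blast
  have "(\<lambda>x. \<Sum>g\<in>t. c g * g x) \<in> W" using t(1,2)
  proof (induction t rule: finite_induct)
    case empty
    then show ?case using assms(2) by simp
  next
    case (insert g t)
    then have "(\<lambda>x. c g * g x + (\<Sum>g\<in>t. c g * g x)) \<in> W"
      using assms(1) by (intro assms(3,4)) auto
    then show ?case using insert.hyps by simp
  qed
  then show "f \<in> W" using t(3) by simp
qed

text \<open>The statement about the span is kept separately: it shows that the span lies in H^1,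
  which the closure lemmas ask for.\<close>

lemma H1_tensor_subset:
  assumes \<Omega>: "\<And>j. j < n \<Longrightarrow> openin (Rtop (d j)) (\<Omega> j)"
    and H: "\<And>j. j < n \<Longrightarrow> H j = H1_vanishing (d j) (\<Omega> j) (\<Gamma> j)"
  shows "complex_span {elem_tensor n d f | f. \<forall>j<n. f j \<in> H j}
      \<subseteq> H1_vanishing (offset d n) (prod_set n d \<Omega>) (prod_Gamma n d \<Omega> \<Gamma>)"
    and "H1_tensor n d \<Omega> H \<subseteq> H1_vanishing (offset d n) (prod_set n d \<Omega>) (prod_Gamma n d \<Omega> \<Gamma>)"
proof -
  let ?D = "offset d n" and ?O = "prod_set n d \<Omega>" and ?\<Gamma> = "prod_Gamma n d \<Omega> \<Gamma>"
  have O: "openin (Rtop ?D) ?O" by (rule openin_prod_set[OF \<Omega>])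
  have "elem_tensor n d f \<in> H1_vanishing ?D ?O ?\<Gamma>" if f: "\<forall>j<n. f j \<in> H j" for f
  proof -
    have fj: "f j \<in> H1_vanishing (d j) (\<Omega> j) (\<Gamma> j)" if "j < n" for j using f H that by blast
    have "elem_tensor n d f \<in> H1_vanishing ?D ?O ?\<Gamma> \<and>
        weak_grad ?D ?O (elem_tensor n d f) (tensor_grad n d f (\<lambda>j i. weak_deriv (d j) (\<Omega> j) i (f j)))"
      by (rule elem_tensor_H1_vanishing[OF \<Omega> order_refl])
        (use fj weak_grad_weak_deriv[OF H1_vanishing_H1[OF fj]] in auto)
    then show ?thesis ..
  qed
  then have T: "{elem_tensor n d f | f. \<forall>j<n. f j \<in> H j} \<subseteq> H1_vanishing ?D ?O ?\<Gamma>" by blast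
  have "(\<lambda>_. 0) \<in> H1_vanishing ?D ?O ?\<Gamma>"
    by (rule H1_vanishing_memI[OF O test_functions_zero]) simp
  with T show span: "complex_span {elem_tensor n d f | f. \<forall>j<n. f j \<in> H j} \<subseteq> H1_vanishing ?D ?O ?\<Gamma>"
    by (intro complex_span_subset H1_vanishing_add[OF O] H1_vanishing_cmult[OF O])
  then show "H1_tensor n d \<Omega> H \<subseteq> H1_vanishing ?D ?O ?\<Gamma>"
    unfolding H1_tensor_def H1_vanishing_def
    using restrict_test_function_H1[OF O] by (intro H1_closure_mono_closure[OF O]) auto
qed

section \<open>Bernstein polynomials with parameters: uniform and C^1 approximation\<close>

section \<open>Bernstein approximation in one variable\<close>

text \<open>The variance of the binomial distribution, computed from its mean and its second
  factorial moment.\<close>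

lemma Bernstein_variance: "(\<Sum>k\<le>n. (real k - real n * x)\<^sup>2 * Bernstein n k x) = real n * x * (1 - x)"
proof -
  have "(\<Sum>k\<le>n. (real k - real n * x)\<^sup>2 * Bernstein n k x) =
      (\<Sum>k\<le>n. real k * (real k - 1) * Bernstein n k x + (1 - 2 * real n * x) * (real k * Bernstein n k x)
        + (real n * x)\<^sup>2 * Bernstein n k x)"
    by (rule sum.cong) (auto simp: power2_eq_square algebra_simps)
  also have "\<dots> = real n * (real n - 1) * x\<^sup>2 + (1 - 2 * real n * x) * (real n * x) + (real n * x)\<^sup>2"
    by (simp only: sum.distrib sum_distrib_left[symmetric] sum_kk_Bernstein sum_k_Bernstein sum_Bernstein mult_1_right)
  also have "\<dots> = real n * x * (1 - x)" by (simp add: power2_eq_square algebra_simps)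
  finally show ?thesis .
qed

text \<open>Bernstein's probabilistic argument: nodes near x are handled by uniform continuity,
  distant ones by Chebyshev's inequality. The threshold for n involves only M, \<delta> and e, so
  one degree serves a whole family of functions that share these data.\<close>

lemma Bernstein_approx_bound:
  fixes f :: "real \<Rightarrow> complex"
  assumes M: "\<And>x. x \<in> {0..1} \<Longrightarrow> cmod (f x) \<le> M"
    and uc: "\<And>x y. x \<in> {0..1} \<Longrightarrow> y \<in> {0..1} \<Longrightarrow> \<bar>x - y\<bar> < \<delta> \<Longrightarrow> cmod (f x - f y) \<le> e / 2"
    and \<delta>: "\<delta> > 0" and e: "e > 0" and n: "4 * M / (e * \<delta>\<^sup>2) \<le> real n" "n \<ge> 1" and x: "x \<in> {0..1}"
  shows "cmod ((\<Sum>k\<le>n. of_real (Bernstein n k x) * f (real k / real n)) - f x) \<le> e"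
proof -
  have M0: "M \<ge> 0" by (rule order_trans[OF norm_ge_zero M[of 0]]) simp
  have B: "0 \<le> Bernstein n k x" for k using x by (auto intro: Bernstein_nonneg)
  have one: "(\<Sum>k\<le>n. complex_of_real (Bernstein n k x)) = 1"
    by (simp only: of_real_sum[symmetric] sum_Bernstein of_real_1)
  have "(\<Sum>k\<le>n. of_real (Bernstein n k x) * f (real k / real n)) - f x =
      (\<Sum>k\<le>n. of_real (Bernstein n k x) * (f (real k / real n) - f x))"
    using one by (simp add: right_diff_distrib sum_subtractf sum_distrib_right[symmetric])
  also have "cmod \<dots> \<le> (\<Sum>k\<le>n. Bernstein n k x * (e / 2 + 2 * M / (\<delta>\<^sup>2 * (real n)\<^sup>2) * (real k - real n * x)\<^sup>2))"
  proof (rule sum_norm_le)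
    fix k assume "k \<in> {..n}"
    then have kn: "real k / real n \<in> {0..1}" using n(2) by (auto simp: field_simps)
    have nonneg: "0 \<le> 2 * M / (\<delta>\<^sup>2 * (real n)\<^sup>2) * (real k - real n * x)\<^sup>2" using M0 by simp
    have "cmod (f (real k / real n) - f x) \<le> e / 2 + 2 * M / (\<delta>\<^sup>2 * (real n)\<^sup>2) * (real k - real n * x)\<^sup>2"
    proof (cases "\<bar>real k / real n - x\<bar> < \<delta>")
      case True
      then show ?thesis using uc[OF kn x] nonneg by linarith
    next
      case False
      have "real k / real n - x = (real k - real n * x) / real n" using n(2) by (simp add: field_simps)
      then have "\<delta>\<^sup>2 \<le> ((real k - real n * x) / real n)\<^sup>2"
        using False \<delta> by (metis abs_le_square_iff abs_of_pos not_less)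
      then have "\<delta>\<^sup>2 * (real n)\<^sup>2 \<le> (real k - real n * x)\<^sup>2"
        using n(2) by (simp add: power_divide field_simps)
      \<comment> \<open>At a distant node the quadratic term alone reaches 2M, the trivial bound for
        the difference.\<close>
      then have "2 * M \<le> 2 * M / (\<delta>\<^sup>2 * (real n)\<^sup>2) * (real k - real n * x)\<^sup>2"
        using M0 \<delta> n(2) by (simp add: field_simps mult_left_mono)
      moreover have "cmod (f (real k / real n) - f x) \<le> M + M"
        by (rule order_trans[OF norm_triangle_ineq4 add_mono[OF M[OF kn] M[OF x]]])
      ultimately show ?thesis using e by linarith
    qed
    then show "cmod (of_real (Bernstein n k x) * (f (real k / real n) - f x)) \<le>
        Bernstein n k x * (e / 2 + 2 * M / (\<delta>\<^sup>2 * (real n)\<^sup>2) * (real k - real n * x)\<^sup>2)"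
      using B[of k] by (simp add: norm_mult mult_left_mono)
  qed
  also have "\<dots> = (\<Sum>k\<le>n. e / 2 * Bernstein n k x +
      2 * M / (\<delta>\<^sup>2 * (real n)\<^sup>2) * ((real k - real n * x)\<^sup>2 * Bernstein n k x))"
    by (rule sum.cong) (simp_all add: algebra_simps)
  also have "\<dots> = e / 2 + 2 * M / (\<delta>\<^sup>2 * (real n)\<^sup>2) * (real n * x * (1 - x))"
    by (simp only: sum.distrib sum_distrib_left[symmetric] sum_Bernstein Bernstein_variance mult_1_right)
  also have "\<dots> \<le> e / 2 + 2 * M / (\<delta>\<^sup>2 * (real n)\<^sup>2) * real n"
  proof -
    have "x * (1 - x) \<le> 1" using x by (intro mult_le_one) auto
    then have "real n * x * (1 - x) \<le> real n" using mult_left_mono[of "x * (1 - x)" 1 "real n"] by (simp add: mult.assoc)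
    then show ?thesis using M0 by (intro add_left_mono mult_left_mono) auto
  qed
  also have "\<dots> \<le> e"
  proof -
    have "2 * M / (\<delta>\<^sup>2 * (real n)\<^sup>2) * real n = 2 * M / (\<delta>\<^sup>2 * real n)"
      using n(2) by (simp add: power2_eq_square)
    also have "\<dots> \<le> e / 2" using n \<delta> e by (simp add: field_simps)
    finally show ?thesis by simp
  qed
  finally show ?thesis .
qed

text \<open>The polynomial with index -1 is zero by convention; the \<open>if\<close> says so, since
  truncated subtraction would turn it into \<open>Bernstein m 0\<close>.\<close>

lemma Bernstein_has_derivative:
  assumes "k \<le> Suc m"
  shows "(Bernstein (Suc m) k has_real_derivative
    real (Suc m) * ((if k = 0 then 0 else Bernstein m (k - 1) t) - Bernstein m k t)) (at t)"
proof (cases k)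
  case 0
  have "((\<lambda>t. 1 - t) has_real_derivative - 1) (at t)" by (auto intro!: derivative_eq_intros)
  then have "((\<lambda>t. (1 - t) ^ Suc m) has_real_derivative (1 + of_nat m) * (- 1 * (1 - t) ^ m)) (at t)"
    by (rule DERIV_power_Suc)
  moreover have "(1 + of_nat m) * (- 1 * (1 - t) ^ m) =
      real (Suc m) * ((if k = 0 then 0 else Bernstein m (k - 1) t) - Bernstein m k t)"
    using 0 by (simp add: Bernstein_def)
  moreover have "Bernstein (Suc m) k = (\<lambda>t. (1 - t) ^ Suc m)"
    using 0 by (simp add: Bernstein_def fun_eq_iff)
  ultimately show ?thesis by (simp only:)
next
  case (Suc j)
  let ?C = "real (Suc m choose Suc j)"
  \<comment> \<open>The absorption identities for binomial coefficients, which turn the two terms of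
    the product rule into Bernstein polynomials of degree m.\<close>
  have c1: "?C * real (Suc j) = real (Suc m) * real (m choose j)"
    by (metis Suc_times_binomial_eq of_nat_mult)
  have c2: "real (m - j) * ?C = real (Suc m) * real (m choose Suc j)"
    using binomial_absorb_comp[of "Suc m" "Suc j"] by (metis diff_Suc_Suc diff_Suc_1 of_nat_mult)
  have "((\<lambda>t. 1 - t) has_real_derivative - 1) (at t)" by (auto intro!: derivative_eq_intros)
  from DERIV_mult[OF DERIV_cmult[OF DERIV_power_Suc[OF DERIV_ident]] DERIV_power[OF this], of ?C j "m - j"]
  have "((\<lambda>t. ?C * t ^ Suc j * (1 - t) ^ (m - j)) has_real_derivative
      ?C * ((1 + of_nat j) * (1 * t ^ j)) * (1 - t) ^ (m - j) +
      of_nat (m - j) * (- 1 * (1 - t) ^ (m - j - Suc 0)) * (?C * t ^ Suc j)) (at t)" .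
  also have "?C * ((1 + of_nat j) * (1 * t ^ j)) * (1 - t) ^ (m - j) +
      of_nat (m - j) * (- 1 * (1 - t) ^ (m - j - Suc 0)) * (?C * t ^ Suc j) =
      (?C * real (Suc j)) * (t ^ j * (1 - t) ^ (m - j)) - (real (m - j) * ?C) * (t ^ Suc j * (1 - t) ^ (m - Suc j))"
    by (simp add: algebra_simps)
  also have "\<dots> = real (Suc m) * (Bernstein m j t - Bernstein m (Suc j) t)"
    unfolding c1 c2 by (simp add: Bernstein_def algebra_simps)
  finally show ?thesis using Suc by (simp add: Bernstein_def[abs_def])
qed

text \<open>Summation by parts: differentiating a Bernstein sum lowers the degree by one and
  replaces the coefficients by scaled forward differences.\<close>

lemma Bernstein_sum_derivative:
  fixes a :: "nat \<Rightarrow> complex"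
  shows "(\<Sum>k\<le>Suc m. of_real (real (Suc m) * ((if k = 0 then 0 else Bernstein m (k - 1) t) - Bernstein m k t)) * a k) =
    (\<Sum>k\<le>m. of_real (Bernstein m k t) * (of_nat (Suc m) * (a (Suc k) - a k)))"
proof -
  let ?b = "\<lambda>k. complex_of_real (Bernstein m k t)" and ?c = "\<lambda>k. complex_of_real (if k = 0 then 0 else Bernstein m (k - 1) t)"
  have z: "?b (Suc m) = 0" by (simp add: Bernstein_def)
  have "(\<Sum>k\<le>Suc m. of_real (real (Suc m) * ((if k = 0 then 0 else Bernstein m (k - 1) t) - Bernstein m k t)) * a k) =
      (\<Sum>k\<le>Suc m. of_nat (Suc m) * (?c k * a k) - of_nat (Suc m) * (?b k * a k))"
    by (rule sum.cong) (simp_all only: of_real_mult of_real_diff of_real_of_nat_eq algebra_simps)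
  also have "\<dots> = of_nat (Suc m) * ((\<Sum>k\<le>Suc m. ?c k * a k) - (\<Sum>k\<le>Suc m. ?b k * a k))"
    by (simp only: sum_subtractf sum_distrib_left[symmetric] right_diff_distrib)
  also have "(\<Sum>k\<le>Suc m. ?c k * a k) = (\<Sum>k\<le>m. ?b k * a (Suc k))"
    by (subst sum.atMost_Suc_shift) simp
  also have "(\<Sum>k\<le>Suc m. ?b k * a k) = (\<Sum>k\<le>m. ?b k * a k)"
    using z by (subst sum.atMost_Suc) simp
  also have "of_nat (Suc m) * ((\<Sum>k\<le>m. ?b k * a (Suc k)) - (\<Sum>k\<le>m. ?b k * a k)) =
      (\<Sum>k\<le>m. ?b k * (of_nat (Suc m) * (a (Suc k) - a k)))"
    by (simp only: sum_subtractf[symmetric] sum_distrib_left) (rule sum.cong, simp_all only: algebra_simps)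
  finally show ?thesis .
qed

lemma cdiff_Bernstein: "cdiff l (\<lambda>t. Bernstein n k ((t + R) / (2 * R)))"
proof -
  have "cdiff l (Bernstein n k)"
    unfolding Bernstein_def[abs_def]
    using cdiff_affine[OF cdiff_ident, of l "-1" 1]
    by (intro cdiff_mult cdiff_const cdiff_power cdiff_ident) simp
  from cdiff_affine[OF this, of "1 / (2 * R)" "R / (2 * R)"] show ?thesis
    by (simp add: add_divide_distrib)
qed

lemma continuous_map_fun_upd_const:
  assumes "i < d"
  shows "continuous_map (Rtop d) (Rtop d) (\<lambda>x. x(i := s))"
  unfolding continuous_map_componentwise
proof (intro conjI ballI)
  show "(\<lambda>x. x(i := s)) ` topspace (Rtop d) \<subseteq> extensional {..<d}"
    using assms by (auto simp: extensional_def)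
  fix k assume "k \<in> {..<d}"
  then show "continuous_map (Rtop d) euclidean (\<lambda>x. (x(i := s)) k)"
    using continuous_map_product_projection[of k "{..<d}" "\<lambda>_. euclideanreal"] by (cases "k = i") auto
qed

lemma slice_has_partial_derivative:
  assumes v: "C_k d (Suc k) v" and i: "i < d" and j: "j < d" "j \<noteq> i" and x: "x \<in> topspace (Rtop d)"
  shows "((\<lambda>t. v (x(j := t, i := s))) has_vector_derivative partial_deriv j v (x(i := s))) (at (x j))"
proof -
  have "x(i := s) \<in> topspace (Rtop d)" using fun_upd_in_Rtop[OF i] x by simp
  note deriv = C_k_has_partial_deriv[OF v j(1) this]
  have "(x(i := s)) j = x j" using j(2) by (rule fun_upd_other)
  moreover have "x(i := s, j := t) = x(j := t, i := s)" for t by (rule fun_upd_twist) (use j(2) in auto)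
  ultimately show ?thesis using deriv by (simp only:)
qed

lemma C_k_slice:
  assumes i: "i < d"
  shows "C_k d k v \<Longrightarrow> C_k d k (\<lambda>x. v (x(i := s)))"
proof (induction k arbitrary: v)
  case 0
  then show ?case
    using continuous_map_compose[OF continuous_map_fun_upd_const[OF i, of s], of euclidean v]
    by (simp only: o_def C_k.simps)
next
  case (Suc k)
  show ?case
  proof (rule C_k_SucI[where u' = "\<lambda>j x. if j = i then 0 else partial_deriv j v (x(i := s))"])
    show "continuous_map (Rtop d) euclidean (\<lambda>x. v (x(i := s)))"
      using continuous_map_compose[OF continuous_map_fun_upd_const[OF i, of s], of euclidean v]
        C_k_continuous[OF Suc.prems] by (simp only: o_def)
  next
    fix j x assume jx: "j < d" "x \<in> topspace (Rtop d)"
    show "((\<lambda>t. v (x(j := t, i := s))) has_vector_derivative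
        (if j = i then 0 else partial_deriv j v (x(i := s)))) (at (x j))"
    proof (cases "j = i")
      case True
      then show ?thesis by (simp only: True fun_upd_upd refl if_True has_vector_derivative_const)
    next
      case False
      then show ?thesis
        using slice_has_partial_derivative[OF Suc.prems i jx(1) False jx(2)] by (simp only: if_False)
    qed
  next
    fix j assume j: "j < d"
    show "C_k d k (\<lambda>x. if j = i then 0 else partial_deriv j v (x(i := s)))"
    proof (cases "j = i")
      case True
      then show ?thesis by (simp add: C_k_const)
    next
      case False
      then show ?thesis using Suc.IH[OF C_k_partial_deriv[OF Suc.prems j]] by (simp only: if_False)
    qed
  qed
qed

text \<open>The Bernstein polynomial in the variable \<open>i\<close> on [-R, R], with the other
  variables as parameters. Each coefficient is v on the slice through a node, hence independent of
  \<open>x i\<close> and as regular as v in the rest.\<close>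

definition Bernstein_op ::
  "real \<Rightarrow> nat \<Rightarrow> nat \<Rightarrow> ((nat \<Rightarrow> real) \<Rightarrow> complex) \<Rightarrow> (nat \<Rightarrow> real) \<Rightarrow> complex" where
  "Bernstein_op R i n v x = (\<Sum>k\<le>n. of_real (Bernstein n k ((x i + R) / (2 * R))) *
     v (x(i := - R + 2 * R * (real k / real n))))"

lemma C_k_Bernstein_op: "i < d \<Longrightarrow> C_k d k v \<Longrightarrow> C_k d k (Bernstein_op R i n v)"
  unfolding Bernstein_op_def[abs_def]
  by (intro C_k_sum C_k_mult C_k_slice C_k_coordinate[OF cdiff_Bernstein]) auto

text \<open>Compactness in the topology of the whole function type, where products with intervals
  and attainment of minima are at hand.\<close>

lemma compact_cube: "compact (cube d a r)"
proof -
  have "cube d a r = PiE UNIV (\<lambda>i. if i < d then {a i - r..a i + r} else {undefined})" (is "_ = ?P")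
    by (auto simp: cube_def PiE_def Pi_def extensional_def split: if_splits)
  moreover have "compactin (product_topology (\<lambda>_. euclidean) UNIV) ?P"
    by (simp add: compactin_PiE)
  ultimately show ?thesis by (simp add: euclidean_product_topology)
qed

lemma continuous_on_restrict_Rtop:
  assumes "continuous_map (Rtop d) euclidean v"
  shows "continuous_on UNIV (\<lambda>x. v (restrict x {..<d}))"
  using continuous_map_compose[OF continuous_map_restrict assms] by (simp add: o_def)

text \<open>The triples (x, s, t) with a variation of at least e form a compact set. If it is
  nonempty, |s - t| attains a minimum on it, which is positive because s = t gives variation 0; this
  minimum serves as \<delta>.\<close>

lemma equicontinuous_slices:
  fixes v :: "_ \<Rightarrow> complex"
  assumes v: "continuous_map (Rtop d) euclidean v" and i: "i < d" and e: "e > 0"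
  obtains \<delta> where "\<delta> > 0" "\<And>x s t. x \<in> cube d (\<lambda>_. 0) R \<Longrightarrow> s \<in> {-R..R} \<Longrightarrow> t \<in> {-R..R} \<Longrightarrow> \<bar>s - t\<bar> < \<delta> \<Longrightarrow>
    cmod (v (x(i := s)) - v (x(i := t))) \<le> e"
proof -
  let ?v = "\<lambda>x. v (restrict x {..<d})"
  let ?g = "\<lambda>(x, s, t). cmod (?v (x(i := s)) - ?v (x(i := t)))"
  let ?K = "cube d (\<lambda>_. 0) R \<times> {-R..R} \<times> {-R..R}"
  define S where "S = ?K \<inter> ?g -` {e..}"
  have upd: "continuous_on UNIV (\<lambda>p :: (nat \<Rightarrow> real) \<times> real \<times> real. (fst p)(i := f p))"
    if "continuous_on UNIV f" for f
  proof (rule continuous_on_coordinatewise_then_product)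
    fix k
    show "continuous_on UNIV (\<lambda>p :: (nat \<Rightarrow> real) \<times> real \<times> real. ((fst p)(i := f p)) k)"
      using that continuous_on_product_then_coordinatewise[OF continuous_on_fst[OF continuous_on_id], of UNIV k]
      by (cases "k = i") auto
  qed
  have slice: "continuous_on UNIV (\<lambda>p. ?v ((fst p)(i := f p)))"
    if "continuous_on UNIV f" for f :: "(nat \<Rightarrow> real) \<times> real \<times> real \<Rightarrow> real"
    by (rule continuous_on_compose2[OF continuous_on_restrict_Rtop[OF v] upd[OF that]]) simp
  have "continuous_on UNIV ?g"
    unfolding case_prod_unfold by (intro continuous_intros slice)
  then have "closed (?g -` {e..})" by (intro closed_vimage) auto
  then have comp: "compact S"
    unfolding S_def by (intro compact_Int_closed compact_Times compact_cube compact_Icc)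
  have in_top: "x(i := s) \<in> topspace (Rtop d)" if "x \<in> cube d (\<lambda>_. 0) R" for x s
  proof -
    have "x \<in> PiE {..<d} (\<lambda>_. UNIV)" using that by (simp only: cube_iff)
    from fun_upd_in_Rtop[OF i this] show ?thesis by (simp only: topspace_Rtop)
  qed
  have v_eq: "?v (x(i := s)) = v (x(i := s))" if "x \<in> cube d (\<lambda>_. 0) R" for x s
    using in_top[OF that, of s] by (simp add: PiE_restrict)
  show ?thesis
  proof (cases "S = {}")
    case True
    have "cmod (v (x(i := s)) - v (x(i := t))) \<le> e"
      if "x \<in> cube d (\<lambda>_. 0) R" "s \<in> {-R..R}" "t \<in> {-R..R}" for x s t
    proof -
      have "(x, s, t) \<notin> S" using True by blast
      then show ?thesis using that v_eq[OF that(1)] by (auto simp: S_def)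
    qed
    then show ?thesis by (intro that[of 1]) auto
  next
    case False
    have "\<exists>p\<in>S. \<forall>q\<in>S. \<bar>fst (snd p) - snd (snd p)\<bar> \<le> \<bar>fst (snd q) - snd (snd q)\<bar>"
      by (rule continuous_attains_inf[OF comp False]) (intro continuous_intros)
    then obtain p where p: "p \<in> S" "\<And>q. q \<in> S \<Longrightarrow> \<bar>fst (snd p) - snd (snd p)\<bar> \<le> \<bar>fst (snd q) - snd (snd q)\<bar>"
      by blast
    have pos: "\<bar>fst (snd p) - snd (snd p)\<bar> > 0"
      using p(1) e by (auto simp: split_beta S_def)
    have "cmod (v (x(i := s)) - v (x(i := t))) \<le> e"
      if A: "x \<in> cube d (\<lambda>_. 0) R" "s \<in> {-R..R}" "t \<in> {-R..R}" "\<bar>s - t\<bar> < \<bar>fst (snd p) - snd (snd p)\<bar>" for x s t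
    proof -
      have "(x, s, t) \<notin> S" using p(2)[of "(x, s, t)"] A(4) by auto
      then show ?thesis using A(1-3) v_eq[OF A(1)] by (auto simp: S_def)
    qed
    then show ?thesis by (rule that[OF pos])
  qed
qed

lemma upd_in_cube: "i < d \<Longrightarrow> x \<in> cube d (\<lambda>_. 0) R \<Longrightarrow> s \<in> {-R..R} \<Longrightarrow> x(i := s) \<in> cube d (\<lambda>_. 0) R"
  using fun_upd_in_Rtop[of i d x s] by (auto simp: cube_iff abs_le_iff)

lemma Bernstein_op_approx:
  assumes v: "continuous_map (Rtop d) euclidean v" and i: "i < d" and R: "R > 0" and e: "e > 0"
  shows "\<exists>N. \<forall>n\<ge>N. \<forall>x\<in>cube d (\<lambda>_. 0) R. cmod (Bernstein_op R i n v x - v x) \<le> e"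
proof -
  obtain M where M: "\<And>x. x \<in> cube d (\<lambda>_. 0) R \<Longrightarrow> cmod (v x) \<le> M"
    using continuous_map_compact_bounded[OF v compactin_cube] by blast
  obtain \<delta> where \<delta>: "\<delta> > 0" "\<And>x s t. x \<in> cube d (\<lambda>_. 0) R \<Longrightarrow> s \<in> {-R..R} \<Longrightarrow> t \<in> {-R..R} \<Longrightarrow> \<bar>s - t\<bar> < \<delta> \<Longrightarrow>
      cmod (v (x(i := s)) - v (x(i := t))) \<le> e / 2"
    using equicontinuous_slices[OF v i, of "e / 2" R] e by auto
  \<comment> \<open>The modulus of continuity carried over from [-R, R] to the unit
    interval.\<close>
  define \<delta>' where "\<delta>' = \<delta> / (2 * R)"
  have \<delta>': "\<delta>' > 0" using \<delta>(1) R by (simp add: \<delta>'_def)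
  obtain N :: nat where N: "4 * M / (e * \<delta>'\<^sup>2) < real N" using reals_Archimedean2 by blast
  have pt: "- R + 2 * R * \<tau> \<in> {-R..R}" if "\<tau> \<in> {0..1}" for \<tau>
  proof -
    have "2 * R * \<tau> \<le> 2 * R * 1" using that R by (intro mult_left_mono) auto
    then show ?thesis using that R by auto
  qed
  have "cmod (Bernstein_op R i n v x - v x) \<le> e" if n: "n \<ge> N + 1" and x: "x \<in> cube d (\<lambda>_. 0) R" for n x
  proof -
    let ?t = "(x i + R) / (2 * R)" and ?f = "\<lambda>\<tau>. v (x(i := - R + 2 * R * \<tau>))"
    have xi: "\<bar>x i\<bar> \<le> R" using x i by (simp add: cube_iff)
    then have t: "?t \<in> {0..1}" using R by (auto simp: field_simps abs_le_iff)
    have "- R + 2 * R * ?t = x i" using R by (simp add: field_simps)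
    then have fx: "?f ?t = v x" by (simp only: fun_upd_triv)
    have "cmod ((\<Sum>k\<le>n. of_real (Bernstein n k ?t) * ?f (real k / real n)) - ?f ?t) \<le> e"
    proof (rule Bernstein_approx_bound[OF _ _ \<delta>' e _ _ t, where M = M])
      show "cmod (?f \<tau>) \<le> M" if "\<tau> \<in> {0..1}" for \<tau>
        by (rule M[OF upd_in_cube[OF i x pt[OF that]]])
      show "cmod (?f \<tau> - ?f \<sigma>) \<le> e / 2" if "\<tau> \<in> {0..1}" "\<sigma> \<in> {0..1}" "\<bar>\<tau> - \<sigma>\<bar> < \<delta>'" for \<tau> \<sigma>
      proof (rule \<delta>(2)[OF x pt[OF that(1)] pt[OF that(2)]])
        have "\<bar>- R + 2 * R * \<tau> - (- R + 2 * R * \<sigma>)\<bar> = 2 * R * \<bar>\<tau> - \<sigma>\<bar>"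
          using R by (simp add: abs_mult right_diff_distrib[symmetric])
        also have "\<dots> < 2 * R * \<delta>'" using that(3) R by simp
        also have "\<dots> = \<delta>" using R by (simp add: \<delta>'_def)
        finally show "\<bar>- R + 2 * R * \<tau> - (- R + 2 * R * \<sigma>)\<bar> < \<delta>" .
      qed
      show "4 * M / (e * \<delta>'\<^sup>2) \<le> real n" "n \<ge> 1" using N n by linarith+
    qed
    then show ?thesis unfolding fx Bernstein_op_def .
  qed
  then show ?thesis by blast
qed

text \<open>The weights depend on \<open>x i\<close> only, so a derivative in another variable
  passes to the samples.\<close>

lemma partial_deriv_Bernstein_op_other:
  assumes v: "C_k d (Suc 0) v" and i: "i < d" and j: "j < d" "j \<noteq> i" and x: "x \<in> topspace (Rtop d)"
  shows "partial_deriv j (Bernstein_op R i n v) x = Bernstein_op R i n (partial_deriv j v) x"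
proof (rule partial_deriv_eqI)
  let ?b = "\<lambda>k. complex_of_real (Bernstein n k ((x i + R) / (2 * R)))" and ?s = "\<lambda>k. - R + 2 * R * (real k / real n)"
  have "((\<lambda>t. \<Sum>k\<le>n. ?b k * v (x(j := t, i := ?s k))) has_vector_derivative
      (\<Sum>k\<le>n. ?b k * partial_deriv j v (x(i := ?s k)))) (at (x j))"
    by (intro has_vector_derivative_sum has_vector_derivative_mult_right slice_has_partial_derivative[OF v i j x])
  moreover have "(x(j := t)) i = x i" for t using j(2) by (intro fun_upd_other) auto
  ultimately show "((\<lambda>t. Bernstein_op R i n v (x(j := t))) has_vector_derivative
      Bernstein_op R i n (partial_deriv j v) x) (at (x j))"
    by (simp only: Bernstein_op_def)
qed

text \<open>Neighbouring nodes are 2R / (m + 1) apart, so the coefficients on the right are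
  difference quotients of v between them.\<close>

lemma partial_deriv_Bernstein_op_same:
  assumes R: "R > 0"
  shows "partial_deriv i (Bernstein_op R i (Suc m) v) x =
    (\<Sum>k\<le>m. of_real (Bernstein m k ((x i + R) / (2 * R))) * (of_real (real (Suc m) / (2 * R)) *
      (v (x(i := - R + 2 * R * (real (Suc k) / real (Suc m)))) - v (x(i := - R + 2 * R * (real k / real (Suc m)))))))"
    (is "_ = ?rhs")
proof (rule partial_deriv_eqI)
  define a where "a k = v (x(i := - R + 2 * R * (real k / real (Suc m))))" for k
  define t0 where "t0 = (x i + R) / (2 * R)"
  define B' where "B' k = real (Suc m) * ((if k = 0 then 0 else Bernstein m (k - 1) t0) - Bernstein m k t0)" for k
  have "((\<lambda>t. Bernstein (Suc m) k ((t + R) / (2 * R))) has_real_derivative B' k * (1 / (2 * R))) (at (x i))"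
    if "k \<in> {..Suc m}" for k
  proof (rule DERIV_chain2[where f = "Bernstein (Suc m) k" and g = "\<lambda>t. (t + R) / (2 * R)"])
    show "(Bernstein (Suc m) k has_real_derivative B' k) (at ((x i + R) / (2 * R)))"
      unfolding B'_def t0_def by (rule Bernstein_has_derivative) (use that in simp)
    show "((\<lambda>t. (t + R) / (2 * R)) has_real_derivative 1 / (2 * R)) (at (x i))"
      using R by (auto intro!: derivative_eq_intros)
  qed
  then have "((\<lambda>t. \<Sum>k\<le>Suc m. complex_of_real (Bernstein (Suc m) k ((t + R) / (2 * R))) * a k) has_vector_derivative
      (\<Sum>k\<le>Suc m. of_real (B' k * (1 / (2 * R))) * a k)) (at (x i))"
    by (intro has_vector_derivative_sum has_vector_derivative_mult_left has_vector_derivative_of_real)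
      (simp add: has_real_derivative_iff_has_vector_derivative)
  moreover have "(\<Sum>k\<le>Suc m. of_real (B' k * (1 / (2 * R))) * a k) = ?rhs"
  proof -
    have "(\<Sum>k\<le>Suc m. of_real (B' k * (1 / (2 * R))) * a k) = of_real (1 / (2 * R)) * (\<Sum>k\<le>Suc m. of_real (B' k) * a k)"
      by (simp only: sum_distrib_left of_real_mult mult_ac)
    also have "(\<Sum>k\<le>Suc m. of_real (B' k) * a k) = (\<Sum>k\<le>m. of_real (Bernstein m k t0) * (of_nat (Suc m) * (a (Suc k) - a k)))"
      unfolding B'_def by (rule Bernstein_sum_derivative)
    also have "of_real (1 / (2 * R)) * \<dots> =
        (\<Sum>k\<le>m. of_real (Bernstein m k t0) * (of_real (real (Suc m) / (2 * R)) * (a (Suc k) - a k)))"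
      unfolding sum_distrib_left by (rule sum.cong) simp_all
    finally show ?thesis by (simp only: a_def t0_def)
  qed
  moreover have "Bernstein_op R i (Suc m) v (x(i := t)) =
      (\<Sum>k\<le>Suc m. complex_of_real (Bernstein (Suc m) k ((t + R) / (2 * R))) * a k)" for t
    by (simp only: Bernstein_op_def fun_upd_same fun_upd_upd a_def)
  ultimately show "((\<lambda>t. Bernstein_op R i (Suc m) v (x(i := t))) has_vector_derivative ?rhs) (at (x i))"
    by (simp only:)
qed

text \<open>The mean value inequality for f(s) - s D, used because a complex-valued function need
  not attain its difference quotient as a derivative.\<close>

lemma difference_quotient_bound:
  fixes f :: "real \<Rightarrow> complex"
  assumes ab: "a < b" and deriv: "\<And>s. (f has_vector_derivative f' s) (at s)"
    and bound: "\<And>s. a < s \<Longrightarrow> s < b \<Longrightarrow> cmod (f' s - D) \<le> e"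
  shows "cmod (of_real (1 / (b - a)) * (f b - f a) - D) \<le> e"
proof -
  have cont: "continuous_on {a..b} (\<lambda>s. f s - of_real s * D)"
    using deriv by (intro continuous_intros continuous_at_imp_continuous_on ballI has_vector_derivative_continuous)
  have "cmod ((f b - of_real b * D) - (f a - of_real a * D)) \<le> e * b - e * a"
  proof (rule differentiable_bound_general[OF ab cont, where f' = "\<lambda>s. f' s - D" and \<phi>' = "\<lambda>_. e"])
    show "continuous_on {a..b} (\<lambda>s. e * s)" by (intro continuous_intros)
    show "((\<lambda>s. f s - of_real s * D) has_vector_derivative f' s - D) (at s)" for s
    proof -
      have "((\<lambda>s. complex_of_real s * D) has_vector_derivative 1 * D) (at s)"
        by (intro has_vector_derivative_mult_left) (auto intro!: derivative_eq_intros)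
      then show ?thesis using has_vector_derivative_diff[OF deriv] by fastforce
    qed
    show "((\<lambda>s. e * s) has_vector_derivative e) (at s)" for s
      by (auto intro!: derivative_eq_intros simp: has_real_derivative_iff_has_vector_derivative[symmetric])
  qed (use bound in auto)
  moreover have "(f b - of_real b * D) - (f a - of_real a * D) = of_real (b - a) * (of_real (1 / (b - a)) * (f b - f a) - D)"
    using ab by (simp add: field_simps)
  ultimately have "(b - a) * cmod (of_real (1 / (b - a)) * (f b - f a) - D) \<le> (b - a) * e"
    using ab by (simp only: norm_mult norm_of_real) (simp add: algebra_simps)
  then show ?thesis using ab by simp
qed

text \<open>The derivative of the operator of degree m + 1 is compared with the operator of degree m
  applied to the derivative of v. Their coefficients are a difference quotient over a short interval
  and the derivative at a point of that same interval.\<close>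

lemma Bernstein_op_deriv_approx:
  assumes v: "C_k d (Suc 0) v" and i: "i < d" and R: "R > 0" and e: "e > 0"
  shows "\<exists>N. \<forall>n\<ge>N. \<forall>x\<in>cube d (\<lambda>_. 0) R. cmod (partial_deriv i (Bernstein_op R i n v) x - partial_deriv i v x) \<le> e"
proof -
  let ?w = "partial_deriv i v"
  have w: "continuous_map (Rtop d) euclidean ?w" by (rule C_k_continuous[OF C_k_partial_deriv[OF v i]])
  obtain N where N: "\<And>n x. n \<ge> N \<Longrightarrow> x \<in> cube d (\<lambda>_. 0) R \<Longrightarrow> cmod (Bernstein_op R i n ?w x - ?w x) \<le> e / 2"
    using Bernstein_op_approx[OF w i R, of "e / 2"] e by auto
  obtain \<delta> where \<delta>: "\<delta> > 0" "\<And>x s t. x \<in> cube d (\<lambda>_. 0) R \<Longrightarrow> s \<in> {-R..R} \<Longrightarrow> t \<in> {-R..R} \<Longrightarrow> \<bar>s - t\<bar> < \<delta> \<Longrightarrow>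
      cmod (?w (x(i := s)) - ?w (x(i := t))) \<le> e / 2"
    using equicontinuous_slices[OF w i, of "e / 2" R] e by auto
  obtain N' :: nat where N': "2 * R / \<delta> < real N'" using reals_Archimedean2 by blast
  have "cmod (partial_deriv i (Bernstein_op R i n v) x - ?w x) \<le> e"
    if n: "n \<ge> N + N' + 2" and x: "x \<in> cube d (\<lambda>_. 0) R" for n x
  proof -
    obtain m where m: "n = Suc m" "m \<ge> N" "m \<ge> N'" "m \<ge> 1" using n by (cases n) auto
    have xt: "x \<in> topspace (Rtop d)" using x by (simp add: cube_iff)
    define s where "s k = - R + 2 * R * (real k / real (Suc m))" for k
    \<comment> \<open>The nodes of degree m, against the nodes s of degree m + 1.\<close>
    define \<sigma> where "\<sigma> k = - R + 2 * R * (real k / real m)" for k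
    define b where "b k = complex_of_real (Bernstein m k ((x i + R) / (2 * R)))" for k
    define q where "q k = complex_of_real (real (Suc m) / (2 * R)) * (v (x(i := s (Suc k))) - v (x(i := s k)))" for k
    have step: "s (Suc k) - s k = 2 * R / real (Suc m)" for k
    proof -
      have "real (Suc k) / real (Suc m) = real k / real (Suc m) + 1 / real (Suc m)"
        by (simp only: add_divide_distrib[symmetric]) simp
      then show ?thesis by (simp add: s_def distrib_left del: of_nat_Suc)
    qed
    have step_less: "2 * R / real (Suc m) < \<delta>"
    proof -
      have "2 * R / \<delta> < real (Suc m)" using N' m(3) by simp
      then show ?thesis using \<delta>(1) by (simp add: field_simps)
    qed
    have s_mem: "s k \<in> {-R..R}" if "k \<le> Suc m" for k
    proof -
      have "real k / real (Suc m) \<le> 1" using that by (simp add: field_simps)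
      then have "2 * R * (real k / real (Suc m)) \<le> 2 * R * 1" using R by (intro mult_left_mono) auto
      then show ?thesis using R by (simp add: s_def)
    qed
    \<comment> \<open>The two grids interlace: k / (m + 1) \<le> k / m \<le> (k + 1) / (m + 1) for k
      \<le> m.\<close>
    have \<sigma>_mem: "s k \<le> \<sigma> k" "\<sigma> k \<le> s (Suc k)" if "k \<le> m" for k
    proof -
      have le: "real k / real (Suc m) \<le> real k / real m" using m(4) by (intro divide_left_mono) auto
      show "s k \<le> \<sigma> k"
        unfolding s_def \<sigma>_def by (intro add_left_mono mult_left_mono le) (use R in simp)
      have le: "real k / real m \<le> real (Suc k) / real (Suc m)" using m(4) that by (simp add: field_simps)
      show "\<sigma> k \<le> s (Suc k)"
        unfolding s_def \<sigma>_def by (intro add_left_mono mult_left_mono le) (use R in simp)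
    qed
    have q: "cmod (q k - ?w (x(i := \<sigma> k))) \<le> e / 2" if k: "k \<le> m" for k
    proof -
      have "cmod (of_real (1 / (s (Suc k) - s k)) * (v (x(i := s (Suc k))) - v (x(i := s k))) - ?w (x(i := \<sigma> k))) \<le> e / 2"
      proof (rule difference_quotient_bound)
        have "0 < s (Suc k) - s k" unfolding step using R by simp
        then show "s k < s (Suc k)" by simp
        show "((\<lambda>t. v (x(i := t))) has_vector_derivative ?w (x(i := t))) (at t)" for t
          by (rule C_k_has_partial_deriv_at[OF v i xt])
        fix t assume t: "s k < t" "t < s (Suc k)"
        have "t \<in> {-R..R}" using t s_mem[of k] s_mem[of "Suc k"] k by auto
        moreover have "\<sigma> k \<in> {-R..R}" using \<sigma>_mem[OF k] s_mem[of k] s_mem[of "Suc k"] k by auto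
        moreover have "\<bar>t - \<sigma> k\<bar> < \<delta>" using t \<sigma>_mem[OF k] step[of k] step_less by linarith
        ultimately show "cmod (?w (x(i := t)) - ?w (x(i := \<sigma> k))) \<le> e / 2" by (rule \<delta>(2)[OF x])
      qed
      then show ?thesis unfolding q_def step by simp
    qed
    have b0: "cmod (b k) = Bernstein m k ((x i + R) / (2 * R))" for k
    proof -
      have "\<bar>x i\<bar> \<le> R" using x i by (simp add: cube_iff)
      then have "0 \<le> (x i + R) / (2 * R)" "(x i + R) / (2 * R) \<le> 1" using R by (auto simp: field_simps abs_le_iff)
      then show ?thesis by (simp add: b_def Bernstein_nonneg)
    qed
    \<comment> \<open>Both sums run over the same weights of degree m, which are nonnegative and add
      up to 1, so the error is at most that of the coefficients.\<close>
    have "partial_deriv i (Bernstein_op R i n v) x - Bernstein_op R i m ?w x = (\<Sum>k\<le>m. b k * (q k - ?w (x(i := \<sigma> k))))"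
      unfolding m(1) partial_deriv_Bernstein_op_same[OF R] Bernstein_op_def
      by (simp only: b_def q_def s_def \<sigma>_def sum_subtractf[symmetric] right_diff_distrib)
    also have "cmod \<dots> \<le> (\<Sum>k\<le>m. Bernstein m k ((x i + R) / (2 * R)) * (e / 2))"
    proof (rule sum_norm_le)
      fix k assume "k \<in> {..m}"
      then show "cmod (b k * (q k - ?w (x(i := \<sigma> k)))) \<le> Bernstein m k ((x i + R) / (2 * R)) * (e / 2)"
        unfolding norm_mult b0 using b0[of k] by (intro mult_left_mono q) (auto simp flip: b0)
    qed
    also have "\<dots> = e / 2" by (simp only: sum_distrib_right[symmetric] sum_Bernstein mult_1_left)
    finally have "cmod (partial_deriv i (Bernstein_op R i n v) x - Bernstein_op R i m ?w x) \<le> e / 2" .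
    moreover have "cmod (Bernstein_op R i m ?w x - ?w x) \<le> e / 2" by (rule N[OF m(2) x])
    ultimately show ?thesis
      using norm_triangle_ineq[of "partial_deriv i (Bernstein_op R i n v) x - Bernstein_op R i m ?w x" "Bernstein_op R i m ?w x - ?w x"]
      by simp
  qed
  then show ?thesis by blast
qed

text \<open>Put as eventualities in the degree, the finitely many conditions, one for the values and
  one for each partial derivative, hold for a common degree.\<close>

lemma Bernstein_op_C1_approx:
  assumes v: "C_k d (Suc 0) v" and i: "i < d" and R: "R > 0" and e: "e > 0"
  obtains n where "\<And>x. x \<in> cube d (\<lambda>_. 0) R \<Longrightarrow> cmod (v x - Bernstein_op R i n v x) \<le> e"
    "\<And>j x. j < d \<Longrightarrow> x \<in> cube d (\<lambda>_. 0) R \<Longrightarrow> cmod (partial_deriv j v x - partial_deriv j (Bernstein_op R i n v) x) \<le> e"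
proof -
  have ev0: "\<forall>\<^sub>F n in sequentially. \<forall>x\<in>cube d (\<lambda>_. 0) R. cmod (Bernstein_op R i n v x - v x) \<le> e"
    using Bernstein_op_approx[OF C_k_continuous[OF v] i R e] by (simp add: eventually_sequentially)
  have "\<forall>\<^sub>F n in sequentially. \<forall>x\<in>cube d (\<lambda>_. 0) R. cmod (partial_deriv j (Bernstein_op R i n v) x - partial_deriv j v x) \<le> e"
    if j: "j < d" for j
  proof (cases "j = i")
    case True
    then show ?thesis
      using Bernstein_op_deriv_approx[OF v i R e] by (simp add: eventually_sequentially)
  next
    case False
    have "\<forall>\<^sub>F n in sequentially. \<forall>x\<in>cube d (\<lambda>_. 0) R. cmod (Bernstein_op R i n (partial_deriv j v) x - partial_deriv j v x) \<le> e"
      using Bernstein_op_approx[OF C_k_continuous[OF C_k_partial_deriv[OF v j]] i R e]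
      by (simp add: eventually_sequentially)
    then show ?thesis
    proof eventually_elim
      case (elim n)
      show ?case
      proof
        fix x assume x: "x \<in> cube d (\<lambda>_. 0) R"
        then have "x \<in> topspace (Rtop d)" by (simp add: cube_iff)
        from partial_deriv_Bernstein_op_other[OF v i j False this]
        show "cmod (partial_deriv j (Bernstein_op R i n v) x - partial_deriv j v x) \<le> e" using elim x by simp
      qed
    qed
  qed
  then have "\<forall>\<^sub>F n in sequentially. \<forall>j\<in>{..<d}. \<forall>x\<in>cube d (\<lambda>_. 0) R.
      cmod (partial_deriv j (Bernstein_op R i n v) x - partial_deriv j v x) \<le> e"
    by (intro eventually_ball_finite) auto
  with ev0 have "\<forall>\<^sub>F n in sequentially. (\<forall>x\<in>cube d (\<lambda>_. 0) R. cmod (Bernstein_op R i n v x - v x) \<le> e) \<and>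
    (\<forall>j\<in>{..<d}. \<forall>x\<in>cube d (\<lambda>_. 0) R. cmod (partial_deriv j (Bernstein_op R i n v) x - partial_deriv j v x) \<le> e)"
    by (rule eventually_conj)
  then obtain n where n: "\<forall>x\<in>cube d (\<lambda>_. 0) R. cmod (Bernstein_op R i n v x - v x) \<le> e"
    "\<forall>j\<in>{..<d}. \<forall>x\<in>cube d (\<lambda>_. 0) R. cmod (partial_deriv j (Bernstein_op R i n v) x - partial_deriv j v x) \<le> e"
    using eventually_happens'[OF sequentially_bot] by blast
  show ?thesis
    by (rule that[of n]) (use n in \<open>simp_all add: norm_minus_commute\<close>)
qed

section \<open>Splitting off the variables one at a time, and the inclusion of V in the tensor
  product\<close>

section \<open>Density of tensors of test functions\<close>

lemma L2_normsq_le: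
  assumes \<Omega>: "openin (Rtop d) \<Omega>" and u: "u \<in> L2 d \<Omega>"
    and bound: "\<And>x. x \<in> cube d a r \<Longrightarrow> cmod (u x) \<le> B"
    and zero: "\<And>x. x \<in> topspace (Rtop d) \<Longrightarrow> x \<notin> cube d a r \<Longrightarrow> u x = 0"
  shows "(L2_norm d \<Omega> u)\<^sup>2 \<le> B\<^sup>2 * measure (Rmeas d) (cube d a r)"
proof -
  have meas: "cube d a r \<in> sets (Rmeas d)" by (rule sets_Rmeas_closedin[OF closedin_cube])
  have "(L2_norm d \<Omega> u)\<^sup>2 = (LINT x|Rmeas d. indicator \<Omega> x *\<^sub>R (cmod (u x))\<^sup>2)"
    unfolding L2_normsq by (rule integral_restrict_space[OF open_in_Rmeas[OF \<Omega>]])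
  also have "\<dots> \<le> (LINT x|Rmeas d. indicator (cube d a r) x *\<^sub>R B\<^sup>2)"
  proof (rule integral_mono)
    show "integrable (Rmeas d) (\<lambda>x. indicator \<Omega> x *\<^sub>R (cmod (u x))\<^sup>2)"
      using L2D(2)[OF u] by (simp only: integrable_restrict_space[OF open_in_Rmeas[OF \<Omega>]])
    show "integrable (Rmeas d) (\<lambda>x. indicator (cube d a r) x *\<^sub>R B\<^sup>2)"
      by (intro integrable_scaleR_left integrable_real_indicator meas emeasure_cube_finite)
    fix x assume "x \<in> space (Rmeas d)"
    then have x: "x \<in> topspace (Rtop d)" by simp
    show "indicator \<Omega> x *\<^sub>R (cmod (u x))\<^sup>2 \<le> indicator (cube d a r) x *\<^sub>R B\<^sup>2"
    proof (cases "x \<in> cube d a r")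
      case True
      then have "(cmod (u x))\<^sup>2 \<le> B\<^sup>2" using bound by (intro power_mono) auto
      then show ?thesis using True by (auto simp: indicator_def)
    next
      case False
      then show ?thesis using zero[OF x] by simp
    qed
  qed
  also have "\<dots> = B\<^sup>2 * measure (Rmeas d) (cube d a r)"
    using meas emeasure_cube_finite Int_absorb2[OF sets.sets_into_space[OF meas], unfolded space_Rmeas]
    by (simp add: less_top[symmetric])
  finally show ?thesis .
qed

text \<open>Smallness of v is known only on the cube, and X is supported there. The constant 2 B e
  covers the two terms of the product rule, and 1 + d counts the function and its partial
  derivatives.\<close>

lemma H1_normsq_mult_cutoff_le:
  assumes \<Omega>: "openin (Rtop d) \<Omega>" and v: "C_k d (Suc 0) v" and X: "C_k d (Suc 0) X"
    and B: "\<And>x. x \<in> cube d (\<lambda>_. 0) R \<Longrightarrow> cmod (X x) \<le> B"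
      "\<And>i x. i < d \<Longrightarrow> x \<in> cube d (\<lambda>_. 0) R \<Longrightarrow> cmod (partial_deriv i X x) \<le> B"
    and supp: "supp d X \<subseteq> cube d (\<lambda>_. 0) R"
    and e: "\<And>x. x \<in> cube d (\<lambda>_. 0) R \<Longrightarrow> cmod (v x) \<le> e"
      "\<And>i x. i < d \<Longrightarrow> x \<in> cube d (\<lambda>_. 0) R \<Longrightarrow> cmod (partial_deriv i v x) \<le> e"
    and nonneg: "e \<ge> 0" "B \<ge> 0"
  shows "(H1_norm d \<Omega> (\<lambda>x. v x * X x))\<^sup>2 \<le> (1 + real d) * ((2 * B * e)\<^sup>2 * measure (Rmeas d) (cube d (\<lambda>_. 0) R))"
proof -
  let ?f = "\<lambda>x. v x * X x" and ?m = "measure (Rmeas d) (cube d (\<lambda>_. 0) R)"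
  have f: "C_k d (Suc 0) ?f" by (rule C_k_mult[OF v X])
  have "supp d ?f \<subseteq> supp d X" by (rule supp_minimal[OF closedin_supp]) (simp add: not_in_supp)
  then have sf: "supp d ?f \<subseteq> cube d (\<lambda>_. 0) R" using supp by blast
  have wg: "weak_grad d \<Omega> ?f (\<lambda>i. partial_deriv i ?f)"
    by (rule weak_grad_C1[OF \<Omega> f compactin_supp[OF compactin_cube sf]])
  have zero: "?f x = 0" "i < d \<Longrightarrow> partial_deriv i ?f x = 0"
    if "x \<in> topspace (Rtop d)" "x \<notin> cube d (\<lambda>_. 0) R" for i x
  proof -
    have "x \<notin> supp d ?f" using sf that(2) by blast
    then show "?f x = 0" "i < d \<Longrightarrow> partial_deriv i ?f x = 0"
      using not_in_supp[OF that(1)] supp_partial_deriv[of i d ?f] by blast+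
  qed
  have prod_le: "cmod (y * z) \<le> B * e" if "cmod y \<le> e" "cmod z \<le> B" for y z
    using mult_mono[OF that nonneg(1) norm_ge_zero] by (simp add: norm_mult mult.commute)
  have Be: "0 \<le> B * e" using nonneg by simp
  have f_le: "(L2_norm d \<Omega> ?f)\<^sup>2 \<le> (2 * B * e)\<^sup>2 * ?m"
  proof (rule L2_normsq_le[OF \<Omega> weak_gradD(1)[OF wg] _ zero(1)])
    fix x assume "x \<in> cube d (\<lambda>_. 0) R"
    then have "cmod (?f x) \<le> B * e" by (intro prod_le e B)
    then show "cmod (?f x) \<le> 2 * B * e" using Be by linarith
  qed
  have df_le: "(L2_norm d \<Omega> (partial_deriv i ?f))\<^sup>2 \<le> (2 * B * e)\<^sup>2 * ?m" if i: "i < d" for i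
  proof (rule L2_normsq_le[OF \<Omega> weak_gradD(2)[OF wg i] _ zero(2)[OF _ _ i]])
    fix x assume x: "x \<in> cube d (\<lambda>_. 0) R"
    then have xt: "x \<in> topspace (Rtop d)" by (simp add: cube_iff)
    have "cmod (v x * partial_deriv i X x + partial_deriv i v x * X x) \<le> B * e + B * e"
      by (intro order_trans[OF norm_triangle_ineq] add_mono prod_le e B i x)
    then show "cmod (partial_deriv i ?f x) \<le> 2 * B * e"
      by (simp add: partial_deriv_mult[OF v X i xt])
  qed
  have "(H1_norm d \<Omega> ?f)\<^sup>2 = (L2_norm d \<Omega> ?f)\<^sup>2 + (\<Sum>i<d. (L2_norm d \<Omega> (partial_deriv i ?f))\<^sup>2)"
    by (rule H1_normsq[OF \<Omega> wg])
  also have "\<dots> \<le> (2 * B * e)\<^sup>2 * ?m + (\<Sum>i<d. (2 * B * e)\<^sup>2 * ?m)"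
    by (intro add_mono sum_mono f_le df_le) simp
  also have "\<dots> = (1 + real d) * ((2 * B * e)\<^sup>2 * ?m)" by (simp add: distrib_right)
  finally show ?thesis .
qed

text \<open>Functions that are a product in the first \<open>k\<close> variables: successive Bernstein approximation
  in the variables \<open>k, k + 1, \<dots>\<close> leads from \<open>k = 0\<close>, arbitrary functions, to \<open>k = d\<close>, tensors.\<close>

definition product_form :: "nat \<Rightarrow> nat \<Rightarrow> ((nat \<Rightarrow> real) \<Rightarrow> complex) \<Rightarrow> bool" where
  "product_form d k v \<longleftrightarrow> C_k d (Suc 0) v \<and> (\<exists>w q. (\<forall>i l. cdiff l (q i)) \<and>
     (\<forall>x\<in>topspace (Rtop d). v x = w x * (\<Prod>i<k. of_real (q i (x i)))) \<and>
     (\<forall>x\<in>topspace (Rtop d). \<forall>y\<in>topspace (Rtop d). (\<forall>i<d. k \<le> i \<longrightarrow> x i = y i) \<longrightarrow> w x = w y))"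

lemma product_formE:
  assumes "product_form d k v"
  obtains w q where "\<forall>i l. cdiff l (q i)"
    "\<forall>x\<in>topspace (Rtop d). v x = w x * (\<Prod>i<k. of_real (q i (x i)))"
    "\<forall>x\<in>topspace (Rtop d). \<forall>y\<in>topspace (Rtop d). (\<forall>i<d. k \<le> i \<longrightarrow> x i = y i) \<longrightarrow> w x = w y"
proof -
  have "\<exists>w q. (\<forall>i l. cdiff l (q i)) \<and>
     (\<forall>x\<in>topspace (Rtop d). v x = w x * (\<Prod>i<k. of_real (q i (x i)))) \<and>
     (\<forall>x\<in>topspace (Rtop d). \<forall>y\<in>topspace (Rtop d). (\<forall>i<d. k \<le> i \<longrightarrow> x i = y i) \<longrightarrow> w x = w y)"
    using assms unfolding product_form_def by (rule conjunct2)
  then show ?thesis by (elim exE conjE) (rule that)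
qed

text \<open>Freezing the variable \<open>k\<close> at s makes the remaining factor independent of
  it, and the new factor in \<open>x k\<close> extends the product by one. Each term of
  \<open>Bernstein_op\<close> in the variable \<open>k\<close> has this shape.\<close>

lemma product_form_slice:
  assumes v: "product_form d k v" and k: "k < d" and b: "\<And>l. cdiff l b"
  shows "product_form d (Suc k) (\<lambda>x. of_real (b (x k)) * v (x(k := s)))"
proof -
  obtain w q where q: "\<forall>i l. cdiff l (q i)"
    and w: "\<forall>x\<in>topspace (Rtop d). v x = w x * (\<Prod>i<k. of_real (q i (x i)))"
    and indep: "\<forall>x\<in>topspace (Rtop d). \<forall>y\<in>topspace (Rtop d). (\<forall>i<d. k \<le> i \<longrightarrow> x i = y i) \<longrightarrow> w x = w y"
    by (rule product_formE[OF v])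
  have top: "x(k := s) \<in> topspace (Rtop d)" if "x \<in> topspace (Rtop d)" for x
    using fun_upd_in_Rtop[OF k] that by (simp only: topspace_Rtop)
  have "C_k d (Suc 0) (\<lambda>x. of_real (b (x k)) * v (x(k := s)))"
    using v unfolding product_form_def by (intro C_k_mult C_k_coordinate[OF b k] C_k_slice[OF k]) auto
  moreover have "\<forall>i l. cdiff l ((q(k := b)) i)" using q b by simp
  moreover have "\<forall>x\<in>topspace (Rtop d). of_real (b (x k)) * v (x(k := s)) =
      w (x(k := s)) * (\<Prod>i<Suc k. of_real ((q(k := b)) i (x i)))"
  proof
    fix x assume x: "x \<in> topspace (Rtop d)"
    have "(\<Prod>i<k. complex_of_real (q i ((x(k := s)) i))) = (\<Prod>i<k. of_real (q i (x i)))"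
      "(\<Prod>i<k. complex_of_real ((q(k := b)) i (x i))) = (\<Prod>i<k. of_real (q i (x i)))"
      by (auto intro!: prod.cong)
    then show "of_real (b (x k)) * v (x(k := s)) = w (x(k := s)) * (\<Prod>i<Suc k. of_real ((q(k := b)) i (x i)))"
      unfolding bspec[OF w top[OF x]] prod.lessThan_Suc by (simp only: fun_upd_same mult_ac)
  qed
  moreover have "\<forall>x\<in>topspace (Rtop d). \<forall>y\<in>topspace (Rtop d).
      (\<forall>i<d. Suc k \<le> i \<longrightarrow> x i = y i) \<longrightarrow> w (x(k := s)) = w (y(k := s))"
  proof (intro ballI impI)
    fix x y assume x: "x \<in> topspace (Rtop d)" and y: "y \<in> topspace (Rtop d)" and eq: "\<forall>i<d. Suc k \<le> i \<longrightarrow> x i = y i"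
    show "w (x(k := s)) = w (y(k := s))"
    proof (rule mp[OF bspec[OF bspec[OF indep top[OF x]] top[OF y]]], intro allI impI)
      fix i assume "i < d" "k \<le> i"
      then show "(x(k := s)) i = (y(k := s)) i" using eq by (cases "i = k") auto
    qed
  qed
  ultimately show ?thesis
    unfolding product_form_def
    by (intro conjI exI[of _ "\<lambda>x. w (x(k := s))"] exI[of _ "q(k := b)"])
qed

lemma complex_spanI: "finite t \<Longrightarrow> t \<subseteq> S \<Longrightarrow> f = (\<lambda>x. \<Sum>g\<in>t. c g * g x) \<Longrightarrow> f \<in> complex_span S"
  unfolding complex_span_def by (intro CollectI exI conjI)

lemma complex_span_superset: "f \<in> S \<Longrightarrow> f \<in> complex_span S"
  by (rule complex_spanI[of "{f}" _ _ "\<lambda>_. 1"]) auto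

lemma complex_span_add:
  assumes "f \<in> complex_span S" "g \<in> complex_span S"
  shows "(\<lambda>x. f x + g x) \<in> complex_span S"
proof -
  obtain s a where s: "f = (\<lambda>x. \<Sum>h\<in>s. a h * h x)" "finite s" "s \<subseteq> S"
    using assms(1) unfolding complex_span_def by blast
  obtain t b where t: "g = (\<lambda>x. \<Sum>h\<in>t. b h * h x)" "finite t" "t \<subseteq> S"
    using assms(2) unfolding complex_span_def by blast
  \<comment> \<open>Sums run over sets of functions, so both are extended to the union with
    coefficients 0 and a function occurring in both receives the sum of its coefficients.\<close>
  have "f x + g x = (\<Sum>h\<in>s \<union> t. ((if h \<in> s then a h else 0) + (if h \<in> t then b h else 0)) * h x)" for x
  proof -
    have "f x = (\<Sum>h\<in>s \<union> t. (if h \<in> s then a h else 0) * h x)"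
      unfolding s(1) by (rule sum.mono_neutral_cong_left) (use s t in auto)
    moreover have "g x = (\<Sum>h\<in>s \<union> t. (if h \<in> t then b h else 0) * h x)"
      unfolding t(1) by (rule sum.mono_neutral_cong_left) (use s t in auto)
    ultimately show ?thesis by (simp only: sum.distrib distrib_right)
  qed
  then have "(\<lambda>x. f x + g x) = (\<lambda>x. \<Sum>h\<in>s \<union> t. ((if h \<in> s then a h else 0) + (if h \<in> t then b h else 0)) * h x)"
    by (rule ext)
  moreover have "finite (s \<union> t)" "s \<union> t \<subseteq> S" using s t by auto
  ultimately show ?thesis by (intro complex_spanI)
qed

lemma complex_span_cmult:
  assumes "f \<in> complex_span S"
  shows "(\<lambda>x. c * f x) \<in> complex_span S"
proof -
  obtain s a where s: "f = (\<lambda>x. \<Sum>h\<in>s. a h * h x)" "finite s" "s \<subseteq> S"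
    using assms(1) unfolding complex_span_def by blast
  then have "(\<lambda>x. c * f x) = (\<lambda>x. \<Sum>h\<in>s. (c * a h) * h x)"
    by (simp only: sum_distrib_left mult.assoc)
  then show ?thesis by (rule complex_spanI[OF s(2,3)])
qed

context
  fixes n :: nat and d :: "nat \<Rightarrow> nat" and \<Omega> \<Gamma> H
  assumes open_\<Omega>: "\<And>j. j < n \<Longrightarrow> openin (Rtop (d j)) (\<Omega> j)"
    and H: "\<And>j. j < n \<Longrightarrow> H j = H1_vanishing (d j) (\<Omega> j) (\<Gamma> j)"
begin

lemma open_prod: "openin (Rtop (offset d n)) (prod_set n d \<Omega>)"
  by (rule openin_prod_set[OF open_\<Omega>])

lemma span_subset_H1:
  "complex_span {elem_tensor n d f | f. \<forall>j<n. f j \<in> H j} \<subseteq> H1 (offset d n) (prod_set n d \<Omega>)"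
proof
  fix f assume "f \<in> complex_span {elem_tensor n d f | f. \<forall>j<n. f j \<in> H j}"
  then have "f \<in> H1_vanishing (offset d n) (prod_set n d \<Omega>) (prod_Gamma n d \<Omega> \<Gamma>)"
    using H1_tensor_subset(1)[of n d \<Omega> H \<Gamma>, OF open_\<Omega> H] by blast
  then show "f \<in> H1 (offset d n) (prod_set n d \<Omega>)" by (rule H1_vanishing_H1)
qed

lemma H1_tensor_add:
  assumes "f \<in> H1_tensor n d \<Omega> H" "g \<in> H1_tensor n d \<Omega> H"
  shows "(\<lambda>x. f x + g x) \<in> H1_tensor n d \<Omega> H"
  unfolding H1_tensor_def
proof (rule H1_closure_add[OF open_prod span_subset_H1 _ assms[unfolded H1_tensor_def]])
  let ?S = "complex_span {elem_tensor n d f | f. \<forall>j<n. f j \<in> H j}"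
  fix f g assume fg: "f \<in> ?S" "g \<in> ?S"
  show "\<exists>h\<in>?S. \<forall>x\<in>prod_set n d \<Omega>. h x = f x + g x"
    by (rule bexI[OF _ complex_span_add[OF fg]]) simp
qed

lemma H1_tensor_cmult:
  assumes "f \<in> H1_tensor n d \<Omega> H"
  shows "(\<lambda>x. c * f x) \<in> H1_tensor n d \<Omega> H"
  unfolding H1_tensor_def
proof (rule H1_closure_cmult[OF open_prod span_subset_H1 _ assms[unfolded H1_tensor_def]])
  let ?S = "complex_span {elem_tensor n d f | f. \<forall>j<n. f j \<in> H j}"
  fix f c assume f: "f \<in> ?S"
  show "\<exists>h\<in>?S. \<forall>x\<in>prod_set n d \<Omega>. h x = c * f x"
    by (rule bexI[OF _ complex_span_cmult[OF f, of c]]) simp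
qed

lemma H1_tensor_elem:
  assumes "\<And>j. j < n \<Longrightarrow> f j \<in> H j"
  shows "elem_tensor n d f \<in> H1_tensor n d \<Omega> H"
proof -
  have "elem_tensor n d f \<in> complex_span {elem_tensor n d f | f. \<forall>j<n. f j \<in> H j}"
    using assms by (intro complex_span_superset) blast
  then show ?thesis
    unfolding H1_tensor_def using H1_closure_subset[OF open_prod span_subset_H1] by blast
qed

lemma H1_tensor_cong:
  "f \<in> H1_tensor n d \<Omega> H \<Longrightarrow> (\<And>x. x \<in> prod_set n d \<Omega> \<Longrightarrow> f x = g x) \<Longrightarrow> g \<in> H1_tensor n d \<Omega> H"
  unfolding H1_tensor_def by (rule H1_closure_cong[OF open_prod])

lemma H1_tensor_sum:
  assumes "finite A" "A \<noteq> {}" "\<And>a. a \<in> A \<Longrightarrow> f a \<in> H1_tensor n d \<Omega> H"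
  shows "(\<lambda>x. \<Sum>a\<in>A. f a x) \<in> H1_tensor n d \<Omega> H"
  using assms
proof (induction A rule: finite_ne_induct)
  case (singleton a)
  then show ?case by simp
next
  case (insert a A)
  then have "(\<lambda>x. f a x + (\<Sum>a\<in>A. f a x)) \<in> H1_tensor n d \<Omega> H" by (intro H1_tensor_add) auto
  then show ?case using insert.hyps by simp
qed

lemma test_function_in_H:
  assumes "j < n" "u \<in> test_functions (d j) (topspace (Rtop (d j)) - \<Gamma> j)"
  shows "u \<in> H j"
  unfolding H[OF assms(1)] by (rule H1_vanishing_memI[OF open_\<Omega>[OF assms(1)] assms(2)]) simp

text \<open>When every variable has been split off, what remains of v is a constant and a product
  over single coordinates. Regrouped by blocks, this product is absorbed into the cutoffs, whose
  compact supports make each factor a test function.\<close>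

lemma product_form_full_mult_cutoff:
  assumes \<eta>: "\<And>j. j < n \<Longrightarrow> \<eta> j \<in> test_functions (d j) (topspace (Rtop (d j)) - \<Gamma> j)"
    and v: "product_form (offset d n) (offset d n) v"
  shows "(\<lambda>x. v x * elem_tensor n d \<eta> x) \<in> H1_tensor n d \<Omega> H"
proof -
  let ?D = "offset d n"
  obtain w q where q: "\<forall>i l. cdiff l (q i)"
    and w: "\<forall>x\<in>topspace (Rtop ?D). v x = w x * (\<Prod>i<?D. of_real (q i (x i)))"
    and indep: "\<forall>x\<in>topspace (Rtop ?D). \<forall>y\<in>topspace (Rtop ?D). (\<forall>i<?D. ?D \<le> i \<longrightarrow> x i = y i) \<longrightarrow> w x = w y"
    by (rule product_formE[OF v])
  \<comment> \<open>No variable is left for w to depend on, so its value at the origin is its value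
    everywhere.\<close>
  define c where "c = w (\<lambda>i\<in>{..<?D}. 0)"
  have c: "w x = c" if "x \<in> topspace (Rtop ?D)" for x
    unfolding c_def by (rule mp[OF bspec[OF bspec[OF indep that]]]) simp_all
  define f where "f j y = \<eta> j y * (\<Prod>i<d j. of_real (q (offset d j + i) (y i)))" for j y
  have "f j \<in> test_functions (d j) (topspace (Rtop (d j)) - \<Gamma> j)" if "j < n" for j
    unfolding f_def[abs_def] smooth_def
    by (rule test_functions_mult[OF \<eta>[OF that]]) (auto simp: smooth_def intro!: C_k_prod C_k_coordinate[OF q[rule_format]])
  then have "elem_tensor n d f \<in> H1_tensor n d \<Omega> H"
    by (intro H1_tensor_elem test_function_in_H)
  then have "(\<lambda>x. c * elem_tensor n d f x) \<in> H1_tensor n d \<Omega> H" by (rule H1_tensor_cmult)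
  then show ?thesis
  proof (rule H1_tensor_cong)
    fix x assume "x \<in> prod_set n d \<Omega>"
    then have x: "x \<in> topspace (Rtop ?D)" unfolding prod_set_def by blast
    have "elem_tensor n d f x = elem_tensor n d \<eta> x * (\<Prod>j<n. \<Prod>i<d j. of_real (q (offset d j + i) (block d j x i)))"
      by (simp only: elem_tensor_def f_def prod.distrib)
    also have "(\<Prod>j<n. \<Prod>i<d j. complex_of_real (q (offset d j + i) (block d j x i))) = (\<Prod>i<?D. of_real (q i (x i)))"
      unfolding prod_offset by (intro prod.cong refl) (simp add: block_apply)
    finally show "c * elem_tensor n d f x = v x * elem_tensor n d \<eta> x"
      by (simp only: bspec[OF w x] c[OF x] mult_ac)
  qed
qed

text \<open>Descending induction on the number of variables already split off. One Bernstein
  approximation in the variable \<open>k\<close> gives a finite sum of functions with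
  \<open>Suc k\<close> split variables, which are in the space by induction; v follows because the
  space is closed.\<close>

lemma product_form_mult_cutoff:
  assumes \<eta>: "\<And>j. j < n \<Longrightarrow> \<eta> j \<in> test_functions (d j) (topspace (Rtop (d j)) - \<Gamma> j)"
    and "k \<le> offset d n" and "product_form (offset d n) k v"
  shows "(\<lambda>x. v x * elem_tensor n d \<eta> x) \<in> H1_tensor n d \<Omega> H"
  using assms(2,3)
proof (induction k arbitrary: v rule: inc_induct)
  case base
  show ?case by (rule product_form_full_mult_cutoff[of \<eta>, OF \<eta> base])
next
  case (step k)
  let ?D = "offset d n" and ?X = "elem_tensor n d \<eta>" and ?O = "prod_set n d \<Omega>"
  have v: "C_k ?D (Suc 0) v" using step.prems by (simp add: product_form_def)
  have Xtest: "?X \<in> test_functions ?D (prod_set n d (\<lambda>j. topspace (Rtop (d j)) - \<Gamma> j))"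
    by (rule elem_tensor_test_function[OF \<eta>])
  have X: "C_k ?D (Suc 0) ?X" by (rule smoothD[OF test_functionsD(1)[OF Xtest]])
  obtain R where R: "R > 0" "supp ?D ?X \<subseteq> cube ?D (\<lambda>_. 0) R"
    using compactin_Rtop_bounded[OF test_functionsD(2)[OF Xtest]] .
  let ?C = "cube ?D (\<lambda>_. 0) R" and ?m = "measure (Rmeas ?D) (cube ?D (\<lambda>_. 0) R)"
  obtain B where B: "B > 0" "\<And>x. x \<in> ?C \<Longrightarrow> cmod (?X x) \<le> B"
    "\<And>i x. i < ?D \<Longrightarrow> x \<in> ?C \<Longrightarrow> cmod (partial_deriv i ?X x) \<le> B"
  proof -
    obtain B0 where B0: "B0 > 0" "\<And>x. x \<in> ?C \<Longrightarrow> cmod (?X x) \<le> B0"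
      using continuous_map_compact_bounded[OF C_k_continuous[OF X] compactin_cube] by blast
    have "\<exists>b. \<forall>x\<in>?C. cmod (partial_deriv i ?X x) \<le> b" if "i < ?D" for i
      using continuous_map_compact_bounded[OF C_k_continuous[OF C_k_partial_deriv[OF X that]] compactin_cube] by metis
    then obtain b where b: "\<And>i x. i < ?D \<Longrightarrow> x \<in> ?C \<Longrightarrow> cmod (partial_deriv i ?X x) \<le> b i" by metis
    define B where "B = Max (insert B0 (b ` {..<?D}))"
    have le: "B0 \<le> B" "i < ?D \<Longrightarrow> b i \<le> B" for i unfolding B_def by (auto intro: Max_ge)
    show ?thesis
    proof (rule that)
      show "B > 0" using B0(1) le(1) by linarith
      show "cmod (?X x) \<le> B" if "x \<in> ?C" for x using B0(2)[OF that] le(1) by linarith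
      show "cmod (partial_deriv i ?X x) \<le> B" if "i < ?D" "x \<in> ?C" for i x
        using b[OF that] le(2)[OF that(1)] by linarith
    qed
  qed
  have vX: "weak_grad ?D ?O (\<lambda>x. v x * ?X x) (\<lambda>i. partial_deriv i (\<lambda>x. v x * ?X x))"
  proof (rule weak_grad_C1[OF open_prod C_k_mult[OF v X]])
    show "compactin (Rtop ?D) (supp ?D (\<lambda>x. v x * ?X x))"
      by (rule compactin_supp[OF test_functionsD(2)[OF Xtest]], rule supp_minimal[OF closedin_supp])
        (simp add: not_in_supp)
  qed
  show ?case
    unfolding H1_tensor_def
  proof (rule H1_closure_closed[OF open_prod span_subset_H1 weak_grad_H1[OF vX]])
    fix \<epsilon> :: real assume \<epsilon>: "\<epsilon> > 0"
    \<comment> \<open>The constant of the cutoff estimate with e^2 taken out; the choice of e makes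
      the squared error at most A \<epsilon> / (A + 1), and the 1 covers A = 0.\<close>
    define A where "A = (1 + real ?D) * ((2 * B)\<^sup>2 * ?m)"
    have A: "A \<ge> 0"
      unfolding A_def
      by (intro mult_nonneg_nonneg add_nonneg_nonneg of_nat_0_le_iff zero_le_power2 measure_nonneg zero_le_one)
    define e where "e = sqrt (\<epsilon> / (A + 1))"
    have e: "e > 0" "e\<^sup>2 = \<epsilon> / (A + 1)" using \<epsilon> A by (auto simp: e_def)
    obtain N where N: "\<And>x. x \<in> ?C \<Longrightarrow> cmod (v x - Bernstein_op R k N v x) \<le> e"
      "\<And>j x. j < ?D \<Longrightarrow> x \<in> ?C \<Longrightarrow> cmod (partial_deriv j v x - partial_deriv j (Bernstein_op R k N v) x) \<le> e"
      using Bernstein_op_C1_approx[OF v step.hyps(2) R(1) e(1)] by blast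
    let ?p = "Bernstein_op R k N v"
    have p: "C_k ?D (Suc 0) ?p" by (rule C_k_Bernstein_op[OF step.hyps(2) v])
    have "(\<lambda>x. \<Sum>l\<le>N. of_real (Bernstein N l ((x k + R) / (2 * R))) * v (x(k := - R + 2 * R * (real l / real N))) * ?X x)
        \<in> H1_tensor n d \<Omega> H"
    proof (rule H1_tensor_sum)
      fix l
      show "(\<lambda>x. of_real (Bernstein N l ((x k + R) / (2 * R))) * v (x(k := - R + 2 * R * (real l / real N))) * ?X x)
          \<in> H1_tensor n d \<Omega> H"
        by (rule step.IH[OF product_form_slice[OF step.prems step.hyps(2) cdiff_Bernstein]])
    qed auto
    then have mem: "(\<lambda>x. ?p x * ?X x) \<in> H1_tensor n d \<Omega> H"
      by (simp only: Bernstein_op_def sum_distrib_right)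
    have close: "(H1_norm ?D ?O (\<lambda>x. v x * ?X x - ?p x * ?X x))\<^sup>2 < \<epsilon>"
    proof -
      have "(H1_norm ?D ?O (\<lambda>x. (v x - ?p x) * ?X x))\<^sup>2 \<le> (1 + real ?D) * ((2 * B * e)\<^sup>2 * ?m)"
      proof (rule H1_normsq_mult_cutoff_le[OF open_prod C_k_diff[OF v p] X B(2,3) R(2) N(1)])
        fix i x assume i: "i < ?D" and x: "x \<in> ?C"
        then have "x \<in> topspace (Rtop ?D)" by (simp add: cube_iff)
        from partial_deriv_diff[OF v p i this] N(2)[OF i x]
        show "cmod (partial_deriv i (\<lambda>x. v x - ?p x) x) \<le> e" by simp
      qed (use e B(1) in auto)
      also have "\<dots> = A * (\<epsilon> / (A + 1))" by (simp only: A_def power_mult_distrib e(2) mult_ac)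
      also have "\<dots> < \<epsilon>" using A \<epsilon> by (simp add: field_simps)
      finally show ?thesis by (simp only: left_diff_distrib)
    qed
    show "\<exists>g\<in>H1_closure ?D ?O (complex_span {elem_tensor n d f | f. \<forall>j<n. f j \<in> H j}).
        (H1_norm ?D ?O (\<lambda>x. v x * ?X x - g x))\<^sup>2 < \<epsilon>"
      by (rule bexI[where x = "\<lambda>x. ?p x * ?X x"]) (rule close, rule mem[unfolded H1_tensor_def])
  qed
qed

lemma test_function_in_H1_tensor:
  assumes closed: "\<And>j. j < n \<Longrightarrow> closedin (Rtop (d j)) (\<Gamma> j)"
    and u: "u \<in> test_functions (offset d n) (topspace (Rtop (offset d n)) - prod_Gamma n d \<Omega> \<Gamma>)"
  shows "u \<in> H1_tensor n d \<Omega> H"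
proof -
  let ?D = "offset d n" and ?cl = "\<lambda>j. Rtop (d j) closure_of \<Omega> j"
  \<comment> \<open>The support is cut down to the product of the closures: elsewhere in the support
    a block may lie in its \<Gamma>_j, whereas u has to be reproduced on \<Omega> only.\<close>
  define K where "K = supp ?D u \<inter> prod_set n d ?cl"
  have "closedin (Rtop ?D) (prod_set n d ?cl)" by (rule closedin_prod_set[OF closedin_closure_of])
  then have K: "compactin (Rtop ?D) K"
    unfolding K_def using test_functionsD(2)[OF u] by (intro compact_Int_closedin)
  have "\<exists>\<eta>. \<eta> \<in> test_functions (d j) (topspace (Rtop (d j)) - \<Gamma> j) \<and> (\<forall>y\<in>block d j ` K. \<eta> y = 1)" if j: "j < n" for j
  proof -
    have "compactin (Rtop (d j)) (block d j ` K)" by (rule image_compactin[OF K continuous_map_block[OF j]])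
    moreover have "block d j ` K \<subseteq> topspace (Rtop (d j)) - \<Gamma> j"
    proof
      fix y assume "y \<in> block d j ` K"
      then obtain x where x: "x \<in> K" "y = block d j x" by blast
      have "block d j x \<notin> \<Gamma> j"
      proof
        assume bad: "block d j x \<in> \<Gamma> j"
        have "x \<in> topspace (Rtop ?D)" "\<And>l. l < n \<Longrightarrow> block d l x \<in> ?cl l"
          using x(1) unfolding K_def prod_set_def by blast+
        then have "x \<in> prod_set n d (\<lambda>l. if l = j then \<Gamma> l else ?cl l)"
          using bad unfolding prod_set_def by auto
        then have "x \<in> prod_Gamma n d \<Omega> \<Gamma>" using j unfolding prod_Gamma_def by blast
        then show False using x(1) test_functionsD(3)[OF u] unfolding K_def by blast
      qed
      then show "y \<in> topspace (Rtop (d j)) - \<Gamma> j" using x(2) block_in by simp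
    qed
    moreover have "openin (Rtop (d j)) (topspace (Rtop (d j)) - \<Gamma> j)"
      using closed[OF j] by (simp only: closedin_def)
    ultimately show ?thesis by (metis exists_cutoff)
  qed
  then obtain \<eta> where \<eta>: "\<And>j. j < n \<Longrightarrow> \<eta> j \<in> test_functions (d j) (topspace (Rtop (d j)) - \<Gamma> j)"
    "\<And>j y. j < n \<Longrightarrow> y \<in> block d j ` K \<Longrightarrow> \<eta> j y = 1" by metis
  \<comment> \<open>Nothing is split off at the start: the product is empty and w is u, and points
    that agree in all coordinates are equal by extensionality.\<close>
  have "product_form ?D 0 u"
    unfolding product_form_def
  proof (intro conjI exI)
    show "C_k ?D (Suc 0) u" by (rule smoothD[OF test_functionsD(1)[OF u]])
    show "\<forall>i l. cdiff l ((\<lambda>_ _. 1 :: real) i)" by (simp add: cdiff_const)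
    show "\<forall>x\<in>topspace (Rtop ?D). u x = u x * (\<Prod>i<0. of_real ((\<lambda>_ _. 1 :: real) i (x i)))" by simp
    show "\<forall>x\<in>topspace (Rtop ?D). \<forall>y\<in>topspace (Rtop ?D). (\<forall>i<?D. 0 \<le> i \<longrightarrow> x i = y i) \<longrightarrow> u x = u y"
    proof (intro ballI impI)
      fix x y assume "x \<in> topspace (Rtop ?D)" "y \<in> topspace (Rtop ?D)" "\<forall>i<?D. 0 \<le> i \<longrightarrow> x i = y i"
      then have "x = y" by (intro PiE_ext[of x "{..<?D}" "\<lambda>_. UNIV" y]) auto
      then show "u x = u y" by simp
    qed
  qed
  then have "(\<lambda>x. u x * elem_tensor n d \<eta> x) \<in> H1_tensor n d \<Omega> H"
    by (intro product_form_mult_cutoff[of \<eta> 0] \<eta>(1) le0)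
  then show ?thesis
  proof (rule H1_tensor_cong)
    fix x assume x: "x \<in> prod_set n d \<Omega>"
    have xt: "x \<in> topspace (Rtop ?D)" using x unfolding prod_set_def by blast
    \<comment> \<open>The cutoffs are known to be 1 only on the projections of K; at points of
      \<Omega> off the support of u both sides vanish.\<close>
    show "u x * elem_tensor n d \<eta> x = u x"
    proof (cases "x \<in> supp ?D u")
      case True
      have "x \<in> prod_set n d ?cl"
        using x closure_of_subset[OF openin_subset[OF open_\<Omega>]] unfolding prod_set_def by blast
      then have "x \<in> K" using True by (simp add: K_def)
      then have "elem_tensor n d \<eta> x = 1" unfolding elem_tensor_def by (intro prod.neutral) (auto simp: \<eta>(2))
      then show ?thesis by simp
    next
      case False
      then show ?thesis using not_in_supp[OF xt] by simp
    qed
  qed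
qed

lemma H1_vanishing_eq_H1_tensor:
  assumes closed: "\<And>j. j < n \<Longrightarrow> closedin (Rtop (d j)) (\<Gamma> j)"
  shows "H1_vanishing (offset d n) (prod_set n d \<Omega>) (prod_Gamma n d \<Omega> \<Gamma>) = H1_tensor n d \<Omega> H"
proof
  let ?D = "offset d n" and ?O = "prod_set n d \<Omega>"
  show "H1_tensor n d \<Omega> H \<subseteq> H1_vanishing ?D ?O (prod_Gamma n d \<Omega> \<Gamma>)"
    by (rule H1_tensor_subset(2)[of n d \<Omega> H \<Gamma>, OF open_\<Omega> H])
  have "restrict u ?O \<in> H1_tensor n d \<Omega> H"
    if "u \<in> test_functions ?D (topspace (Rtop ?D) - prod_Gamma n d \<Omega> \<Gamma>)" for u
    by (rule H1_tensor_cong[OF test_function_in_H1_tensor[OF closed that]]) simp_all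
  then show "H1_vanishing ?D ?O (prod_Gamma n d \<Omega> \<Gamma>) \<subseteq> H1_tensor n d \<Omega> H"
    unfolding H1_vanishing_def H1_tensor_def by (intro H1_closure_mono_closure[OF open_prod _ span_subset_H1]) blast
qed

end

theorem proposition3p4:
  fixes n :: nat and d :: "nat \<Rightarrow> nat"
    and \<Omega> \<Gamma> :: "nat \<Rightarrow> (nat \<Rightarrow> real) set"
    and D :: nat and \<Omega>' \<Gamma>' :: "(nat \<Rightarrow> real) set"
    and V :: "((nat \<Rightarrow> real) \<Rightarrow> complex) set"
    and H :: "nat \<Rightarrow> ((nat \<Rightarrow> real) \<Rightarrow> complex) set"
  assumes "n \<ge> 2"
    and "\<forall>j<n. d j \<ge> 1"
    and "\<forall>j<n. openin (Rtop (d j)) (\<Omega> j)"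
    and "\<forall>j<n. closedin (Rtop (d j)) (\<Gamma> j) \<and> \<Gamma> j \<subseteq> Rtop (d j) frontier_of \<Omega> j"
    and "D = (\<Sum>j<n. d j)"
    and "\<Omega>' = prod_set n d \<Omega>"
    and "\<Gamma>' = prod_Gamma n d \<Omega> \<Gamma>"
    and "V = H1_vanishing D \<Omega>' \<Gamma>'"
    and "\<forall>j<n. H j = H1_vanishing (d j) (\<Omega> j) (\<Gamma> j)"
  shows "(\<forall>T \<Delta>. associated_op D \<Omega>' (H1_tensor n d \<Omega> H) T \<longrightarrow> is_laplacian D \<Omega>' V \<Delta>
            \<longrightarrow> T = op_uminus \<Delta>) \<and>
         V = H1_tensor n d \<Omega> H"
proof -
  have V: "V = H1_tensor n d \<Omega> H"
    unfolding assms(5-8) by (rule H1_vanishing_eq_H1_tensor) (use assms(3,4,9) in blast)+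
  then show ?thesis
    unfolding is_laplacian_def using associated_op_unique by blast
qed

end
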